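(* Consider the Schrödinger--Lohe system $$i\partial_t\psi_j=-\frac12\Delta\psi_j+(V+\Omega_j)\psi_j+i\frac{K}{2N}\sum_{\ell=1}^N\left(\psi_\ell-\langle\psi_\ell,\psi_j\rangle\psi_j\right),\qquad j=1,\dots,N,$$ with $K>0$, and let $(\psi_1,\dots,\psi_N)\in C([0,\infty);H^1(\mathbf{R}^d))$ be the solution with initial data $\psi_j(0)=\psi_{j,0}\in H^1(\mathbf{R}^d)$, $\|\psi_{j,0}\|_{L^2}=1$. Assume that one of the following holds: (a) $N=2$, $\Omega_1=-\Omega_2=\Omega\ge0$, and, with $\Lambda:=\frac{2\Omega}{K}$, either $0\le\Lambda<1$ and $\langle\psi_{1,0},\psi_{2,0}\rangle\neq-\sqrt{1-\Lambda^2}+i\Lambda$, or $\Lambda=1$ and $\langle\psi_{1,0},\psi_{2,0}\rangle\neq i$; (b) $N\ge2$, $\Omega_j=0$ for all $j$, and $\operatorname{Re}\langle\zeta(0),\psi_{j,0}\rangle>0$ for all $j=1,\dots,N$, where $\zeta:=\frac1N\sum_{\ell=1}^N\psi_\ell$. Let $\rho_j:=|\psi_j|^2$ and $J_j:=\operatorname{Im}(\overline{\psi_j}\nabla\psi_j)$. Then $$\lim_{t\to\infty}\|\rho_j(t)-\rho_k(t)\|_{L^1}=\lim_{t\to\infty}\|J_j(t)-J_k(t)\|_{L^1}=0\qquad\text{for all } j,k=1,\dots,N.$$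
   Context: $\langle f,g\rangle:=\int_{\mathbf{R}^d}\overline{f(x)}g(x)\,dx$ (conjugate-linear in the first argument). The potential $V:\mathbf{R}^d\to\mathbf{R}$ is real-valued and time-independent, $V\in L^p(\mathbf{R}^d)+L^\infty(\mathbf{R}^d)$ with $p>\max\{1,d/2\}$. Solutions are understood in the usual mild (Duhamel) sense with respect to the unitary group $e^{-it(-\frac12\Delta+V)}$; the system is globally well-posed in $L^2(\mathbf{R}^d)$ and in $H^1(\mathbf{R}^d)$, and the $L^2$ norm of each $\psi_j$ is conserved. *)

theory Defs
  imports "HOL-Analysis.Analysis"
begin

section \<open>The Hilbert space of square-integrable functions\<close>

definition square_integrable :: "('a::euclidean_space \<Rightarrow> complex) \<Rightarrow> bool" where
  "square_integrable f \<longleftrightarrow>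
     f \<in> borel_measurable lborel \<and> integrable lborel (\<lambda>x. (norm (f x))\<^sup>2)"

definition L2_rel :: "('a::euclidean_space \<Rightarrow> complex) \<Rightarrow> ('a \<Rightarrow> complex) \<Rightarrow> bool" where
  "L2_rel f g \<longleftrightarrow>
     square_integrable f \<and> square_integrable g \<and> (AE x in lborel. f x = g x)"

lemma square_integrable_zero: "square_integrable (\<lambda>x. 0)"
  by (simp add: square_integrable_def)

lemma square_integrable_scale:
  assumes "square_integrable f"
  shows "square_integrable (\<lambda>x. c * f x)"
  using assms by (auto simp: square_integrable_def norm_mult power_mult_distrib)

lemma square_integrable_add:
  assumes "square_integrable f" "square_integrable g"
  shows "square_integrable (\<lambda>x. f x + g x)"
proof -
  have [measurable]: "f \<in> borel_measurable lborel" "g \<in> borel_measurable lborel"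
    using assms by (auto simp: square_integrable_def)
  have bound: "(norm (a + b))\<^sup>2 \<le> 2 * (norm a)\<^sup>2 + 2 * (norm b)\<^sup>2" for a b :: complex
  proof -
    have "(norm (a + b))\<^sup>2 \<le> (norm a + norm b)\<^sup>2"
      by (intro power_mono norm_triangle_ineq) simp
    also have "\<dots> \<le> 2 * (norm a)\<^sup>2 + 2 * (norm b)\<^sup>2"
      using sum_squares_bound[of "norm a" "norm b"] by (simp add: power2_sum)
    finally show ?thesis .
  qed
  have "integrable lborel (\<lambda>x. (norm (f x + g x))\<^sup>2)"
  proof (rule Bochner_Integration.integrable_bound)
    show "integrable lborel (\<lambda>x. 2 * (norm (f x))\<^sup>2 + 2 * (norm (g x))\<^sup>2)"
      using assms by (auto simp: square_integrable_def)
    show "AE x in lborel. norm ((norm (f x + g x))\<^sup>2)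
            \<le> norm (2 * (norm (f x))\<^sup>2 + 2 * (norm (g x))\<^sup>2)"
      using bound by (auto intro!: AE_I2 simp: abs_of_nonneg)
  qed measurable
  then show ?thesis by (simp add: square_integrable_def)
qed

lemma square_integrable_cnj_mult:
  assumes "square_integrable f" "square_integrable g"
  shows "integrable lborel (\<lambda>x. cnj (f x) * g x)"
proof (rule Bochner_Integration.integrable_bound)
  have [measurable]: "f \<in> borel_measurable lborel" "g \<in> borel_measurable lborel"
    using assms by (auto simp: square_integrable_def)
  have "(\<lambda>x. cnj (f x)) \<in> borel_measurable lborel"
    by (rule borel_measurable_continuous_on[where f = cnj]) (auto intro: continuous_intros)
  then show "(\<lambda>x. cnj (f x) * g x) \<in> borel_measurable lborel"
    by (rule borel_measurable_times) fact
  show "integrable lborel (\<lambda>x. (norm (f x))\<^sup>2 + (norm (g x))\<^sup>2)"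
    using assms by (auto simp: square_integrable_def)
  have "norm a * norm b \<le> (norm a)\<^sup>2 + (norm b)\<^sup>2" for a b :: complex
    using sum_squares_bound[of "norm a" "norm b"] mult_nonneg_nonneg[of "norm a" "norm b"]
    by (simp del: mult_nonneg_nonneg)
  then show "AE x in lborel. norm (cnj (f x) * g x)
      \<le> norm ((norm (f x))\<^sup>2 + (norm (g x))\<^sup>2)"
    by (auto intro!: AE_I2 simp: norm_mult abs_of_nonneg)
qed

quotient_type (overloaded) 'a L2 = "'a::euclidean_space \<Rightarrow> complex" / partial: L2_rel
proof (rule part_equivpI)
  show "\<exists>f::'a \<Rightarrow> complex. L2_rel f f"
    by (rule exI[of _ "\<lambda>x. 0"]) (simp add: L2_rel_def square_integrable_zero)
  show "symp (L2_rel :: ('a \<Rightarrow> complex) \<Rightarrow> _)"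
    by (auto simp: symp_def L2_rel_def elim: AE_mp)
  show "transp (L2_rel :: ('a \<Rightarrow> complex) \<Rightarrow> _)"
    by (auto simp: transp_def L2_rel_def elim: AE_mp)
qed

lift_definition cinner :: "'a::euclidean_space L2 \<Rightarrow> 'a L2 \<Rightarrow> complex" ("\<langle>_, _\<rangle>")
  is "\<lambda>f g. LINT x|lborel. cnj (f x) * g x"
proof (rule integral_cong_AE)
  fix f f' g g' :: "'a \<Rightarrow> complex"
  assume rel: "L2_rel f f'" "L2_rel g g'"
  then show "(\<lambda>x. cnj (f x) * g x) \<in> borel_measurable lborel"
    "(\<lambda>x. cnj (f' x) * g' x) \<in> borel_measurable lborel"
    using square_integrable_cnj_mult borel_measurable_integrable
    unfolding L2_rel_def by blast+
  show "AE x in lborel. cnj (f x) * g x = cnj (f' x) * g' x"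
    using rel by (auto simp: L2_rel_def)
qed

lift_definition scaleC :: "complex \<Rightarrow> 'a::euclidean_space L2 \<Rightarrow> 'a L2" (infixr "*\<^sub>C" 75)
  is "\<lambda>c f x. c * f x"
  by (auto simp: L2_rel_def square_integrable_scale elim!: AE_mp intro!: AE_I2)

instantiation L2 :: (euclidean_space) real_vector
begin

lift_definition zero_L2 :: "'a L2" is "\<lambda>x. 0"
  by (simp add: L2_rel_def square_integrable_zero)

lift_definition plus_L2 :: "'a L2 \<Rightarrow> 'a L2 \<Rightarrow> 'a L2" is "\<lambda>f g x. f x + g x"
  by (auto simp: L2_rel_def square_integrable_add)

definition uminus_L2 :: "'a L2 \<Rightarrow> 'a L2" where "uminus_L2 u = (-1) *\<^sub>C u"

definition minus_L2 :: "'a L2 \<Rightarrow> 'a L2 \<Rightarrow> 'a L2" where "minus_L2 u v = u + (- v)"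

definition scaleR_L2 :: "real \<Rightarrow> 'a L2 \<Rightarrow> 'a L2" where
  "scaleR_L2 r u = complex_of_real r *\<^sub>C u"

instance
proof
  fix u v w :: "'a L2" and r s :: real
  show "u + v + w = u + (v + w)"
    by transfer (auto simp: L2_rel_def square_integrable_add add.assoc)
  show "u + v = v + u"
    by transfer (auto simp: L2_rel_def square_integrable_add add.commute)
  show "0 + u = u"
    by transfer (auto simp: L2_rel_def)
  show "- u + u = 0"
    unfolding uminus_L2_def
    by transfer (auto simp: L2_rel_def square_integrable_zero)
  show "u - v = u + - v" by (simp add: minus_L2_def)
  show "r *\<^sub>R (u + v) = r *\<^sub>R u + r *\<^sub>R v"
    unfolding scaleR_L2_def
    by transfer (auto simp: L2_rel_def distrib_left intro!: square_integrable_add square_integrable_scale)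
  show "(r + s) *\<^sub>R u = r *\<^sub>R u + s *\<^sub>R u"
    unfolding scaleR_L2_def
    by transfer (auto simp: L2_rel_def distrib_right intro!: square_integrable_add square_integrable_scale)
  show "r *\<^sub>R s *\<^sub>R u = (r * s) *\<^sub>R u"
    unfolding scaleR_L2_def
    by transfer (auto simp: L2_rel_def mult.assoc intro!: square_integrable_scale)
  show "1 *\<^sub>R u = u"
    unfolding scaleR_L2_def by transfer (auto simp: L2_rel_def)
qed

end

instantiation L2 :: (euclidean_space) real_inner
begin

definition inner_L2 :: "'a L2 \<Rightarrow> 'a L2 \<Rightarrow> real" where "inner_L2 u v = Re \<langle>u, v\<rangle>"

definition norm_L2 :: "'a L2 \<Rightarrow> real" where "norm_L2 u = sqrt (inner u u)"

definition sgn_L2 :: "'a L2 \<Rightarrow> 'a L2" where "sgn_L2 u = u /\<^sub>R norm u"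

definition dist_L2 :: "'a L2 \<Rightarrow> 'a L2 \<Rightarrow> real" where "dist_L2 u v = norm (u - v)"

definition uniformity_L2 :: "('a L2 \<times> 'a L2) filter" where
  "uniformity_L2 = (INF e\<in>{0 <..}. principal {(u, v). dist u v < e})"

definition open_L2 :: "'a L2 set \<Rightarrow> bool" where
  "open_L2 S = (\<forall>u\<in>S. \<forall>\<^sub>F (u', v) in uniformity. u' = u \<longrightarrow> v \<in> S)"

instance
proof
  fix u v w :: "'a L2" and r :: real
  show "dist u v = norm (u - v)" by (simp add: dist_L2_def)
  show "sgn u = u /\<^sub>R norm u" by (simp add: sgn_L2_def)
  show "(uniformity :: ('a L2 \<times> 'a L2) filter) = (INF e\<in>{0 <..}. principal {(u, v). dist u v < e})"
    by (simp add: uniformity_L2_def)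
  show "open S = (\<forall>u\<in>S. \<forall>\<^sub>F (u', v) in uniformity. u' = u \<longrightarrow> v \<in> S)" for S :: "'a L2 set"
    by (simp add: open_L2_def)
  show "norm u = sqrt (inner u u)" by (simp add: norm_L2_def)
  have cnj_sym: "\<langle>v, u\<rangle> = cnj \<langle>u, v\<rangle>"
    by transfer (subst Bochner_Integration.integral_cnj[symmetric], simp add: mult.commute)
  then show "inner u v = inner v u" by (simp add: inner_L2_def)
  have "\<langle>u + v, w\<rangle> = \<langle>u, w\<rangle> + \<langle>v, w\<rangle>"
    by transfer
       (auto simp: L2_rel_def distrib_right square_integrable_cnj_mult
             intro!: Bochner_Integration.integral_add)
  then show "inner (u + v) w = inner u w + inner v w" by (simp add: inner_L2_def)
  have "\<langle>complex_of_real r *\<^sub>C u, v\<rangle> = complex_of_real r * \<langle>u, v\<rangle>"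
    by transfer (simp add: mult.assoc)
  then show "inner (r *\<^sub>R u) v = r * inner u v"
    by (simp add: inner_L2_def scaleR_L2_def)
  have self: "\<langle>u, u\<rangle> = complex_of_real (LINT x|lborel. (norm (rep_L2 u x))\<^sup>2)"
    unfolding cinner.rep_eq
    by (subst integral_complex_of_real[symmetric])
       (rule Bochner_Integration.integral_cong, simp_all add: complex_norm_square mult.commute del: of_real_power)
  then show "0 \<le> inner u u" by (simp add: inner_L2_def)
  have rep: "square_integrable (rep_L2 u)"
    using Quotient_rep_reflp[OF Quotient_L2, of u] by (simp add: L2_rel_def)
  have "inner u u = 0 \<longleftrightarrow> (AE x in lborel. (norm (rep_L2 u x))\<^sup>2 = 0)"
    using rep by (simp add: inner_L2_def self square_integrable_def integral_nonneg_eq_0_iff_AE)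
  also have "\<dots> \<longleftrightarrow> L2_rel (rep_L2 u) (\<lambda>x. 0)"
    using rep by (simp add: L2_rel_def square_integrable_zero)
  also have "\<dots> \<longleftrightarrow> u = 0"
    using rep Quotient_rel_abs2[OF Quotient_L2] Quotient_abs_rep[OF Quotient_L2]
      Quotient_rel[OF Quotient_L2, of "rep_L2 u" "\<lambda>x. 0"]
    by (auto simp: zero_L2_def L2_rel_def square_integrable_zero)
  finally show "inner u u = 0 \<longleftrightarrow> u = 0" .
qed

end


section \<open>The Sobolev space \<open>H\<^sup>1\<close>\<close>

coinductive smooth :: "('a::euclidean_space \<Rightarrow> real) \<Rightarrow> bool" where
  "(\<And>x. (f has_derivative (\<lambda>h. \<Sum>b\<in>Basis. inner h b * g b x)) (at x)) \<Longrightarrow>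
   (\<And>b. b \<in> Basis \<Longrightarrow> smooth (g b)) \<Longrightarrow> smooth f"

definition test_function :: "('a::euclidean_space \<Rightarrow> real) \<Rightarrow> bool" where
  "test_function \<phi> \<longleftrightarrow> smooth \<phi> \<and> compact (closure {x. \<phi> x \<noteq> 0})"

definition has_weak_deriv :: "'a::euclidean_space L2 \<Rightarrow> 'a \<Rightarrow> 'a L2 \<Rightarrow> bool" where
  "has_weak_deriv u b v \<longleftrightarrow>
     (\<forall>\<phi>. test_function \<phi> \<longrightarrow>
        (LINT x|lborel. rep_L2 u x * complex_of_real (frechet_derivative \<phi> (at x) b))
        = - (LINT x|lborel. rep_L2 v x * complex_of_real (\<phi> x)))"

definition weak_deriv :: "'a::euclidean_space L2 \<Rightarrow> 'a \<Rightarrow> 'a L2" where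
  "weak_deriv u b = (THE v. has_weak_deriv u b v)"

definition H1 :: "'a::euclidean_space L2 set" where
  "H1 = {u. \<forall>b\<in>Basis. \<exists>v. has_weak_deriv u b v}"

definition H1_norm :: "'a::euclidean_space L2 \<Rightarrow> real" where
  "H1_norm u = sqrt ((norm u)\<^sup>2 + (\<Sum>b\<in>Basis. (norm (weak_deriv u b))\<^sup>2))"

definition continuous_on_H1 :: "real set \<Rightarrow> (real \<Rightarrow> 'a::euclidean_space L2) \<Rightarrow> bool" where
  "continuous_on_H1 T \<psi> \<longleftrightarrow>
     (\<forall>t\<in>T. \<psi> t \<in> H1) \<and>
     (\<forall>t\<in>T. ((\<lambda>s. H1_norm (\<psi> s - \<psi> t)) \<longlongrightarrow> 0) (at t within T))"


section \<open>The linear Schroedinger group\<close>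

definition Lp_plus_Linfty :: "real \<Rightarrow> ('a::euclidean_space \<Rightarrow> real) \<Rightarrow> bool" where
  "Lp_plus_Linfty p V \<longleftrightarrow>
     (\<exists>V1 V2 C. V1 \<in> borel_measurable lborel \<and> integrable lborel (\<lambda>x. \<bar>V1 x\<bar> powr p) \<and>
        V2 \<in> borel_measurable lborel \<and> (AE x in lborel. \<bar>V2 x\<bar> \<le> C) \<and>
        V = (\<lambda>x. V1 x + V2 x))"

text \<open>The graph of the self-adjoint operator \<open>-\<Delta>/2 + V\<close>, taken as a form sum with
  form domain \<open>H\<^sup>1\<close>: for \<open>p > max 1 (d/2)\<close> the potential is infinitesimally form-bounded
  with respect to \<open>-\<Delta>\<close>, but in general it is not operator-bounded.\<close>

definition schroedinger_op ::
    "('a::euclidean_space \<Rightarrow> real) \<Rightarrow> 'a L2 \<Rightarrow> 'a L2 \<Rightarrow> bool" where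
  "schroedinger_op V u w \<longleftrightarrow>
     u \<in> H1 \<and>
     (\<forall>\<phi>\<in>H1. (1/2) * (\<Sum>b\<in>Basis. \<langle>weak_deriv \<phi> b, weak_deriv u b\<rangle>)
         + (LINT x|lborel. cnj (rep_L2 \<phi> x) * complex_of_real (V x) * rep_L2 u x)
       = \<langle>\<phi>, w\<rangle>)"

definition unitary_group :: "(real \<Rightarrow> 'a::euclidean_space L2 \<Rightarrow> 'a L2) \<Rightarrow> bool" where
  "unitary_group U \<longleftrightarrow>
     (\<forall>t u v. U t (u + v) = U t u + U t v) \<and>
     (\<forall>t c u. U t (c *\<^sub>C u) = c *\<^sub>C U t u) \<and>
     (\<forall>t. surj (U t)) \<and>
     (\<forall>t u v. \<langle>U t u, U t v\<rangle> = \<langle>u, v\<rangle>) \<and>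
     (\<forall>u. U 0 u = u) \<and>
     (\<forall>s t u. U (s + t) u = U s (U t u)) \<and>
     (\<forall>u. continuous_on UNIV (\<lambda>t. U t u))"

text \<open>\<open>U t = exp (-i t (-\<Delta>/2 + V))\<close>: by Stone's theorem this is the unique strongly
  continuous unitary group with infinitesimal generator \<open>-i (-\<Delta>/2 + V)\<close>.\<close>

definition schroedinger_group ::
    "('a::euclidean_space \<Rightarrow> real) \<Rightarrow> (real \<Rightarrow> 'a L2 \<Rightarrow> 'a L2) \<Rightarrow> bool" where
  "schroedinger_group V U \<longleftrightarrow>
     unitary_group U \<and>
     (\<forall>u w. ((\<lambda>t. U t u) has_vector_derivative (- \<i>) *\<^sub>C w) (at 0)
              \<longleftrightarrow> schroedinger_op V u w)"


section \<open>The Schroedinger--Lohe system\<close>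

text \<open>The terms on the right-hand side of
  \<open>i \<partial>\<^sub>t \<psi>\<^sub>j = (-\<Delta>/2 + V) \<psi>\<^sub>j + \<dots>\<close> other than the linear part.\<close>

definition lohe_term ::
    "nat \<Rightarrow> real \<Rightarrow> (nat \<Rightarrow> real) \<Rightarrow> (nat \<Rightarrow> 'a::euclidean_space L2) \<Rightarrow> nat \<Rightarrow> 'a L2" where
  "lohe_term N K \<Omega> \<psi> j =
     complex_of_real (\<Omega> j) *\<^sub>C \<psi> j
     + (\<i> * complex_of_real (K / (2 * real N))) *\<^sub>C
         (\<Sum>l=1..N. \<psi> l - \<langle>\<psi> l, \<psi> j\<rangle> *\<^sub>C \<psi> j)"

definition schroedinger_lohe_solution ::
    "('a::euclidean_space \<Rightarrow> real) \<Rightarrow> nat \<Rightarrow> real \<Rightarrow> (nat \<Rightarrow> real) \<Rightarrow>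
     (nat \<Rightarrow> 'a L2) \<Rightarrow> (nat \<Rightarrow> real \<Rightarrow> 'a L2) \<Rightarrow> bool" where
  "schroedinger_lohe_solution V N K \<Omega> \<psi>init \<psi> \<longleftrightarrow>
     (\<exists>U. schroedinger_group V U \<and>
       (\<forall>j\<in>{1..N}. \<forall>t\<ge>0. \<exists>D.
          ((\<lambda>s. U (t - s) (lohe_term N K \<Omega> (\<lambda>l. \<psi> l s) j)) has_integral D) {0..t} \<and>
          \<psi> j t = U t (\<psi>init j) - \<i> *\<^sub>C D))"

definition mass_density :: "'a::euclidean_space L2 \<Rightarrow> 'a \<Rightarrow> real" where
  "mass_density u x = (norm (rep_L2 u x))\<^sup>2"

definition current_density :: "'a::euclidean_space L2 \<Rightarrow> 'a \<Rightarrow> 'a" where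
  "current_density u x = (\<Sum>b\<in>Basis. Im (cnj (rep_L2 u x) * rep_L2 (weak_deriv u b) x) *\<^sub>R b)"

definition L1_norm :: "('a::euclidean_space \<Rightarrow> 'b::real_normed_vector) \<Rightarrow> ennreal" where
  "L1_norm f = (\<integral>\<^sup>+ x. ennreal (norm (f x)) \<partial>lborel)"

end

theory Submission
  imports Defs
begin

text \<open>Mass and current densities do not change when a state is multiplied by a phase. It is therefore
  enough that the moduli of the overlaps \<open>|\<langle>\<psi> j, \<psi> k\<rangle>|\<close> tend to one, provided that convergence in
  \<open>L2\<close> can be upgraded to convergence of gradients.

  \<^emph>\<open>Overlaps.\<close> The coupling only involves inner products, so it commutes with the Schroedinger group
  \<open>U\<close>, and \<open>\<phi> j t = U (- t) (\<psi> j t)\<close> solves an ordinary differential equation in \<open>L2\<close> with the same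
  overlaps (\<open>interaction_picture\<close>); it keeps the states normalised (\<open>norm_\<phi>\<close>). For two states with
  opposite frequencies, the overlap solves an autonomous complex Riccati equation. Its fixed points
  have modulus one, and they coincide in the critical case; from every admitted initial value in the
  closed unit disc, the overlap converges to one of them
  (\<open>overlap_limit_subcritical\<close>, \<open>overlap_limit_critical\<close>). For identical frequencies, the length of
  the centroid does not decrease, and Barbalat's lemma makes its rate of growth vanish; this forces
  every state towards the complex line of the centroid (\<open>overlap_limit_identical\<close>).

  \<^emph>\<open>Gradients.\<close> For unit vectors and \<open>c = \<langle>\<psi> k, \<psi> j\<rangle>\<close>, the difference \<open>\<psi> j - c \<psi> k\<close> has squared
  norm \<open>1 - |c|\<^sup>2\<close>, which tends to zero. All \<open>\<phi> j t\<close> stay in the finite-dimensional complex span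
  \<open>S\<close> of the initial data (\<open>flow_in_span\<close>). The group conserves the energy form, and the energy form
  controls the gradient, because the potential is infinitesimally form-bounded with respect to the
  Dirichlet form. On the finite-dimensional space \<open>S\<close> this yields a constant \<open>M\<close>, independent of
  time, with \<open>|\<nabla> (U t x)| \<le> M |x|\<close> (\<open>span_H1_bound\<close>). Hence the gradient of
  \<open>\<psi> j - c \<psi> k = U t (\<phi> j - c \<phi> k)\<close> tends to zero as well, and the densities converge in \<open>L1\<close>
  (\<open>densities_synchronize\<close>).

  \<^emph>\<open>Form-boundedness.\<close> The estimate \<open>\<integral> |V| |u|\<^sup>2 \<le> \<epsilon> |\<nabla> u|\<^sup>2 + C |u|\<^sup>2\<close> for \<open>V\<close> in \<open>Lp\<close> with
  \<open>p > max 1 (d / 2)\<close> is derived without Sobolev inequalities. Averaging \<open>u\<close> over cubes of side \<open>h\<close>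
  makes it square-integrable against \<open>|V|\<close> with norm of order \<open>h powr (- d / (2 p))\<close>, and moves it by
  at most \<open>h |\<nabla> u|\<close>. Summation over dyadic \<open>h\<close> converges because \<open>d / (2 p) < 1\<close>
  (\<open>norm_mult_sqrt_le\<close>). Completeness of the energy form then gives that the domain of the
  Schroedinger operator is dense in \<open>H1\<close> for the energy norm (\<open>Dom_dense\<close>), so that conservation of
  energy extends from the domain to \<open>H1\<close> (\<open>E_group\<close>).\<close>

section \<open>Square-integrable functions as a complex Hilbert space\<close>

lemma square_integrable_rep: "square_integrable (rep_L2 u)"
  using Quotient_rep_reflp[OF Quotient_L2, of u] by (simp add: L2_rel_def)

lemma rep_L2_measurable [measurable]: "rep_L2 u \<in> borel_measurable borel"
  using square_integrable_rep[of u] by (simp add: square_integrable_def)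

lemma integrable_rep_L2_sq: "integrable lborel (\<lambda>x. (norm (rep_L2 u x))\<^sup>2)"
  using square_integrable_rep[of u] by (simp add: square_integrable_def)

lemma rep_abs_L2:
  assumes "square_integrable f"
  shows "AE x in lborel. rep_L2 (abs_L2 f) x = f x"
  using Quotient_rep_abs[OF Quotient_L2, of f] assms by (simp add: L2_rel_def)

lemma L2_eqI:
  assumes "AE x in lborel. rep_L2 u x = rep_L2 v x"
  shows "u = v"
  using Quotient_rel_rep[OF Quotient_L2, of u v] assms
  by (simp add: L2_rel_def square_integrable_rep)

lemma rep_plus_L2: "AE x in lborel. rep_L2 (u + v) x = rep_L2 u x + rep_L2 v x"
proof -
  have "u + v = abs_L2 (\<lambda>x. rep_L2 u x + rep_L2 v x)"
    by (simp add: plus_L2_def)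
  then show ?thesis
    using rep_abs_L2[OF square_integrable_add[OF square_integrable_rep square_integrable_rep], of u v]
    by simp
qed

lemma rep_scaleC: "AE x in lborel. rep_L2 (c *\<^sub>C u) x = c * rep_L2 u x"
proof -
  have "c *\<^sub>C u = abs_L2 (\<lambda>x. c * rep_L2 u x)"
    by (simp add: scaleC_def)
  then show ?thesis
    using rep_abs_L2[OF square_integrable_scale[OF square_integrable_rep], of c u] by simp
qed

lemma rep_zero_L2: "AE x in lborel. rep_L2 0 x = 0"
  unfolding zero_L2_def by (rule rep_abs_L2[OF square_integrable_zero])

lemma minus_L2_eq_scaleC: "u - v = u + (-1) *\<^sub>C (v :: 'a::euclidean_space L2)"
  by (simp add: minus_L2_def uminus_L2_def)

lemma rep_minus_L2: "AE x in lborel. rep_L2 (u - v) x = rep_L2 u x - rep_L2 v x"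
  using rep_plus_L2[of u "(-1) *\<^sub>C v"] rep_scaleC[of "-1" v]
  unfolding minus_L2_eq_scaleC by (auto elim!: AE_mp)

lemma rep_scaleR_L2: "AE x in lborel. rep_L2 (r *\<^sub>R u) x = complex_of_real r * rep_L2 u x"
  unfolding scaleR_L2_def by (rule rep_scaleC)

lemma cinner_commute: "\<langle>v, u\<rangle> = cnj \<langle>u, v\<rangle>"
  by transfer (subst Bochner_Integration.integral_cnj[symmetric], simp add: mult.commute)

lemma cinner_add_left: "\<langle>u + v, w\<rangle> = \<langle>u, w\<rangle> + \<langle>v, w\<rangle>"
  by transfer (auto simp: L2_rel_def distrib_right square_integrable_cnj_mult
             intro!: Bochner_Integration.integral_add)

lemma cinner_add_right: "\<langle>u, v + w\<rangle> = \<langle>u, v\<rangle> + \<langle>u, w\<rangle>"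
  by (metis cinner_commute cinner_add_left complex_cnj_add)

lemma cinner_scaleC_left: "\<langle>c *\<^sub>C u, v\<rangle> = cnj c * \<langle>u, v\<rangle>"
  by transfer (simp add: mult.assoc)

lemma cinner_scaleC_right: "\<langle>u, c *\<^sub>C v\<rangle> = c * \<langle>u, v\<rangle>"
  by (metis cinner_commute cinner_scaleC_left complex_cnj_mult complex_cnj_cnj)

lemma scaleC_scaleC: "c *\<^sub>C d *\<^sub>C u = (c * d) *\<^sub>C u"
  by transfer (auto simp: L2_rel_def mult.assoc intro!: square_integrable_scale)

lemma scaleC_add_right: "c *\<^sub>C (u + v) = c *\<^sub>C u + c *\<^sub>C v"
  by transfer (auto simp: L2_rel_def distrib_left intro!: square_integrable_add square_integrable_scale)

lemma scaleC_add_left: "(c + d) *\<^sub>C u = c *\<^sub>C u + d *\<^sub>C u"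
  by transfer (auto simp: L2_rel_def distrib_right intro!: square_integrable_add square_integrable_scale)

lemma scaleC_of_real: "complex_of_real r *\<^sub>C u = r *\<^sub>R u"
  by (simp add: scaleR_L2_def)

lemma scaleC_one [simp]: "1 *\<^sub>C u = u"
  using scaleC_of_real[of 1 u] by simp

lemma scaleC_minus_one: "(-1) *\<^sub>C u = - u"
  by (simp add: uminus_L2_def)

lemma scaleC_zero_left [simp]: "0 *\<^sub>C u = 0"
  using scaleC_of_real[of 0 u] by simp

lemma scaleC_minus_left: "(- c) *\<^sub>C u = - (c *\<^sub>C u)"
  using scaleC_scaleC[of "-1" c u] by (simp add: scaleC_minus_one)

lemma scaleC_zero_right [simp]: "c *\<^sub>C 0 = 0"
  using scaleC_scaleC[of c 0 0] by simp

lemma scaleC_scaleR: "c *\<^sub>C r *\<^sub>R u = r *\<^sub>R c *\<^sub>C u"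
  by (simp add: scaleC_of_real[symmetric] scaleC_scaleC mult.commute)

lemma cinner_minus_left: "\<langle>- u, v\<rangle> = - \<langle>u, v\<rangle>"
  using cinner_scaleC_left[of "-1" u v] by (simp add: scaleC_minus_one)

lemma cinner_minus_right: "\<langle>u, - v\<rangle> = - \<langle>u, v\<rangle>"
  using cinner_scaleC_right[of u "-1" v] by (simp add: scaleC_minus_one)

lemma cinner_diff_left: "\<langle>u - v, w\<rangle> = \<langle>u, w\<rangle> - \<langle>v, w\<rangle>"
  by (simp only: diff_conv_add_uminus cinner_add_left cinner_minus_left)

lemma cinner_diff_right: "\<langle>u, v - w\<rangle> = \<langle>u, v\<rangle> - \<langle>u, w\<rangle>"
  by (simp only: diff_conv_add_uminus cinner_add_right cinner_minus_right)

lemma cinner_zero_left [simp]: "\<langle>0, v\<rangle> = 0"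
  using cinner_scaleC_left[of 0 0 v] by simp

lemma cinner_zero_right [simp]: "\<langle>v, 0\<rangle> = 0"
  using cinner_scaleC_right[of v 0 0] by simp

lemma cinner_scaleR_left: "\<langle>r *\<^sub>R u, v\<rangle> = complex_of_real r * \<langle>u, v\<rangle>"
  by (simp add: scaleR_L2_def cinner_scaleC_left)

lemma cinner_scaleR_right: "\<langle>u, r *\<^sub>R v\<rangle> = complex_of_real r * \<langle>u, v\<rangle>"
  by (simp add: scaleR_L2_def cinner_scaleC_right)

lemma cinner_sum_left: "\<langle>\<Sum>i\<in>I. f i, v\<rangle> = (\<Sum>i\<in>I. \<langle>f i, v\<rangle>)"
  by (induction I rule: infinite_finite_induct) (auto simp: cinner_add_left)

lemma cinner_sum_right: "\<langle>v, \<Sum>i\<in>I. f i\<rangle> = (\<Sum>i\<in>I. \<langle>v, f i\<rangle>)"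
  by (induction I rule: infinite_finite_induct) (auto simp: cinner_add_right)

lemma cinner_self: "\<langle>u, u\<rangle> = complex_of_real ((norm u)\<^sup>2)"
proof -
  have "Im \<langle>u, u\<rangle> = 0"
    using cinner_commute[of u u] by (simp add: complex_eq_iff)
  then show ?thesis
    by (simp add: complex_eq_iff power2_norm_eq_inner inner_L2_def)
qed

lemma inner_i_L2: "inner (\<i> *\<^sub>C u) v = Im \<langle>u, v\<rangle>"
  by (simp add: inner_L2_def cinner_scaleC_left)

lemma norm_sq_L2: "(norm u)\<^sup>2 = (LINT x|lborel. (norm (rep_L2 u x))\<^sup>2)"
proof -
  have "\<langle>u, u\<rangle> = (LINT x|lborel. complex_of_real ((norm (rep_L2 u x))\<^sup>2))"
    unfolding cinner.rep_eq
    by (rule Bochner_Integration.integral_cong) (simp_all add: complex_norm_square mult.commute del: of_real_power)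
  also have "\<dots> = complex_of_real (LINT x|lborel. (norm (rep_L2 u x))\<^sup>2)"
    by (rule integral_complex_of_real)
  finally show ?thesis
    unfolding cinner_self by (simp only: of_real_eq_iff)
qed

lemma norm_sq_L2_nn: "ennreal ((norm u)\<^sup>2) = (\<integral>\<^sup>+ x. ennreal ((norm (rep_L2 u x))\<^sup>2) \<partial>lborel)"
  unfolding norm_sq_L2
  by (rule nn_integral_eq_integral[symmetric, OF integrable_rep_L2_sq]) auto

lemma norm_abs_L2_sq:
  assumes "square_integrable f"
  shows "(norm (abs_L2 f))\<^sup>2 = (LINT x|lborel. (norm (f x))\<^sup>2)"
  unfolding norm_sq_L2 using assms rep_abs_L2[OF assms]
  by (intro integral_cong_AE) (auto simp: square_integrable_def elim!: AE_mp)

lemma norm_scaleC: "norm (c *\<^sub>C u) = cmod c * norm u"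
proof -
  have "complex_of_real ((norm (c *\<^sub>C u))\<^sup>2) = (cnj c * c) * \<langle>u, u\<rangle>"
    unfolding cinner_self[symmetric] cinner_scaleC_left cinner_scaleC_right by (simp only: mult_ac)
  also have "cnj c * c = complex_of_real ((cmod c)\<^sup>2)"
    by (subst mult.commute) (rule complex_norm_square[symmetric])
  finally have "complex_of_real ((norm (c *\<^sub>C u))\<^sup>2) = complex_of_real ((cmod c * norm u)\<^sup>2)"
    by (simp only: cinner_self power_mult_distrib of_real_mult)
  then have "(norm (c *\<^sub>C u))\<^sup>2 = (cmod c * norm u)\<^sup>2"
    by (simp only: of_real_eq_iff)
  then show ?thesis by simp
qed

lemma cinner_Cauchy_Schwarz: "cmod \<langle>u, v\<rangle> \<le> norm u * norm v"
proof (cases "\<langle>u, v\<rangle> = 0")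
  case False
  define c where "c = cnj \<langle>u, v\<rangle> / cmod \<langle>u, v\<rangle>"
  have c: "cmod c = 1" using False by (simp add: c_def norm_divide)
  have "cnj \<langle>u, v\<rangle> * \<langle>u, v\<rangle> = complex_of_real ((cmod \<langle>u, v\<rangle>)\<^sup>2)"
    by (subst mult.commute) (rule complex_norm_square[symmetric])
  then have "c * \<langle>u, v\<rangle> = complex_of_real ((cmod \<langle>u, v\<rangle>)\<^sup>2) / complex_of_real (cmod \<langle>u, v\<rangle>)"
    by (simp only: c_def times_divide_eq_left)
  then have "complex_of_real (cmod \<langle>u, v\<rangle>) = c * \<langle>u, v\<rangle>"
    using False by (simp add: power2_eq_square)
  also have "\<dots> = \<langle>u, c *\<^sub>C v\<rangle>" by (simp add: cinner_scaleC_right)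
  finally have "cmod \<langle>u, v\<rangle> = inner u (c *\<^sub>C v)"
    unfolding inner_L2_def by (metis Re_complex_of_real)
  also have "\<dots> \<le> norm u * norm (c *\<^sub>C v)" by (rule norm_cauchy_schwarz)
  finally show ?thesis by (simp add: norm_scaleC c)
qed simp

lemma bounded_linear_scaleC: "bounded_linear (\<lambda>u. c *\<^sub>C u)"
proof (rule bounded_linear_intro[where K = "cmod c"])
  show "norm (c *\<^sub>C u) \<le> norm u * cmod c" for u :: "'a L2"
    by (simp add: norm_scaleC mult.commute)
qed (simp_all only: scaleC_add_right scaleC_scaleR)

lemma bounded_bilinear_cinner: "bounded_bilinear cinner"
proof
  show "\<exists>K. \<forall>a b. cmod \<langle>a, b\<rangle> \<le> norm a * norm b * K"
    by (rule exI[of _ 1]) (simp add: cinner_Cauchy_Schwarz)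
qed (simp_all add: cinner_add_left cinner_add_right cinner_scaleR_left cinner_scaleR_right scaleR_conv_of_real)

lemma bounded_bilinear_scaleC: "bounded_bilinear scaleC"
proof
  show "\<exists>K. \<forall>a b. norm (a *\<^sub>C b) \<le> norm a * norm b * K"
    by (rule exI[of _ 1]) (simp add: norm_scaleC)
qed (simp_all add: scaleC_add_left scaleC_add_right scaleC_scaleC scaleR_L2_def scaleR_conv_of_real mult.commute)

text \<open>Riesz--Fischer. For a sequence with geometrically small increments, the weighted series
  \<open>\<Sum> 2^n |u (n+1) - u n|^2\<close> has finite integral, hence converges almost everywhere; its sum
  bounds the increments pointwise by a geometric sequence.\<close>

lemma L2_converges_of_geometric_increments:
  fixes u :: "nat \<Rightarrow> 'a::euclidean_space L2"
  assumes incr: "\<And>n. norm (u (Suc n) - u n) \<le> (1/2) ^ n"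
  shows "convergent u"
proof -
  let ?a = "\<lambda>n x. norm (rep_L2 (u (Suc n)) x - rep_L2 (u n) x)"
  define G where "G = (\<lambda>x. \<Sum>n. ennreal (2 ^ n * (?a n x)\<^sup>2))"
  have [measurable]: "G \<in> borel_measurable borel" unfolding G_def by measurable
  have int_a: "(\<integral>\<^sup>+ x. ennreal (2 ^ n * (?a n x)\<^sup>2) \<partial>lborel) \<le> ennreal ((1/2) ^ n)" for n
  proof -
    have "(\<integral>\<^sup>+ x. ennreal (2 ^ n * (?a n x)\<^sup>2) \<partial>lborel)
        = ennreal (2 ^ n) * (\<integral>\<^sup>+ x. ennreal ((?a n x)\<^sup>2) \<partial>lborel)"
      by (subst nn_integral_cmult[symmetric]) (auto simp: ennreal_mult)
    also have "(\<integral>\<^sup>+ x. ennreal ((?a n x)\<^sup>2) \<partial>lborel) = ennreal ((norm (u (Suc n) - u n))\<^sup>2)"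
      unfolding norm_sq_L2_nn using rep_minus_L2[of "u (Suc n)" "u n"]
      by (intro nn_integral_cong_AE) auto
    also have "ennreal (2 ^ n) * \<dots> \<le> ennreal (2 ^ n) * ennreal (((1/2) ^ n)\<^sup>2)"
      by (intro mult_left_mono ennreal_leI power_mono incr) auto
    also have "\<dots> = ennreal ((1/2) ^ n)"
      by (simp add: ennreal_mult[symmetric] power2_eq_square power_divide)
    finally show ?thesis .
  qed
  have "(\<integral>\<^sup>+ x. G x \<partial>lborel) = (\<Sum>n. \<integral>\<^sup>+ x. ennreal (2 ^ n * (?a n x)\<^sup>2) \<partial>lborel)"
    unfolding G_def by (rule nn_integral_suminf) measurable
  also have "\<dots> \<le> (\<Sum>n. ennreal ((1/2) ^ n))"
    by (intro suminf_le int_a) auto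
  also have "\<dots> = ennreal (\<Sum>n. (1/2) ^ n)"
    by (rule suminf_ennreal2) (auto intro: summable_geometric)
  finally have G_fin: "(\<integral>\<^sup>+ x. G x \<partial>lborel) < \<infinity>"
    by (rule le_less_trans) simp
  have "AE x in lborel. G x \<noteq> \<infinity>"
    using G_fin by (intro nn_integral_PInf_AE) auto
  moreover have bound: "?a n x \<le> sqrt (enn2real (G x)) * (sqrt (1/2)) ^ n" if "G x \<noteq> \<infinity>" for n x
  proof -
    have "ennreal (2 ^ n * (?a n x)\<^sup>2) \<le> G x"
    proof -
      have "(\<Sum>k\<in>{n}. ennreal (2 ^ k * (?a k x)\<^sup>2)) \<le> G x"
        unfolding G_def by (rule sum_le_suminf) simp_all
      then show ?thesis by simp
    qed
    then have "2 ^ n * (?a n x)\<^sup>2 \<le> enn2real (G x)"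
      using that by (subst (asm) ennreal_enn2real[symmetric]) (auto simp: less_top)
    then have "(1/2) ^ n * (2 ^ n * (?a n x)\<^sup>2) \<le> (1/2) ^ n * enn2real (G x)"
      by (intro mult_left_mono) auto
    then have "(?a n x)\<^sup>2 \<le> enn2real (G x) * (1/2) ^ n"
      by (simp only: mult.assoc[symmetric] power_mult_distrib[symmetric]) (simp add: mult.commute)
    then have "?a n x \<le> sqrt (enn2real (G x) * (1/2) ^ n)"
      by (rule real_le_rsqrt)
    then show ?thesis by (simp add: real_sqrt_mult real_sqrt_power)
  qed
  have summ: "summable (\<lambda>n. rep_L2 (u (Suc n)) x - rep_L2 (u n) x)" if "G x \<noteq> \<infinity>" for x
  proof (rule summable_comparison_test'[of "\<lambda>n. sqrt (enn2real (G x)) * (sqrt (1/2)) ^ n"])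
    show "summable (\<lambda>n. sqrt (enn2real (G x)) * sqrt (1/2) ^ n)"
      by (intro summable_mult summable_geometric) (simp add: real_sqrt_lt_1_iff)
  qed (use bound[OF that] in auto)
  define f where "f = (\<lambda>x. rep_L2 (u 0) x + (\<Sum>n. rep_L2 (u (Suc n)) x - rep_L2 (u n) x))"
  have [measurable]: "f \<in> borel_measurable borel" unfolding f_def by measurable
  have tail: "norm (f x - rep_L2 (u n) x) \<le> 4 * (sqrt (enn2real (G x)) * (sqrt (1/2)) ^ n)"
    if "G x \<noteq> \<infinity>" for n x
  proof -
    have tel: "(\<Sum>k<n. rep_L2 (u (Suc k)) x - rep_L2 (u k) x) = rep_L2 (u n) x - rep_L2 (u 0) x"
      by (rule sum_lessThan_telescope)
    have "(\<Sum>k. rep_L2 (u (Suc k)) x - rep_L2 (u k) x)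
        = (\<Sum>k. rep_L2 (u (Suc (k + n))) x - rep_L2 (u (k + n)) x)
          + (\<Sum>k<n. rep_L2 (u (Suc k)) x - rep_L2 (u k) x)"
      by (rule suminf_split_initial_segment[OF summ[OF that]])
    then have "f x - rep_L2 (u n) x = (\<Sum>k. rep_L2 (u (Suc (k + n))) x - rep_L2 (u (k + n)) x)"
      unfolding f_def tel by simp
    also have "norm \<dots> \<le> (\<Sum>k. sqrt (enn2real (G x)) * (sqrt (1/2)) ^ (k + n))"
    proof (rule norm_suminf_le)
      show "summable (\<lambda>k. sqrt (enn2real (G x)) * sqrt (1/2) ^ (k + n))"
        unfolding power_add
        by (intro summable_mult summable_mult2 summable_geometric) (simp add: real_sqrt_lt_1_iff)
    qed (use bound[OF that] in auto)
    also have "\<dots> = (sqrt (enn2real (G x)) * (sqrt (1/2)) ^ n) * (\<Sum>k. (sqrt (1/2)) ^ k)"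
      by (subst suminf_mult[symmetric])
         (auto simp: power_add ac_simps real_sqrt_lt_1_iff intro!: summable_geometric)
    also have "\<dots> \<le> (sqrt (enn2real (G x)) * (sqrt (1/2)) ^ n) * 4"
    proof (rule mult_left_mono)
      have "(\<Sum>k. (sqrt (1/2)) ^ k) = 1 / (1 - sqrt (1/2))"
        by (rule suminf_geometric) (simp add: real_sqrt_lt_1_iff)
      moreover have "sqrt (1/2) \<le> 3/4" by (rule real_le_lsqrt) (auto simp: power2_eq_square)
      then have "1 / (1 - sqrt (1/2)) \<le> 4" by (simp add: field_simps)
      ultimately show "(\<Sum>k. (sqrt (1/2)) ^ k) \<le> 4" by simp
    qed simp
    finally show ?thesis
      by (simp only: mult_ac)
  qed
  have G_int: "integrable lborel (\<lambda>x. enn2real (G x))"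
  proof (rule integrableI_nonneg)
    have "ennreal (enn2real y) \<le> y" for y by (cases y) auto
    then show "(\<integral>\<^sup>+ x. ennreal (enn2real (G x)) \<partial>lborel) < \<infinity>"
      by (intro le_less_trans[OF nn_integral_mono G_fin])
  qed auto
  have sq_tail: "(norm (f x - rep_L2 (u n) x))\<^sup>2 \<le> 16 * (enn2real (G x) * (1/2) ^ n)"
    if "G x \<noteq> \<infinity>" for n x
  proof -
    have "(norm (f x - rep_L2 (u n) x))\<^sup>2 \<le> (4 * (sqrt (enn2real (G x)) * (sqrt (1/2)) ^ n))\<^sup>2"
      by (intro power_mono tail[OF that]) auto
    also have "\<dots> = 16 * (enn2real (G x) * ((sqrt (1/2)) ^ n)\<^sup>2)"
      by (simp add: power_mult_distrib)
    also have "((sqrt (1/2 :: real)) ^ n)\<^sup>2 = ((sqrt (1/2))\<^sup>2) ^ n"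
      by (metis power_mult mult.commute)
    finally show ?thesis by simp
  qed
  have si_diff: "square_integrable (\<lambda>x. f x - rep_L2 (u n) x)" for n
    unfolding square_integrable_def
  proof (intro conjI)
    show "integrable lborel (\<lambda>x. (norm (f x - rep_L2 (u n) x))\<^sup>2)"
      by (rule Bochner_Integration.integrable_bound[of _ "\<lambda>x. 16 * (enn2real (G x) * (1/2) ^ n)"])
         (use sq_tail \<open>AE x in lborel. G x \<noteq> \<infinity>\<close> G_int in \<open>auto elim!: AE_mp\<close>)
  qed measurable
  have "square_integrable (\<lambda>x. (f x - rep_L2 (u 0) x) + rep_L2 (u 0) x)"
    by (intro square_integrable_add si_diff square_integrable_rep)
  then have si: "square_integrable f" by simp
  have lim: "(norm (abs_L2 f - u n))\<^sup>2 \<le> 16 * (LINT x|lborel. enn2real (G x)) * (1/2) ^ n" for n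
  proof -
    have "(norm (abs_L2 f - u n))\<^sup>2 \<le> (LINT x|lborel. 16 * (enn2real (G x) * (1/2) ^ n))"
      unfolding norm_sq_L2
    proof (rule integral_mono_AE)
      show "AE x in lborel. (norm (rep_L2 (abs_L2 f - u n) x))\<^sup>2 \<le> 16 * (enn2real (G x) * (1/2) ^ n)"
        using \<open>AE x in lborel. G x \<noteq> \<infinity>\<close> rep_minus_L2[of "abs_L2 f" "u n"] rep_abs_L2[OF si]
      proof eventually_elim
        case (elim x)
        then show ?case using sq_tail[of x n] by simp
      qed
    qed (auto intro!: integrable_rep_L2_sq G_int)
    then show ?thesis by simp
  qed
  have "(\<lambda>n. (norm (abs_L2 f - u n))\<^sup>2) \<longlonglongrightarrow> 0"
  proof (rule tendsto_sandwich[of "\<lambda>n. 0" _ _ "\<lambda>n. 16 * (LINT x|lborel. enn2real (G x)) * (1/2) ^ n"])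
    have "(\<lambda>n. 16 * (LINT x|lborel. enn2real (G x)) * (1/2) ^ n)
            \<longlonglongrightarrow> 16 * (LINT x|lborel. enn2real (G x)) * 0"
      by (intro tendsto_mult tendsto_const LIMSEQ_realpow_zero) auto
    then show "(\<lambda>n. 16 * (LINT x|lborel. enn2real (G x)) * (1/2) ^ n) \<longlonglongrightarrow> 0" by simp
  qed (use lim in auto)
  then have "(\<lambda>n. norm (abs_L2 f - u n)) \<longlonglongrightarrow> 0"
    using tendsto_real_sqrt by fastforce
  then have "u \<longlonglongrightarrow> abs_L2 f"
    by (simp add: tendsto_dist_iff[of u] dist_norm norm_minus_commute)
  then show ?thesis by (auto simp: convergent_def)
qed

instance L2 :: (euclidean_space) complete_space
proof
  fix X :: "nat \<Rightarrow> 'a L2"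
  assume C: "Cauchy X"
  have "\<exists>M. \<forall>m\<ge>M. \<forall>n\<ge>M. norm (X m - X n) < (1/2) ^ k" for k
    using CauchyD[OF C, of "(1/2) ^ k"] by simp
  then obtain M where M: "\<And>k m n. m \<ge> M k \<Longrightarrow> n \<ge> M k \<Longrightarrow> norm (X m - X n) < (1/2) ^ k"
    by metis
  define r where "r = (\<lambda>k. \<Sum>j\<le>k. M j + 1)"
  have rM: "M k \<le> r k" for k
    unfolding r_def using member_le_sum[of k "{..k}" "\<lambda>j. M j + 1"] by simp
  have sm: "strict_mono r"
    by (rule strict_monoI_Suc) (simp add: r_def)
  have "norm (X (r (Suc k)) - X (r k)) \<le> (1/2) ^ k" for k
    using M[of k "r (Suc k)" "r k"] rM[of k] sm
    by (meson le_trans lessI less_imp_le strict_mono_less)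
  then have "convergent (\<lambda>k. X (r k))"
    by (intro L2_converges_of_geometric_increments) auto
  then obtain l where "(X \<circ> r) \<longlonglongrightarrow> l" by (auto simp: convergent_def o_def)
  then have "X \<longlonglongrightarrow> l"
    using C sm by (rule Cauchy_converges_subseq[rotated 2])
  then show "convergent X" by (auto simp: convergent_def)
qed

instance L2 :: (euclidean_space) banach ..

lemma Cauchy_L2I:
  fixes X :: "nat \<Rightarrow> 'a::euclidean_space L2"
  assumes "\<And>e. e > 0 \<Longrightarrow> \<exists>M. \<forall>m\<ge>M. \<forall>n\<ge>M. (norm (X m - X n))\<^sup>2 < e"
  shows "\<exists>x. X \<longlonglongrightarrow> x"
proof -
  have "Cauchy X"
  proof (rule CauchyI)
    fix e :: real assume e: "e > 0"
    then obtain M where "\<forall>m\<ge>M. \<forall>n\<ge>M. (norm (X m - X n))\<^sup>2 < e\<^sup>2" using assms[of "e\<^sup>2"] by auto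
    then show "\<exists>M. \<forall>m\<ge>M. \<forall>n\<ge>M. norm (X m - X n) < e"
      using e by (auto intro!: exI[of _ M] power2_less_imp_less[where y = e])
  qed
  then show ?thesis by (auto simp: Cauchy_convergent_iff convergent_def)
qed

lemma tendsto_norm_diff_sq:
  assumes "X \<longlonglongrightarrow> (x :: 'a::euclidean_space L2)"
  shows "(\<lambda>n. (norm (X n - x))\<^sup>2) \<longlonglongrightarrow> 0"
proof -
  have "(\<lambda>n. norm (X n - x)) \<longlonglongrightarrow> 0" using assms by (simp add: LIM_zero tendsto_norm_zero)
  then have "(\<lambda>n. (norm (X n - x))\<^sup>2) \<longlonglongrightarrow> 0\<^sup>2" by (rule tendsto_power)
  then show ?thesis by simp
qed

section \<open>Complete quadratic forms\<close>

lemma affine_nonneg_imp_zero: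
  fixes a b :: real
  assumes "\<And>t. 0 \<le> 2 * t * a + t\<^sup>2 * b" and "b \<ge> 0"
  shows "a = 0"
proof (rule ccontr)
  assume "a \<noteq> 0"
  define s where "s = a / (b + 1)"
  have a: "a = s * (b + 1)" using assms(2) by (simp add: s_def)
  have "0 \<le> 2 * (- s) * a + (- s)\<^sup>2 * b" by (rule assms(1))
  also have "\<dots> = s\<^sup>2 * (b - 2 * (b + 1))"
    by (simp add: a power2_eq_square algebra_simps)
  finally have "0 \<le> s\<^sup>2 * (b - 2 * (b + 1))" .
  moreover have "s\<^sup>2 > 0" using \<open>a \<noteq> 0\<close> a by auto
  ultimately have "b - 2 * (b + 1) \<ge> 0" by (simp only: zero_le_mult_iff) linarith
  with assms(2) show False by simp
qed

text \<open>A Hilbert space structure given by a form on a subspace \<open>S\<close> of an ambient space whose own topology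
  may be different. There are two instances: \<open>L2\<close> with its inner product, and \<open>H1\<close> with the energy
  form, which is complete although \<open>H1\<close> is not closed in \<open>L2\<close>.\<close>

locale complete_form =
  fixes S :: "'v::real_vector set" and B :: "'v \<Rightarrow> 'v \<Rightarrow> real"
  assumes S: "subspace S"
    and sym: "\<And>x y. x \<in> S \<Longrightarrow> y \<in> S \<Longrightarrow> B x y = B y x"
    and add_left: "\<And>x y z. x \<in> S \<Longrightarrow> y \<in> S \<Longrightarrow> z \<in> S \<Longrightarrow> B (x + y) z = B x z + B y z"
    and scale_left: "\<And>r x y. x \<in> S \<Longrightarrow> y \<in> S \<Longrightarrow> B (r *\<^sub>R x) y = r * B x y"
    and nonneg: "\<And>x. x \<in> S \<Longrightarrow> 0 \<le> B x x"
    and complete: "\<And>X. (\<And>n. X n \<in> S) \<Longrightarrow>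
        (\<And>e. e > 0 \<Longrightarrow> \<exists>M. \<forall>m\<ge>M. \<forall>n\<ge>M. B (X m - X n) (X m - X n) < e) \<Longrightarrow>
        \<exists>x\<in>S. (\<lambda>n. B (X n - x) (X n - x)) \<longlonglongrightarrow> 0"
begin

lemma closed_ops:
  assumes "x \<in> S" "y \<in> S"
  shows "x + y \<in> S" "x - y \<in> S" "r *\<^sub>R x \<in> S"
  using assms S by (auto intro: subspace_add subspace_diff subspace_scale)

lemma add_right: "x \<in> S \<Longrightarrow> y \<in> S \<Longrightarrow> z \<in> S \<Longrightarrow> B z (x + y) = B z x + B z y"
  using add_left[of x y z] by (simp add: sym closed_ops)

lemma scale_right: "x \<in> S \<Longrightarrow> y \<in> S \<Longrightarrow> B y (r *\<^sub>R x) = r * B y x"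
  using scale_left[of x y r] by (simp add: sym closed_ops)

lemma diff_left: "x \<in> S \<Longrightarrow> y \<in> S \<Longrightarrow> z \<in> S \<Longrightarrow> B (x - y) z = B x z - B y z"
  using add_left[of "x - y" y z] by (simp add: closed_ops)

lemma diff_right: "x \<in> S \<Longrightarrow> y \<in> S \<Longrightarrow> z \<in> S \<Longrightarrow> B z (x - y) = B z x - B z y"
  using add_right[of "x - y" y z] by (simp add: closed_ops)

lemmas bilinear = add_left add_right scale_left scale_right diff_left diff_right closed_ops

lemma Cauchy_Schwarz:
  assumes x: "x \<in> S" and y: "y \<in> S"
  shows "(B x y)\<^sup>2 \<le> B x x * B y y"
proof -
  have expand: "B (x + t *\<^sub>R y) (x + t *\<^sub>R y) = B x x + 2 * t * B x y + t\<^sup>2 * B y y" for t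
    using x y by (simp add: bilinear sym[of y x] power2_eq_square algebra_simps)
  have pos: "0 \<le> B x x + 2 * t * B x y + t\<^sup>2 * B y y" for t
    unfolding expand[symmetric] using x y by (intro nonneg closed_ops)
  show ?thesis
  proof (cases "B y y = 0")
    case True
    have h: "0 \<le> 2 * t * B x y + B x x" for t using pos[of t] True by simp
    have "B x y = 0"
    proof (rule ccontr)
      assume "B x y \<noteq> 0"
      then have "2 * (- (B x x + 1) / (2 * B x y)) * B x y = - (B x x + 1)" by (simp add: field_simps)
      then show False using h[of "- (B x x + 1) / (2 * B x y)"] by linarith
    qed
    then show ?thesis using True by simp
  next
    case False
    then have p: "B y y > 0" using nonneg[OF y] by simp
    define s where "s = B x y / B y y"
    have s: "B x y = s * B y y" using p by (simp add: s_def)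
    have "0 \<le> (B x x - s\<^sup>2 * B y y) * B y y"
      using pos[of "- s"] p by (intro mult_nonneg_nonneg) (simp_all add: s power2_eq_square)
    then show ?thesis by (simp add: s power2_eq_square algebra_simps)
  qed
qed

lemma tendsto_left:
  assumes "\<And>n. X n \<in> S" "x \<in> S" "z \<in> S" "(\<lambda>n. B (X n - x) (X n - x)) \<longlonglongrightarrow> 0"
  shows "(\<lambda>n. B (X n) z) \<longlonglongrightarrow> B x z"
proof -
  have "(\<lambda>n. B (X n - x) (X n - x) * B z z) \<longlonglongrightarrow> 0 * B z z"
    by (intro tendsto_mult assms(4) tendsto_const)
  then have lim: "(\<lambda>n. B (X n - x) (X n - x) * B z z) \<longlonglongrightarrow> 0" by simp
  have "(\<lambda>n. (B (X n - x) z)\<^sup>2) \<longlonglongrightarrow> 0"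
  proof (rule tendsto_sandwich[OF _ _ tendsto_const lim])
    show "\<forall>\<^sub>F n in sequentially. 0 \<le> (B (X n - x) z)\<^sup>2" by simp
    show "\<forall>\<^sub>F n in sequentially. (B (X n - x) z)\<^sup>2 \<le> B (X n - x) (X n - x) * B z z"
      by (intro always_eventually allI Cauchy_Schwarz closed_ops assms)
  qed
  then have "(\<lambda>n. sqrt ((B (X n - x) z)\<^sup>2)) \<longlonglongrightarrow> sqrt 0"
    by (rule tendsto_real_sqrt)
  then have "(\<lambda>n. B (X n - x) z) \<longlonglongrightarrow> 0"
    by (simp only: real_sqrt_abs real_sqrt_zero tendsto_rabs_zero_iff)
  then have "(\<lambda>n. B (X n) z - B x z) \<longlonglongrightarrow> 0"
    using assms(1-3) by (simp add: bilinear)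
  then show ?thesis by (simp add: LIM_zero_iff)
qed

lemma tendsto_diagonal:
  assumes "\<And>n. X n \<in> S" "x \<in> S" "(\<lambda>n. B (X n - x) (X n - x)) \<longlonglongrightarrow> 0"
  shows "(\<lambda>n. B (X n) (X n)) \<longlonglongrightarrow> B x x"
proof -
  have "B (X n) (X n) = B (X n - x) (X n - x) + 2 * B (X n) x - B x x" for n
    using assms(1,2) by (simp add: bilinear sym[of x "X n"])
  moreover have "(\<lambda>n. B (X n - x) (X n - x) + 2 * B (X n) x - B x x) \<longlonglongrightarrow> 0 + 2 * B x x - B x x"
    using assms by (intro tendsto_intros tendsto_left) auto
  ultimately show ?thesis by simp
qed

text \<open>The variational proof of the Riesz representation theorem: a minimising sequence in \<open>D\<close> of
  \<open>v \<mapsto> B v v - 2 L v\<close> is Cauchy by the parallelogram identity, and the limit satisfies the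
  Euler--Lagrange equation. The subspace \<open>D\<close> need not be closed, so the same statement yields
  orthogonal projection onto the closure of \<open>D\<close>.\<close>

lemma Riesz_on_subspace:
  assumes D: "subspace D" "D \<subseteq> S"
    and L_add: "\<And>x y. x \<in> D \<Longrightarrow> y \<in> D \<Longrightarrow> L (x + y) = L x + L y"
    and L_scale: "\<And>r x. x \<in> D \<Longrightarrow> L (r *\<^sub>R x) = r * L x"
    and L_bound: "\<And>x. x \<in> D \<Longrightarrow> (L x)\<^sup>2 \<le> M * B x x"
    and M: "M \<ge> 0"
  shows "\<exists>y\<in>S. (\<exists>d. (\<forall>n. d n \<in> D) \<and> (\<lambda>n. B (d n - y) (d n - y)) \<longlonglongrightarrow> 0) \<and> (\<forall>v\<in>D. B v y = L v)"
proof -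
  define J where "J = (\<lambda>v. B v v - 2 * L v)"
  have DS: "x \<in> S" if "x \<in> D" for x using D that by auto
  have D_ops: "x + y \<in> D" "r *\<^sub>R x \<in> D" if "x \<in> D" "y \<in> D" for x y r
    using D that by (auto intro: subspace_add subspace_scale)
  have lower: "- M \<le> J v" if "v \<in> D" for v
  proof -
    have "(2 * L v)\<^sup>2 \<le> 4 * (M * B v v)" using L_bound[OF that] by (simp add: power_mult_distrib)
    also have "\<dots> \<le> (M + B v v)\<^sup>2"
      using zero_le_power2[of "M - B v v"] by (simp add: power2_eq_square algebra_simps)
    finally have "2 * L v \<le> M + B v v"
      by (rule power2_le_imp_le) (use M nonneg[OF DS[OF that]] in simp)
    then show ?thesis by (simp add: J_def)
  qed
  define m where "m = Inf (J ` D)"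
  have bdd: "bdd_below (J ` D)" using lower by (auto intro!: bdd_belowI2)
  have ne: "J ` D \<noteq> {}" using D(1) by (auto simp: subspace_def)
  have m_le: "m \<le> J v" if "v \<in> D" for v
    unfolding m_def using bdd that by (intro cInf_lower) auto
  have "\<exists>v\<in>D. J v < m + 1 / (real n + 1)" for n
    using cInf_lessD[OF ne, of "m + 1 / (real n + 1)"] by (auto simp: m_def)
  then obtain d where d: "\<And>n. d n \<in> D" "\<And>n. J (d n) < m + 1 / (real n + 1)" by metis
  have parallelogram: "B (x - y) (x - y) \<le> 2 * (J x - m) + 2 * (J y - m)" if "x \<in> D" "y \<in> D" for x y
  proof -
    have "B (x - y) (x - y) = 2 * J x + 2 * J y - 4 * J ((1/2) *\<^sub>R (x + y))"
      using that DS[OF that(1)] DS[OF that(2)]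
      by (simp add: J_def bilinear L_add L_scale D_ops sym[of y x] algebra_simps)
    then show ?thesis using m_le[of "(1/2) *\<^sub>R (x + y)"] that D_ops by auto
  qed
  have "\<exists>y\<in>S. (\<lambda>n. B (d n - y) (d n - y)) \<longlonglongrightarrow> 0"
  proof (rule complete)
    fix e :: real assume e: "e > 0"
    obtain K :: nat where K: "4 / e < real K" using reals_Archimedean2 by blast
    have "B (d i - d j) (d i - d j) < e" if "i \<ge> K" "j \<ge> K" for i j
    proof -
      have "1 / (real i + 1) \<le> 1 / (real K + 1)" "1 / (real j + 1) \<le> 1 / (real K + 1)"
        using that by (auto intro!: divide_left_mono)
      moreover have "4 * (1 / (real K + 1)) < e"
        using K e by (simp add: field_simps)
      moreover have "b < e" if "x \<le> z" "y \<le> z" "4 * z < e" "b \<le> 2 * (p - m) + 2 * (r - m)"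
        "p < m + x" "r < m + y" for b p r x y z :: real
      proof -
        have "b < 2 * x + 2 * y" using that(4-6) by argo
        also have "\<dots> \<le> 4 * z" using that(1,2) by argo
        finally show ?thesis using that(3) by argo
      qed
      ultimately show ?thesis
        using parallelogram[OF d(1) d(1), of i j] d(2)[of i] d(2)[of j] by blast
    qed
    then show "\<exists>M. \<forall>m\<ge>M. \<forall>n\<ge>M. B (d m - d n) (d m - d n) < e" by blast
  qed (use d DS in auto)
  then obtain y where y: "y \<in> S" "(\<lambda>n. B (d n - y) (d n - y)) \<longlonglongrightarrow> 0" by blast
  have "B v y = L v" if v: "v \<in> D" for v
  proof -
    have "0 \<le> 2 * t * (B y v - L v) + t\<^sup>2 * B v v" for t
    proof -
      have "- (1 / (real n + 1)) \<le> 2 * t * (B (d n) v - L v) + t\<^sup>2 * B v v" for n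
      proof -
        have "J (d n + t *\<^sub>R v) = J (d n) + 2 * t * (B (d n) v - L v) + t\<^sup>2 * B v v"
          using d(1)[of n] v DS[OF d(1)[of n]] DS[OF v]
          by (simp add: J_def bilinear L_add L_scale D_ops sym[of v "d n"] power2_eq_square algebra_simps)
        then show ?thesis using m_le[of "d n + t *\<^sub>R v"] d(1)[of n] d(2)[of n] v D_ops by fastforce
      qed
      moreover have "(\<lambda>n. - (1 / (real n + 1))) \<longlonglongrightarrow> - 0"
        using LIMSEQ_inverse_real_of_nat by (intro tendsto_minus) (simp add: inverse_eq_divide add.commute)
      moreover have "(\<lambda>n. 2 * t * (B (d n) v - L v) + t\<^sup>2 * B v v)
          \<longlonglongrightarrow> 2 * t * (B y v - L v) + t\<^sup>2 * B v v"
        using d(1) DS v y by (intro tendsto_intros tendsto_left) auto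
      ultimately have "- 0 \<le> 2 * t * (B y v - L v) + t\<^sup>2 * B v v"
        by (intro LIMSEQ_le) auto
      then show ?thesis by simp
    qed
    then have "B y v - L v = 0"
      by (rule affine_nonneg_imp_zero) (use nonneg DS v in auto)
    then show ?thesis using sym[OF y(1) DS[OF v]] by simp
  qed
  then show ?thesis using y d(1) by blast
qed

text \<open>The orthogonal projection of \<open>x\<close> onto the closure of \<open>D\<close> leaves a remainder orthogonal to \<open>D\<close>; if
  such remainders have length zero, the approximants of the projection converge to \<open>x\<close> itself.\<close>

lemma dense_subspace:
  assumes D: "subspace D" "D \<subseteq> S" and x: "x \<in> S"
    and annihilator: "\<And>y. y \<in> S \<Longrightarrow> (\<And>d. d \<in> D \<Longrightarrow> B d y = 0) \<Longrightarrow> B y y = 0"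
  shows "\<exists>d. (\<forall>n. d n \<in> D) \<and> (\<lambda>n. B (d n - x) (d n - x)) \<longlonglongrightarrow> 0"
proof -
  have DS: "z \<in> S" if "z \<in> D" for z using D that by auto
  obtain y d where y: "y \<in> S" "\<And>v. v \<in> D \<Longrightarrow> B v y = B v x"
    and d: "\<And>n. d n \<in> D" "(\<lambda>n. B (d n - y) (d n - y)) \<longlonglongrightarrow> 0"
    using Riesz_on_subspace[OF D, of "\<lambda>v. B v x" "B x x"] x DS
    by (force simp: bilinear nonneg Cauchy_Schwarz mult.commute[of "B x x"])
  have z: "B (y - x) (y - x) = 0"
    using x y DS by (intro annihilator) (auto simp: bilinear)
  have eq: "B (d n - x) (d n - x) = B (d n - y) (d n - y)" for n
  proof -
    have "(B (d n - y) (y - x))\<^sup>2 \<le> B (d n - y) (d n - y) * B (y - x) (y - x)"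
      using d DS x y by (intro Cauchy_Schwarz closed_ops) auto
    then have c: "B (d n - y) (y - x) = 0" using z by simp
    have "B (p + q) (p + q) = B p p + 2 * B p q + B q q" if "p \<in> S" "q \<in> S" for p q
      using that sym[of p q] by (simp add: add_left add_right closed_ops)
    from this[of "d n - y" "y - x"] show ?thesis
      using c z DS[OF d(1)[of n]] x y by (simp add: closed_ops)
  qed
  show ?thesis
    by (rule exI[of _ d]) (simp only: eq d simp_thms)
qed

end

lemma L2_complete_form: "complete_form UNIV (inner :: 'a::euclidean_space L2 \<Rightarrow> 'a L2 \<Rightarrow> real)"
proof
  fix X :: "nat \<Rightarrow> 'a L2"
  assume C: "\<And>e. e > 0 \<Longrightarrow> \<exists>M. \<forall>m\<ge>M. \<forall>n\<ge>M. inner (X m - X n) (X m - X n) < e"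
  have "\<exists>x. X \<longlonglongrightarrow> x"
    by (rule Cauchy_L2I) (use C in \<open>simp add: power2_norm_eq_inner\<close>)
  then obtain x where "X \<longlonglongrightarrow> x" by blast
  from tendsto_norm_diff_sq[OF this]
  show "\<exists>x\<in>UNIV. (\<lambda>n. inner (X n - x) (X n - x)) \<longlonglongrightarrow> 0"
    by (auto simp: power2_norm_eq_inner)
qed (auto simp: inner_commute inner_add_left inner_add_right)

section \<open>Test functions\<close>

text \<open>For \<open>k = 0\<close> the classical flat function. The whole family is needed because it is closed
  under differentiation up to linear combinations.\<close>

definition flat :: "nat \<Rightarrow> real \<Rightarrow> real" where
  "flat k t = (if t > 0 then inverse t ^ k * exp (- inverse t) else 0)"

lemma flat_tendsto_0: "(flat k \<longlongrightarrow> 0) (at 0)"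
proof (rule filterlim_split_at)
  show "(flat k \<longlongrightarrow> 0) (at_left 0)"
    by (rule tendsto_eventually)
       (auto simp: flat_def eventually_at_filter)
  have "((\<lambda>t. inverse t ^ k / exp (inverse t)) \<longlongrightarrow> 0) (at_right (0::real))"
    by (rule filterlim_compose[OF tendsto_power_div_exp_0 filterlim_inverse_at_top_right])
  then show "(flat k \<longlongrightarrow> 0) (at_right 0)"
    by (rule Lim_transform_eventually)
       (auto simp: flat_def eventually_at_filter exp_minus divide_inverse)
qed

lemma flat_has_field_derivative:
  "(flat k has_field_derivative (flat (k + 2) t - real k * flat (k + 1) t)) (at t)"
proof -
  consider "t > 0" | "t < 0" | "t = 0" by linarith
  then show ?thesis
  proof cases
    case 1
    have "((\<lambda>t. inverse t ^ k * exp (- inverse t)) has_field_derivative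
        (flat (k + 2) t - real k * flat (k + 1) t)) (at t)"
      using 1 by (auto intro!: derivative_eq_intros simp: flat_def power2_eq_square algebra_simps power_Suc)
        (cases k; simp add: algebra_simps)
    then show ?thesis
      by (rule has_field_derivative_transform_within_open[of _ _ _ "{0<..}"])
         (use 1 in \<open>auto simp: flat_def\<close>)
  next
    case 2
    have "((\<lambda>t. 0) has_field_derivative (flat (k + 2) t - real k * flat (k + 1) t)) (at t)"
      using 2 by (simp add: flat_def)
    then show ?thesis
      by (rule has_field_derivative_transform_within_open[of _ _ _ "{..<0}"])
         (use 2 in \<open>auto simp: flat_def\<close>)
  next
    case 3
    have "((\<lambda>t. (flat k t - flat k 0) / (t - 0)) \<longlongrightarrow> 0) (at 0)"
      using flat_tendsto_0[of "Suc k"]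
      by (rule Lim_transform_eventually) (auto simp: flat_def eventually_at_filter divide_inverse)
    then show ?thesis using 3 by (simp add: has_field_derivative_iff flat_def)
  qed
qed

lemma flat_0_bounds: "0 \<le> flat 0 t" "flat 0 t \<le> 1"
  by (auto simp: flat_def)

lemma flat_0_scaled_tendsto: "(\<lambda>n. flat 0 (real (Suc n) * t)) \<longlonglongrightarrow> (if t > 0 then 1 else 0)"
proof (cases "t > 0")
  case True
  have "(\<lambda>n. inverse (real (Suc n)) * inverse t) \<longlonglongrightarrow> 0 * inverse t"
    by (intro tendsto_mult LIMSEQ_inverse_real_of_nat tendsto_const)
  then have "(\<lambda>n. exp (- (inverse (real (Suc n)) * inverse t))) \<longlonglongrightarrow> exp (- (0 * inverse t))"
    by (rule tendsto_exp[OF tendsto_minus])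
  then show ?thesis using True by (simp add: flat_def mult_pos_pos add_pos_nonneg del: of_nat_Suc)
next
  case False
  then have "flat 0 (real (Suc n) * t) = 0" for n
    by (simp add: flat_def zero_less_mult_iff del: of_nat_Suc)
  then show ?thesis using False by simp
qed

text \<open>Products of flat functions of affine arguments include bump functions on boxes, and the generated
  algebra is stable under partial derivatives, so all its members are smooth at once.\<close>

inductive flat_algebra :: "('a::euclidean_space \<Rightarrow> real) \<Rightarrow> bool" where
  const: "flat_algebra (\<lambda>x. c)"
| atom: "flat_algebra (\<lambda>x. flat k (a + inner x v))"
| add: "flat_algebra f \<Longrightarrow> flat_algebra g \<Longrightarrow> flat_algebra (\<lambda>x. f x + g x)"
| mult: "flat_algebra f \<Longrightarrow> flat_algebra g \<Longrightarrow> flat_algebra (\<lambda>x. f x * g x)"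

lemma flat_algebra_derivative:
  assumes "flat_algebra f"
  shows "\<exists>g. (\<forall>x. (f has_derivative (\<lambda>h. \<Sum>b\<in>Basis. inner h b * g b x)) (at x)) \<and>
             (\<forall>b. flat_algebra (g b))"
  using assms
proof induction
  case (const c)
  show ?case
    by (rule exI[of _ "\<lambda>b x. 0"]) (auto intro: flat_algebra.const)
next
  case (atom k a v)
  let ?g = "\<lambda>b x. (flat (k + 2) (a + inner x v) + (- real k) * flat (k + 1) (a + inner x v)) * inner v b"
  have expand: "c * inner h v = (\<Sum>b\<in>Basis. inner h b * (c * inner v b))" for c and h :: 'a
    by (subst euclidean_inner[of h v]) (simp add: sum_distrib_left algebra_simps)
  show ?case
  proof (intro exI[of _ ?g] conjI allI)
    fix x :: 'a
    have "(flat k has_derivative (*) (flat (k + 2) (a + inner x v) - real k * flat (k + 1) (a + inner x v)))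
        (at (a + inner x v))"
      using flat_has_field_derivative[of k "a + inner x v"] unfolding has_field_derivative_def .
    moreover have "((\<lambda>x. a + inner x v) has_derivative (\<lambda>h. inner h v)) (at x)"
      by (auto intro!: derivative_eq_intros)
    ultimately have "((\<lambda>x. flat k (a + inner x v)) has_derivative
        (\<lambda>h. (flat (k + 2) (a + inner x v) - real k * flat (k + 1) (a + inner x v)) * inner h v)) (at x)"
      using has_derivative_compose[of "\<lambda>x. a + inner x v" _ x UNIV "flat k"] by auto
    moreover have "(flat (k + 2) (a + inner x v) - real k * flat (k + 1) (a + inner x v)) * inner h v
        = (\<Sum>b\<in>Basis. inner h b * ?g b x)" for h
      unfolding expand by simp
    ultimately show "((\<lambda>x. flat k (a + inner x v)) has_derivative (\<lambda>h. \<Sum>b\<in>Basis. inner h b * ?g b x)) (at x)"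
      by simp
  qed (intro flat_algebra.intros)
next
  case (add f1 f2)
  then obtain g1 g2 where
    "\<forall>x. (f1 has_derivative (\<lambda>h. \<Sum>b\<in>Basis. inner h b * g1 b x)) (at x)" "\<forall>b. flat_algebra (g1 b)"
    "\<forall>x. (f2 has_derivative (\<lambda>h. \<Sum>b\<in>Basis. inner h b * g2 b x)) (at x)" "\<forall>b. flat_algebra (g2 b)"
    by blast
  then show ?case
    by (intro exI[of _ "\<lambda>b x. g1 b x + g2 b x"])
       (auto intro!: derivative_eq_intros flat_algebra.intros simp: sum.distrib algebra_simps)
next
  case (mult f1 f2)
  then obtain g1 g2 where g:
    "\<And>x. (f1 has_derivative (\<lambda>h. \<Sum>b\<in>Basis. inner h b * g1 b x)) (at x)" "\<And>b. flat_algebra (g1 b)"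
    "\<And>x. (f2 has_derivative (\<lambda>h. \<Sum>b\<in>Basis. inner h b * g2 b x)) (at x)" "\<And>b. flat_algebra (g2 b)"
    by blast
  show ?case
  proof (intro exI[of _ "\<lambda>b x. f1 x * g2 b x + g1 b x * f2 x"] conjI allI)
    fix x
    show "((\<lambda>x. f1 x * f2 x) has_derivative (\<lambda>h. \<Sum>b\<in>Basis. inner h b * (f1 x * g2 b x + g1 b x * f2 x))) (at x)"
    proof (rule has_derivative_eq_rhs[OF has_derivative_mult[OF g(1) g(3)]], rule ext)
      fix h :: 'a
      have "f1 x * (\<Sum>b\<in>Basis. inner h b * g2 b x) + (\<Sum>b\<in>Basis. inner h b * g1 b x) * f2 x
          = (\<Sum>b\<in>Basis. f1 x * (inner h b * g2 b x)) + (\<Sum>b\<in>Basis. inner h b * g1 b x * f2 x)"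
        by (simp only: sum_distrib_left sum_distrib_right)
      also have "\<dots> = (\<Sum>b\<in>Basis. f1 x * (inner h b * g2 b x) + inner h b * g1 b x * f2 x)"
        by (rule sum.distrib[symmetric])
      also have "\<dots> = (\<Sum>b\<in>Basis. inner h b * (f1 x * g2 b x + g1 b x * f2 x))"
        by (intro sum.cong refl) (simp only: distrib_left mult_ac)
      finally show "f1 x * (\<Sum>b\<in>Basis. inner h b * g2 b x) + (\<Sum>b\<in>Basis. inner h b * g1 b x) * f2 x
          = (\<Sum>b\<in>Basis. inner h b * (f1 x * g2 b x + g1 b x * f2 x))" .
    qed
  qed (intro flat_algebra.intros mult.hyps g)
qed

text \<open>The coinduction rule in the form of an invariant closed under taking partial derivatives.\<close>

lemma smoothI_invariant:
  assumes "P f"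
    and step: "\<And>f. P f \<Longrightarrow> \<exists>g. (\<forall>x. (f has_derivative (\<lambda>h. \<Sum>b\<in>Basis. inner h b * g b x)) (at x)) \<and>
      (\<forall>b\<in>Basis. P (g b))"
  shows "smooth f"
  using assms(1)
proof (coinduct rule: smooth.coinduct)
  case (smooth f)
  obtain g where "\<And>x. (f has_derivative (\<lambda>h. \<Sum>b\<in>Basis. inner h b * g b x)) (at x)"
    "\<And>b. b \<in> Basis \<Longrightarrow> P (g b)"
    using step[OF smooth] by metis
  then show ?case by auto
qed

lemma smooth_flat_algebra: "flat_algebra f \<Longrightarrow> smooth f"
  using flat_algebra_derivative by (intro smoothI_invariant[of flat_algebra]) blast+

lemma flat_algebra_prod:
  "finite I \<Longrightarrow> (\<And>i. i \<in> I \<Longrightarrow> flat_algebra (f i)) \<Longrightarrow> flat_algebra (\<lambda>x. \<Prod>i\<in>I. f i x)"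
  by (induction I rule: finite_induct) (auto intro: flat_algebra.intros)

lemma compact_closed_subset:
  assumes "compact C" "closed T" "T \<subseteq> C"
  shows "compact T"
proof -
  have "compact (C \<inter> T)" by (rule compact_Int_closed) fact+
  also have "C \<inter> T = T" using assms(3) by blast
  finally show ?thesis .
qed

text \<open>As the transition at the faces sharpens, these functions increase to the indicator of the open
  box.\<close>

definition box_bump :: "'a::euclidean_space \<Rightarrow> 'a \<Rightarrow> nat \<Rightarrow> 'a \<Rightarrow> real" where
  "box_bump a c n x =
     (\<Prod>b\<in>Basis. flat 0 (real (Suc n) * (inner x b - inner a b)) * flat 0 (real (Suc n) * (inner c b - inner x b)))"

lemma box_bump_support: "box_bump a c n x \<noteq> 0 \<Longrightarrow> x \<in> cbox a c"
proof -
  assume "box_bump a c n x \<noteq> 0"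
  then have nz: "\<forall>b\<in>Basis. flat 0 (real (Suc n) * (inner x b - inner a b))
      * flat 0 (real (Suc n) * (inner c b - inner x b)) \<noteq> 0"
    by (simp add: box_bump_def del: of_nat_Suc)
  have pos: "t > 0" if "flat 0 (real (Suc n) * t) \<noteq> 0" for t
    using that by (auto simp: flat_def zero_less_mult_iff split: if_splits simp del: of_nat_Suc)
  show "x \<in> cbox a c"
    unfolding mem_box
  proof
    fix b :: 'a assume "b \<in> Basis"
    then have "flat 0 (real (Suc n) * (inner x b - inner a b)) \<noteq> 0"
      "flat 0 (real (Suc n) * (inner c b - inner x b)) \<noteq> 0"
      using nz by auto
    then show "inner a b \<le> inner x b \<and> inner x b \<le> inner c b"
      using pos by fastforce
  qed
qed

lemma test_function_box_bump: "test_function (box_bump a c n)"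
  unfolding test_function_def
proof
  have "flat_algebra (\<lambda>x. flat 0 ((- (real (Suc n) * inner a b)) + inner x (real (Suc n) *\<^sub>R b))
      * flat 0 (real (Suc n) * inner c b + inner x ((- real (Suc n)) *\<^sub>R b)))" for b
    by (intro flat_algebra.intros)
  then have "flat_algebra (\<lambda>x. flat 0 (real (Suc n) * (inner x b - inner a b))
      * flat 0 (real (Suc n) * (inner c b - inner x b)))" for b
    by (simp add: algebra_simps)
  then have "flat_algebra (box_bump a c n)"
    unfolding box_bump_def[abs_def] by (intro flat_algebra_prod) auto
  then show "smooth (box_bump a c n)" by (rule smooth_flat_algebra)
  have "{x. box_bump a c n x \<noteq> 0} \<subseteq> cbox a c"
    using box_bump_support by blast
  then have "closure {x. box_bump a c n x \<noteq> 0} \<subseteq> cbox a c"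
    by (intro closure_minimal) auto
  then show "compact (closure {x. box_bump a c n x \<noteq> 0})"
    by (rule compact_closed_subset[OF compact_cbox closed_closure])
qed

lemma box_bump_bounds: "0 \<le> box_bump a c n x" "box_bump a c n x \<le> 1"
  unfolding box_bump_def
  by (intro prod_nonneg prod_le_1 conjI mult_nonneg_nonneg mult_le_one ballI flat_0_bounds)+

lemma box_bump_tendsto: "(\<lambda>n. box_bump a c n x) \<longlonglongrightarrow> indicator (box a c) x"
proof -
  have "(\<lambda>n. box_bump a c n x) \<longlonglongrightarrow>
     (\<Prod>b\<in>Basis. (if inner x b - inner a b > 0 then 1 else 0) * (if inner c b - inner x b > 0 then 1 else 0))"
    unfolding box_bump_def by (rule tendsto_prod) (rule tendsto_mult[OF flat_0_scaled_tendsto flat_0_scaled_tendsto])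
  also have "(\<Prod>b\<in>Basis. (if inner x b - inner a b > 0 then 1 else 0) * (if inner c b - inner x b > 0 then 1 else (0::real)))
     = indicator (box a c) x"
  proof (cases "x \<in> box a c")
    case False
    then obtain b where b: "b \<in> Basis" "\<not> (inner a b < inner x b \<and> inner x b < inner c b)"
      by (auto simp: mem_box)
    then show ?thesis using False by (auto intro!: prod_zero bexI[of _ b])
  qed (auto simp: mem_box intro!: prod.neutral)
  finally show ?thesis .
qed

subsection \<open>Derivatives of test functions\<close>

text \<open>Smoothness provides some family of partial derivatives; the Frechet derivative selects it as a
  function of the test function.\<close>

definition pderiv :: "'a::euclidean_space \<Rightarrow> ('a \<Rightarrow> real) \<Rightarrow> 'a \<Rightarrow> real" where
  "pderiv b \<phi> x = frechet_derivative \<phi> (at x) b"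

lemma smooth_pderiv:
  assumes "smooth \<phi>"
  shows "(\<phi> has_derivative (\<lambda>h. \<Sum>b\<in>Basis. inner h b * pderiv b \<phi> x)) (at x)"
    and "b \<in> Basis \<Longrightarrow> smooth (pderiv b \<phi>)"
proof -
  obtain g where g: "\<And>x. (\<phi> has_derivative (\<lambda>h. \<Sum>b\<in>Basis. inner h b * g b x)) (at x)"
    "\<And>b. b \<in> Basis \<Longrightarrow> smooth (g b)"
    using assms by cases blast
  have eq: "pderiv b \<phi> = g b" if b: "b \<in> Basis" for b
  proof
    fix x
    have "pderiv b \<phi> x = (\<Sum>c\<in>Basis. inner b c * g c x)"
      unfolding pderiv_def frechet_derivative_at[OF g(1)[of x], symmetric] ..
    also have "\<dots> = (\<Sum>c\<in>Basis. if c = b then g b x else 0)"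
      using b by (intro sum.cong) (auto simp: inner_Basis)
    also have "\<dots> = g b x" using b by simp
    finally show "pderiv b \<phi> x = g b x" .
  qed
  show "b \<in> Basis \<Longrightarrow> smooth (pderiv b \<phi>)" using g(2) eq by simp
  show "(\<phi> has_derivative (\<lambda>h. \<Sum>b\<in>Basis. inner h b * pderiv b \<phi> x)) (at x)"
    using g(1)[of x] eq by simp
qed

lemma smooth_continuous: "smooth \<phi> \<Longrightarrow> continuous_on A \<phi>"
  using smooth_pderiv(1) has_derivative_continuous
  by (intro continuous_at_imp_continuous_on) blast

lemma pderiv_eqI:
  assumes "(\<phi> has_derivative (\<lambda>h. \<Sum>b\<in>Basis. inner h b * g b)) (at x)" "b \<in> Basis"
  shows "pderiv b \<phi> x = g b"
proof -
  have "pderiv b \<phi> x = (\<Sum>c\<in>Basis. inner b c * g c)"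
    unfolding pderiv_def frechet_derivative_at[OF assms(1), symmetric] ..
  also have "\<dots> = (\<Sum>c\<in>Basis. if c = b then g b else 0)"
    using assms(2) by (intro sum.cong) (auto simp: inner_Basis)
  also have "\<dots> = g b" using assms(2) by simp
  finally show ?thesis .
qed

lemma smooth_linear_combination:
  fixes f g :: "'a::euclidean_space \<Rightarrow> real"
  assumes "smooth f" "smooth g"
  shows "smooth (\<lambda>x. r * f x + s * g x)"
proof (rule smoothI_invariant[of "\<lambda>F. \<exists>f g. smooth f \<and> smooth g \<and> F = (\<lambda>x. r * f x + s * g x)"])
  fix F :: "'a \<Rightarrow> real"
  assume "\<exists>f g. smooth f \<and> smooth g \<and> F = (\<lambda>x. r * f x + s * g x)"
  then obtain f g where fg: "smooth f" "smooth g" "F = (\<lambda>x. r * f x + s * g x)" by blast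
  let ?G = "\<lambda>b x. r * pderiv b f x + s * pderiv b g x"
  have eq: "r * (\<Sum>b\<in>Basis. inner h b * pderiv b f x) + s * (\<Sum>b\<in>Basis. inner h b * pderiv b g x)
      = (\<Sum>b\<in>Basis. inner h b * ?G b x)" for h x
    by (simp add: sum_distrib_left sum.distrib[symmetric] distrib_left mult_ac)
  have "(F has_derivative (\<lambda>h. \<Sum>b\<in>Basis. inner h b * ?G b x)) (at x)" for x
    unfolding fg(3) eq[symmetric]
    by (intro has_derivative_add has_derivative_mult_right smooth_pderiv(1) fg)
  then show "\<exists>G. (\<forall>x. (F has_derivative (\<lambda>h. \<Sum>b\<in>Basis. inner h b * G b x)) (at x)) \<and>
      (\<forall>b\<in>Basis. \<exists>f g. smooth f \<and> smooth g \<and> G b = (\<lambda>x. r * f x + s * g x))"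
    using smooth_pderiv(2)[OF fg(1)] smooth_pderiv(2)[OF fg(2)] by (intro exI[of _ ?G]) blast
qed (use assms in blast)

lemma has_derivative_translate:
  assumes "(f has_derivative f') (at (x + y :: 'a::real_normed_vector))"
  shows "((\<lambda>x. f (x + y)) has_derivative f') (at x)"
proof -
  have "((\<lambda>x. x + y) has_derivative (\<lambda>h. h)) (at x)" by (auto intro!: derivative_eq_intros)
  from has_derivative_compose[OF this assms] show ?thesis .
qed

lemma smooth_translate:
  fixes f :: "'a::euclidean_space \<Rightarrow> real"
  assumes "smooth f"
  shows "smooth (\<lambda>x. f (x + y))"
proof (rule smoothI_invariant[of "\<lambda>F. \<exists>f. smooth f \<and> F = (\<lambda>x. f (x + y))"])
  fix F :: "'a \<Rightarrow> real"
  assume "\<exists>f. smooth f \<and> F = (\<lambda>x. f (x + y))"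
  then obtain f where f: "smooth f" "F = (\<lambda>x. f (x + y))" by blast
  have "(F has_derivative (\<lambda>h. \<Sum>b\<in>Basis. inner h b * pderiv b f (x + y))) (at x)" for x
    unfolding f(2) by (rule has_derivative_translate[OF smooth_pderiv(1)[OF f(1)]])
  then show "\<exists>G. (\<forall>x. (F has_derivative (\<lambda>h. \<Sum>b\<in>Basis. inner h b * G b x)) (at x)) \<and>
      (\<forall>b\<in>Basis. \<exists>f. smooth f \<and> G b = (\<lambda>x. f (x + y)))"
    using smooth_pderiv(2)[OF f(1)] by (intro exI[of _ "\<lambda>b x. pderiv b f (x + y)"]) blast
qed (use assms in blast)

lemma pderiv_translate:
  assumes "smooth f" "b \<in> Basis"
  shows "pderiv b (\<lambda>x. f (x + y)) x = pderiv b f (x + y)"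
  by (rule pderiv_eqI[where g = "\<lambda>b. pderiv b f (x + y)"])
     (rule has_derivative_translate[OF smooth_pderiv(1)], fact+)

lemma test_functionI:
  assumes "smooth \<phi>" "compact C" "\<And>x. x \<notin> C \<Longrightarrow> \<phi> x = 0"
  shows "test_function \<phi>"
proof -
  have "closure {x. \<phi> x \<noteq> 0} \<subseteq> C"
    using assms by (intro closure_minimal compact_imp_closed) auto
  then have "compact (closure {x. \<phi> x \<noteq> 0})"
    by (rule compact_closed_subset[OF assms(2) closed_closure])
  then show ?thesis unfolding test_function_def using assms(1) by blast
qed

lemma test_function_smooth: "test_function \<phi> \<Longrightarrow> smooth \<phi>"
  by (simp add: test_function_def)

lemma test_function_compact_support:
  assumes "test_function \<phi>"
  shows "\<exists>C. compact C \<and> (\<forall>x. x \<notin> C \<longrightarrow> \<phi> x = 0)"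
  using assms closure_subset[of "{x. \<phi> x \<noteq> 0}"] unfolding test_function_def by blast

lemma test_function_linear_combination:
  assumes "test_function f" "test_function g"
  shows "test_function (\<lambda>x. r * f x + s * g x)"
proof -
  obtain C where C: "compact C" "\<And>x. x \<notin> C \<Longrightarrow> f x = 0" using test_function_compact_support[OF assms(1)] by blast
  obtain D where D: "compact D" "\<And>x. x \<notin> D \<Longrightarrow> g x = 0" using test_function_compact_support[OF assms(2)] by blast
  show ?thesis
  proof (rule test_functionI)
    show "compact (C \<union> D)" using C D by auto
    show "r * f x + s * g x = 0" if "x \<notin> C \<union> D" for x using that C D by auto
  qed (intro smooth_linear_combination test_function_smooth assms)
qed

lemma test_function_translate:
  assumes "test_function f"
  shows "test_function (\<lambda>x. f (x + y))"
proof -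
  obtain C where C: "compact C" "\<And>x. x \<notin> C \<Longrightarrow> f x = 0" using test_function_compact_support[OF assms(1)] by blast
  show ?thesis
  proof (rule test_functionI)
    show "compact ((\<lambda>x. x - y) ` C)"
      using C by (intro compact_continuous_image continuous_intros)
    show "f (x + y) = 0" if "x \<notin> (\<lambda>x. x - y) ` C" for x
      using that C(2)[of "x + y"] by (force simp: image_iff)
  qed (intro smooth_translate test_function_smooth assms)
qed

lemma test_function_pderiv:
  assumes "test_function \<phi>" "b \<in> Basis"
  shows "test_function (pderiv b \<phi>)"
proof -
  obtain C where C: "compact C" "\<And>x. x \<notin> C \<Longrightarrow> \<phi> x = 0" using test_function_compact_support[OF assms(1)] by blast
  show ?thesis
  proof (rule test_functionI[OF _ C(1)])
    show "pderiv b \<phi> x = 0" if "x \<notin> C" for x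
    proof -
      have "((\<lambda>x. 0) has_derivative (\<lambda>h. \<Sum>b\<in>Basis. inner h b * 0)) (at x)" by simp
      then have "(\<phi> has_derivative (\<lambda>h. \<Sum>b\<in>Basis. inner h b * 0)) (at x)"
        by (rule has_derivative_transform_within_open[of _ _ _ _ "- C"])
           (use C that compact_imp_closed in auto)
      then show ?thesis by (rule pderiv_eqI[OF _ assms(2)])
    qed
  qed (use assms smooth_pderiv(2) test_function_smooth in auto)
qed

lemma test_function_zero: "test_function (\<lambda>x. 0)"
proof -
  have "smooth (\<lambda>x::'a. 0)" by (rule smooth_flat_algebra[OF flat_algebra.const])
  then show ?thesis by (rule test_functionI[of _ "{}"]) auto
qed

lemma test_function_bounded:
  assumes "test_function \<phi>"
  obtains M where "M \<ge> 0" "\<And>x. \<bar>\<phi> x\<bar> \<le> M"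
proof -
  obtain C where C: "compact C" "\<And>x. x \<notin> C \<Longrightarrow> \<phi> x = 0" using test_function_compact_support[OF assms(1)] by blast
  have "compact (\<phi> ` C)"
    by (intro compact_continuous_image C smooth_continuous test_function_smooth assms)
  then obtain M where M: "\<And>x. x \<in> C \<Longrightarrow> \<bar>\<phi> x\<bar> \<le> M"
    using compact_imp_bounded[of "\<phi> ` C"] by (auto simp: bounded_iff)
  have "\<bar>\<phi> x\<bar> \<le> max M 0" for x using M[of x] C(2)[of x] by (cases "x \<in> C") auto
  then show ?thesis by (intro that[of "max M 0"]) auto
qed

lemma test_function_Lipschitz:
  assumes "test_function \<phi>"
  obtains L where "L \<ge> 0" "\<And>x y. \<bar>\<phi> x - \<phi> y\<bar> \<le> L * norm (x - y)"
proof -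
  have "\<exists>M\<ge>0. \<forall>x. \<bar>pderiv b \<phi> x\<bar> \<le> M" if "b \<in> Basis" for b
    using test_function_bounded[OF test_function_pderiv[OF assms that]] by metis
  then obtain M where M: "\<And>b. b \<in> Basis \<Longrightarrow> M b \<ge> 0" "\<And>b x. b \<in> Basis \<Longrightarrow> \<bar>pderiv b \<phi> x\<bar> \<le> M b"
    by metis
  let ?L = "\<Sum>b\<in>Basis. M b"
  have "norm (\<phi> x - \<phi> y) \<le> ?L * norm (x - y)" for x y
  proof (rule differentiable_bound[of UNIV])
    show "(\<phi> has_derivative (\<lambda>h. \<Sum>b\<in>Basis. inner h b * pderiv b \<phi> x)) (at x within UNIV)" for x
      using smooth_pderiv(1)[OF test_function_smooth[OF assms]] by simp
    show "onorm (\<lambda>h. \<Sum>b\<in>Basis. inner h b * pderiv b \<phi> x) \<le> ?L" for x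
    proof (rule onorm_bound)
      fix h :: 'a
      have "norm (\<Sum>b\<in>Basis. inner h b * pderiv b \<phi> x) \<le> (\<Sum>b\<in>Basis. \<bar>inner h b\<bar> * \<bar>pderiv b \<phi> x\<bar>)"
        by (metis (mono_tags, lifting) abs_mult real_norm_def sum_norm_le order_refl)
      also have "\<dots> \<le> (\<Sum>b\<in>Basis. norm h * M b)"
        by (intro sum_mono mult_mono Basis_le_norm M) auto
      finally show "norm (\<Sum>b\<in>Basis. inner h b * pderiv b \<phi> x) \<le> ?L * norm h"
        by (simp add: sum_distrib_left mult.commute)
    qed (intro sum_nonneg M)
  qed auto
  then show ?thesis by (intro that[of ?L]) (auto intro!: sum_nonneg M)
qed

section \<open>Test functions determine square-integrable functions\<close>

lemma square_integrable_bounded_support: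
  fixes f :: "'a::euclidean_space \<Rightarrow> complex"
  assumes [measurable]: "f \<in> borel_measurable borel" and C: "compact C"
    and supp: "\<And>x. x \<notin> C \<Longrightarrow> f x = 0" and M: "\<And>x. norm (f x) \<le> M"
  shows "square_integrable f" "norm (abs_L2 f) \<le> M * sqrt (measure lborel C)"
proof -
  have M0: "0 \<le> M" using M[of 0] norm_ge_zero order_trans by blast
  have [measurable]: "C \<in> sets borel" using C by (simp add: compact_imp_closed)
  have fin: "emeasure lborel C < \<infinity>" using emeasure_bounded_finite[OF compact_imp_bounded[OF C]] by simp
  have int: "integrable lborel (\<lambda>x. M\<^sup>2 * indicator C x :: real)"
    using fin by (intro integrable_mult_right integrable_real_indicator) auto
  have bound: "(norm (f x))\<^sup>2 \<le> M\<^sup>2 * indicator C x" for x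
    using M[of x] supp[of x] by (auto simp: indicator_def intro: power_mono)
  have "integrable lborel (\<lambda>x. (norm (f x))\<^sup>2)"
    by (rule Bochner_Integration.integrable_bound[OF int]) (use bound in auto)
  then show si: "square_integrable f" by (simp add: square_integrable_def)
  have "(norm (abs_L2 f))\<^sup>2 \<le> (LINT x|lborel. M\<^sup>2 * indicator C x)"
    unfolding norm_abs_L2_sq[OF si]
    by (rule integral_mono[OF _ int]) (use si bound in \<open>auto simp: square_integrable_def\<close>)
  also have "\<dots> = (M * sqrt (measure lborel C))\<^sup>2"
    using fin by (simp add: power_mult_distrib)
  finally show "norm (abs_L2 f) \<le> M * sqrt (measure lborel C)"
    by (rule power2_le_imp_le) (use M0 in simp)
qed

lemma cnj_measurable [measurable (raw)]:
  "f \<in> borel_measurable M \<Longrightarrow> (\<lambda>x. cnj (f x)) \<in> borel_measurable M"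
  by (rule borel_measurable_continuous_on[where f = cnj]) (auto intro: continuous_intros)

lemma test_function_measurable [measurable_dest]:
  "test_function \<phi> \<Longrightarrow> \<phi> \<in> borel_measurable borel"
  by (intro borel_measurable_continuous_onI smooth_continuous test_function_smooth)

lemma test_function_square_integrable:
  assumes "test_function \<phi>"
  shows "square_integrable (\<lambda>x. complex_of_real (\<phi> x))"
proof -
  obtain C where C: "compact C" "\<And>x. x \<notin> C \<Longrightarrow> \<phi> x = 0"
    using test_function_compact_support[OF assms] by blast
  obtain M where "\<And>x. \<bar>\<phi> x\<bar> \<le> M" using test_function_bounded[OF assms] by metis
  then show ?thesis
    using C assms by (intro square_integrable_bounded_support(1)[of _ C M]) auto
qed

definition test_vector :: "('a::euclidean_space \<Rightarrow> real) \<Rightarrow> 'a L2" where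
  "test_vector \<phi> = abs_L2 (\<lambda>x. complex_of_real (\<phi> x))"

lemma rep_test_vector:
  "test_function \<phi> \<Longrightarrow> AE x in lborel. rep_L2 (test_vector \<phi>) x = complex_of_real (\<phi> x)"
  unfolding test_vector_def by (intro rep_abs_L2 test_function_square_integrable)

lemma cinner_test_vector:
  assumes "test_function \<phi>"
  shows "\<langle>test_vector \<phi>, u\<rangle> = (LINT x|lborel. rep_L2 u x * complex_of_real (\<phi> x))"
  unfolding cinner.rep_eq
proof (rule integral_cong_AE)
  show "(\<lambda>x. rep_L2 u x * complex_of_real (\<phi> x)) \<in> borel_measurable lborel"
    using assms by measurable
  show "AE x in lborel. cnj (rep_L2 (test_vector \<phi>) x) * rep_L2 u x = rep_L2 u x * complex_of_real (\<phi> x)"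
    using rep_test_vector[OF assms] by eventually_elim simp
qed measurable

lemma has_weak_deriv_iff:
  assumes "b \<in> Basis"
  shows "has_weak_deriv u b v \<longleftrightarrow>
    (\<forall>\<phi>. test_function \<phi> \<longrightarrow> \<langle>test_vector (pderiv b \<phi>), u\<rangle> = - \<langle>test_vector \<phi>, v\<rangle>)"
  unfolding has_weak_deriv_def using assms
  by (auto simp: cinner_test_vector test_function_pderiv pderiv_def[symmetric])

lemma test_vector_linear_combination:
  assumes "test_function f" "test_function g"
  shows "test_vector (\<lambda>x. r * f x + s * g x) = r *\<^sub>R test_vector f + s *\<^sub>R test_vector g"
proof (rule L2_eqI)
  show "AE x in lborel. rep_L2 (test_vector (\<lambda>x. r * f x + s * g x)) x
      = rep_L2 (r *\<^sub>R test_vector f + s *\<^sub>R test_vector g) x"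
    using rep_test_vector[OF assms(1)] rep_test_vector[OF assms(2)]
      rep_test_vector[OF test_function_linear_combination[OF assms, of r s]]
      rep_plus_L2[of "r *\<^sub>R test_vector f" "s *\<^sub>R test_vector g"]
      rep_scaleR_L2[of r "test_vector f"] rep_scaleR_L2[of s "test_vector g"]
    by eventually_elim simp
qed

text \<open>Open boxes are stable under intersection and generate the Borel sets, so all set integrals vanish,
  first inside a bounded box and then everywhere.\<close>

lemma AE_eq_0_if_box_integrals_eq_0:
  fixes f :: "'a::euclidean_space \<Rightarrow> complex"
  assumes f: "\<And>a c. integrable lborel (\<lambda>x. indicator (box a c) x *\<^sub>R f x)"
    and box: "\<And>a c. (LINT x|lborel. indicator (box a c) x *\<^sub>R f x) = 0"
  shows "AE x in lborel. f x = 0"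
proof -
  define B where "B = (\<lambda>n::nat. box (- (real n *\<^sub>R One)) (real n *\<^sub>R One) :: 'a set)"
  have "AE x in lborel. indicator (B n) x *\<^sub>R f x = 0" for n
  proof (rule sigma_finite_measure.density_zero[OF sigma_finite_lborel])
    let ?g = "\<lambda>x. indicator (B n) x *\<^sub>R f x"
    show int: "integrable lborel ?g" unfolding B_def by (rule f)
    have intA: "integrable lborel (\<lambda>x. indicator A x *\<^sub>R ?g x)" if "A \<in> sets lborel" for A
      by (rule integrable_mult_indicator[OF that int])
    let ?E = "range (\<lambda>(a, b). box a b::'a set)"
    fix A assume "A \<in> sets (lborel :: 'a measure)"
    then have A: "A \<in> sigma_sets UNIV ?E" by (simp add: borel_eq_box)
    have "Int_stable ?E" by (auto simp: Int_stable_def box_Int_box)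
    have meas: "X \<in> sets lborel" if "X \<in> sigma_sets UNIV ?E" for X
      using that by (simp add: borel_eq_box)
    have "?E \<subseteq> Pow UNIV" by simp
    show "set_lebesgue_integral lborel A ?g = 0"
      using \<open>Int_stable ?E\<close> \<open>?E \<subseteq> Pow UNIV\<close> A
    proof (induct rule: sigma_sets_induct_disjoint)
      case (basic A)
      then obtain a c where "A = box a c" by auto
      then obtain a' c' where A': "A \<inter> B n = box a' c'"
        unfolding B_def by (simp add: box_Int_box)
      have eq: "(\<lambda>x. indicator A x *\<^sub>R ?g x) = (\<lambda>x. indicator (box a' c') x *\<^sub>R f x)"
        unfolding A'[symmetric] by (simp add: fun_eq_iff indicator_def)
      show ?case unfolding set_lebesgue_integral_def eq by (rule box)
    next
      case empty
      show ?case by (simp add: set_lebesgue_integral_def)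
    next
      case (compl A)
      have "set_lebesgue_integral lborel (UNIV - A) ?g = (LINT x|lborel. ?g x - indicator A x *\<^sub>R ?g x)"
        unfolding set_lebesgue_integral_def
        by (rule Bochner_Integration.integral_cong) (auto simp: indicator_def)
      also have "\<dots> = (LINT x|lborel. ?g x) - (LINT x|lborel. indicator A x *\<^sub>R ?g x)"
        by (rule Bochner_Integration.integral_diff[OF int intA[OF meas[OF compl(1)]]])
      also have "\<dots> = 0" using compl(2) box unfolding B_def set_lebesgue_integral_def by simp
      finally show ?case .
    next
      case (union A)
      have "set_lebesgue_integral lborel (\<Union>i. A i) ?g = (\<Sum>i. set_lebesgue_integral lborel (A i) ?g)"
      proof (rule lebesgue_integral_countable_add)
        show "A i \<in> sets lborel" for i using union(2) meas by blast
        show "A i \<inter> A j = {}" if "i \<noteq> j" for i j using union(1) that by (auto simp: disjoint_family_on_def)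
        show "set_integrable lborel (\<Union>i. A i) ?g"
          unfolding set_integrable_def using union(2) meas by (intro intA sets.countable_UN) auto
      qed
      then show ?case using union(3) by simp
    qed
  qed
  then have "AE x in lborel. \<forall>n. indicator (B n) x *\<^sub>R f x = 0" unfolding AE_all_countable by blast
  then show ?thesis
  proof (rule AE_mp, intro AE_I2 impI)
    fix x :: 'a assume x: "\<forall>n. indicator (B n) x *\<^sub>R f x = 0"
    have "x \<in> (\<Union>n. B n)" unfolding B_def UN_box_eq_UNIV by simp
    then obtain n where "x \<in> B n" by blast
    then show "f x = 0" using spec[OF x, of n] by (simp add: indicator_def)
  qed
qed

text \<open>Bump functions converge boundedly to the indicators of boxes, so orthogonality to test functions
  passes to box integrals.\<close>

lemma L2_eq_0_if_orthogonal_to_tests: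
  fixes w :: "'a::euclidean_space L2"
  assumes "\<And>\<phi>. test_function \<phi> \<Longrightarrow> \<langle>test_vector \<phi>, w\<rangle> = 0"
  shows "w = 0"
proof -
  let ?f = "rep_L2 w"
  have dom: "norm (?f x * complex_of_real r) \<le> (norm (?f x))\<^sup>2 + indicator (cbox a c) x"
    if "\<bar>r\<bar> \<le> indicator (cbox a c) x" for a c x r
  proof (cases "x \<in> cbox a c")
    case True
    have "2 * norm (?f x) \<le> (norm (?f x))\<^sup>2 + 1"
      using zero_le_power2[of "norm (?f x) - 1"] by (simp add: power2_eq_square algebra_simps)
    then have "norm (?f x) \<le> (norm (?f x))\<^sup>2 + 1"
      using norm_ge_zero[of "?f x"] by linarith
    moreover have "norm (?f x) * \<bar>r\<bar> \<le> norm (?f x) * 1"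
      using that True by (intro mult_left_mono) auto
    ultimately show ?thesis using True by (simp add: norm_mult)
  qed (use that in simp)
  have int: "integrable lborel (\<lambda>x. (norm (?f x))\<^sup>2 + indicator (cbox a c) x :: real)" for a c
    using emeasure_bounded_finite[OF bounded_cbox]
    by (intro Bochner_Integration.integrable_add integrable_rep_L2_sq integrable_real_indicator) auto
  have intb: "integrable lborel (\<lambda>x. indicator (box a c) x *\<^sub>R ?f x)" for a c
  proof (rule Bochner_Integration.integrable_bound[OF int[of a c]])
    have "norm (indicator (box a c) x *\<^sub>R ?f x) \<le> (norm (?f x))\<^sup>2 + indicator (cbox a c) x" for x
      using dom[of "indicator (box a c) x" a c x] box_subset_cbox[of a c]
      by (auto simp: norm_mult indicator_def split: if_splits)
    then show "AE x in lborel. norm (indicator (box a c) x *\<^sub>R ?f x) \<le> norm ((norm (?f x))\<^sup>2 + indicator (cbox a c) x :: real)"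
      by (intro AE_I2) (simp add: abs_of_nonneg)
  qed measurable
  have "(LINT x|lborel. indicator (box a c) x *\<^sub>R ?f x) = 0" for a c
  proof -
    have "(\<lambda>n. LINT x|lborel. ?f x * complex_of_real (box_bump a c n x))
        \<longlonglongrightarrow> (LINT x|lborel. indicator (box a c) x *\<^sub>R ?f x)"
    proof (rule integral_dominated_convergence[OF _ _ int[of a c]])
      show "(\<lambda>x. ?f x * complex_of_real (box_bump a c n x)) \<in> borel_measurable lborel" for n
        using test_function_box_bump[of a c n] by measurable
      show "AE x in lborel. (\<lambda>n. ?f x * complex_of_real (box_bump a c n x)) \<longlonglongrightarrow> indicator (box a c) x *\<^sub>R ?f x"
      proof (rule AE_I2)
        fix x
        have "(\<lambda>n. ?f x * complex_of_real (box_bump a c n x)) \<longlonglongrightarrow> ?f x * complex_of_real (indicator (box a c) x)"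
          by (intro tendsto_mult tendsto_const tendsto_of_real box_bump_tendsto)
        then show "(\<lambda>n. ?f x * complex_of_real (box_bump a c n x)) \<longlonglongrightarrow> indicator (box a c) x *\<^sub>R ?f x"
          by (simp add: scaleR_conv_of_real mult.commute)
      qed
      have "\<bar>box_bump a c n x\<bar> \<le> indicator (cbox a c) x" for n x
        using box_bump_bounds[of a c n x] box_bump_support[of a c n x]
        by (cases "x \<in> cbox a c") (auto simp: abs_if)
      then show "AE x in lborel. norm (?f x * complex_of_real (box_bump a c n x))
          \<le> (norm (?f x))\<^sup>2 + indicator (cbox a c) x" for n
        by (intro AE_I2 dom)
    qed measurable
    moreover have "(LINT x|lborel. ?f x * complex_of_real (box_bump a c n x)) = 0" for n
      using assms[OF test_function_box_bump[of a c n]]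
      by (simp add: cinner_test_vector test_function_box_bump)
    ultimately show ?thesis by (simp add: LIMSEQ_const_iff)
  qed
  then have "AE x in lborel. ?f x = 0"
    by (intro AE_eq_0_if_box_integrals_eq_0 intb)
  then show ?thesis
    using rep_zero_L2 by (intro L2_eqI) (auto elim: AE_mp)
qed

text \<open>Test functions are real-valued; their complex combinations form the dense subspace. A real
  subspace is enough, because density is obtained from the real inner product.\<close>

definition complex_tests :: "'a::euclidean_space L2 set" where
  "complex_tests = {test_vector f + \<i> *\<^sub>C test_vector g | f g. test_function f \<and> test_function g}"

lemma test_vector_zero: "test_vector (\<lambda>x. 0) = 0"
  by (simp add: test_vector_def zero_L2_def)

lemma complex_tests_subspace: "subspace (complex_tests :: 'a::euclidean_space L2 set)"
proof (rule subspaceI)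
  have "(0 :: 'a L2) = test_vector (\<lambda>x. 0) + \<i> *\<^sub>C test_vector (\<lambda>x. 0)"
    by (simp add: test_vector_zero)
  then show "0 \<in> (complex_tests :: 'a L2 set)"
    unfolding complex_tests_def using test_function_zero by blast
next
  fix x y :: "'a L2" assume "x \<in> complex_tests" "y \<in> complex_tests"
  then obtain f g f' g' where t: "test_function f" "test_function g" "test_function f'" "test_function g'"
    and xy: "x = test_vector f + \<i> *\<^sub>C test_vector g" "y = test_vector f' + \<i> *\<^sub>C test_vector g'"
    by (auto simp: complex_tests_def)
  have "x + y = test_vector (\<lambda>x. 1 * f x + 1 * f' x) + \<i> *\<^sub>C test_vector (\<lambda>x. 1 * g x + 1 * g' x)"
    unfolding xy by (simp only: test_vector_linear_combination t) (simp add: scaleC_add_right)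
  then show "x + y \<in> complex_tests"
    unfolding complex_tests_def using t test_function_linear_combination by blast
next
  fix r and x :: "'a L2" assume "x \<in> complex_tests"
  then obtain f g where t: "test_function f" "test_function g" and x: "x = test_vector f + \<i> *\<^sub>C test_vector g"
    by (auto simp: complex_tests_def)
  have "r *\<^sub>R x = test_vector (\<lambda>x. r * f x + 0 * f x) + \<i> *\<^sub>C test_vector (\<lambda>x. r * g x + 0 * g x)"
    unfolding x by (simp only: test_vector_linear_combination t) (simp add: scaleC_scaleR scaleR_add_right)
  then show "r *\<^sub>R x \<in> complex_tests"
    unfolding complex_tests_def using t test_function_linear_combination by blast
qed

lemma complex_tests_dense:
  fixes u :: "'a::euclidean_space L2"
  shows "\<exists>d. (\<forall>n. d n \<in> complex_tests) \<and> d \<longlonglongrightarrow> u"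
proof -
  interpret complete_form UNIV "inner :: 'a L2 \<Rightarrow> 'a L2 \<Rightarrow> real" by (rule L2_complete_form)
  have "\<exists>d. (\<forall>n. d n \<in> complex_tests) \<and> (\<lambda>n. inner (d n - u) (d n - u)) \<longlonglongrightarrow> 0"
  proof (rule dense_subspace[OF complex_tests_subspace])
    fix y :: "'a L2" assume y: "\<And>d. d \<in> complex_tests \<Longrightarrow> inner d y = 0"
    have "y = 0"
    proof (rule L2_eq_0_if_orthogonal_to_tests)
      fix \<phi> :: "'a \<Rightarrow> real" assume \<phi>: "test_function \<phi>"
      have "test_vector \<phi> + \<i> *\<^sub>C test_vector (\<lambda>x. 0) \<in> complex_tests"
        "test_vector (\<lambda>x. 0) + \<i> *\<^sub>C test_vector \<phi> \<in> complex_tests"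
        unfolding complex_tests_def using \<phi> test_function_zero by blast+
      from y[OF this(1)] y[OF this(2)] show "\<langle>test_vector \<phi>, y\<rangle> = 0"
        by (simp add: test_vector_zero inner_i_L2) (simp add: inner_L2_def complex_eq_iff)
    qed
    then show "inner y y = 0" by simp
  qed auto
  then obtain d where d: "\<And>n. d n \<in> complex_tests" "(\<lambda>n. inner (d n - u) (d n - u)) \<longlonglongrightarrow> 0" by blast
  have "(\<lambda>n. sqrt (inner (d n - u) (d n - u))) \<longlonglongrightarrow> sqrt 0"
    using d(2) by (rule tendsto_real_sqrt)
  then have "d \<longlonglongrightarrow> u"
    by (simp only: norm_eq_sqrt_inner[symmetric] real_sqrt_zero tendsto_norm_zero_iff LIM_zero_iff)
  then show ?thesis using d(1) by blast
qed

lemma norm_le_if_tested: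
  fixes w :: "'a::euclidean_space L2"
  assumes "\<And>d. d \<in> complex_tests \<Longrightarrow> \<bar>inner d w\<bar> \<le> M * norm d" and "M \<ge> 0"
  shows "norm w \<le> M"
proof (cases "w = 0")
  case False
  obtain d where d: "\<And>n. d n \<in> complex_tests" "d \<longlonglongrightarrow> w" using complex_tests_dense by blast
  have "inner (d n) w \<le> M * norm (d n)" for n using assms(1)[OF d(1)[of n]] by linarith
  moreover have "(\<lambda>n. inner (d n) w) \<longlonglongrightarrow> inner w w" by (rule tendsto_inner[OF d(2) tendsto_const])
  moreover have "(\<lambda>n. M * norm (d n)) \<longlonglongrightarrow> M * norm w"
    by (intro tendsto_mult tendsto_const tendsto_norm d(2))
  ultimately have "inner w w \<le> M * norm w" by (intro LIMSEQ_le) auto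
  then have "norm w * norm w \<le> M * norm w" by (simp add: power2_norm_eq_inner[symmetric] power2_eq_square)
  then show ?thesis using False by simp
qed (use assms in simp)

section \<open>Weak derivatives\<close>

lemma has_weak_deriv_unique:
  assumes b: "b \<in> Basis" and v: "has_weak_deriv u b v" "has_weak_deriv u b w"
  shows "v = w"
proof -
  have "v - w = 0"
    using v unfolding has_weak_deriv_iff[OF b]
    by (intro L2_eq_0_if_orthogonal_to_tests) (auto simp: cinner_diff_right)
  then show ?thesis by simp
qed

lemma weak_deriv_eqI: "b \<in> Basis \<Longrightarrow> has_weak_deriv u b v \<Longrightarrow> weak_deriv u b = v"
  unfolding weak_deriv_def using has_weak_deriv_unique by blast

lemma has_weak_deriv_weak_deriv:
  assumes "u \<in> H1" "b \<in> Basis"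
  shows "has_weak_deriv u b (weak_deriv u b)"
proof -
  obtain v where "has_weak_deriv u b v" using assms by (auto simp: H1_def)
  then show ?thesis using weak_deriv_eqI[OF assms(2)] by metis
qed

lemma has_weak_deriv_add:
  assumes b: "b \<in> Basis" and "has_weak_deriv u b v" "has_weak_deriv u' b v'"
  shows "has_weak_deriv (u + u') b (v + v')"
  using assms(2,3) unfolding has_weak_deriv_iff[OF b] by (simp add: cinner_add_right)

lemma has_weak_deriv_scaleC:
  assumes b: "b \<in> Basis" and "has_weak_deriv u b v"
  shows "has_weak_deriv (c *\<^sub>C u) b (c *\<^sub>C v)"
  using assms(2) unfolding has_weak_deriv_iff[OF b] by (simp add: cinner_scaleC_right)

lemma has_weak_deriv_0: "b \<in> Basis \<Longrightarrow> has_weak_deriv 0 b 0"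
  by (simp add: has_weak_deriv_iff)

lemma H1_add: "u \<in> H1 \<Longrightarrow> v \<in> H1 \<Longrightarrow> u + v \<in> H1"
  unfolding H1_def by (blast intro: has_weak_deriv_add)

lemma H1_scaleC: "u \<in> H1 \<Longrightarrow> c *\<^sub>C u \<in> H1"
  unfolding H1_def by (blast intro: has_weak_deriv_scaleC)

lemma H1_scaleR: "u \<in> H1 \<Longrightarrow> r *\<^sub>R u \<in> H1"
  using H1_scaleC[of u "complex_of_real r"] by (simp add: scaleC_of_real)

lemma H1_0: "0 \<in> H1"
  unfolding H1_def by (blast intro: has_weak_deriv_0)

lemma subspace_H1: "subspace H1"
  by (auto simp: subspace_def H1_add H1_scaleR H1_0)

lemma H1_diff: "u \<in> H1 \<Longrightarrow> v \<in> H1 \<Longrightarrow> u - v \<in> H1"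
  by (rule subspace_diff[OF subspace_H1])

lemma weak_deriv_add:
  "b \<in> Basis \<Longrightarrow> u \<in> H1 \<Longrightarrow> v \<in> H1 \<Longrightarrow> weak_deriv (u + v) b = weak_deriv u b + weak_deriv v b"
  by (intro weak_deriv_eqI has_weak_deriv_add has_weak_deriv_weak_deriv)

lemma weak_deriv_scaleC:
  "b \<in> Basis \<Longrightarrow> u \<in> H1 \<Longrightarrow> weak_deriv (c *\<^sub>C u) b = c *\<^sub>C weak_deriv u b"
  by (intro weak_deriv_eqI has_weak_deriv_scaleC has_weak_deriv_weak_deriv)

lemma weak_deriv_scaleR:
  "b \<in> Basis \<Longrightarrow> u \<in> H1 \<Longrightarrow> weak_deriv (r *\<^sub>R u) b = r *\<^sub>R weak_deriv u b"
  using weak_deriv_scaleC[of b u "complex_of_real r"] by (simp add: scaleC_of_real)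

lemma weak_deriv_diff:
  "b \<in> Basis \<Longrightarrow> u \<in> H1 \<Longrightarrow> v \<in> H1 \<Longrightarrow> weak_deriv (u - v) b = weak_deriv u b - weak_deriv v b"
  using weak_deriv_add[of b "u - v" v] by (simp add: H1_diff)

lemma has_weak_deriv_closed:
  assumes b: "b \<in> Basis" and "\<And>n. has_weak_deriv (u n) b (v n)" "u \<longlonglongrightarrow> u'" "v \<longlonglongrightarrow> v'"
  shows "has_weak_deriv u' b v'"
  unfolding has_weak_deriv_iff[OF b]
proof (intro allI impI)
  fix \<phi> :: "'a \<Rightarrow> real" assume \<phi>: "test_function \<phi>"
  have "(\<lambda>n. \<langle>test_vector (pderiv b \<phi>), u n\<rangle>) \<longlonglongrightarrow> \<langle>test_vector (pderiv b \<phi>), u'\<rangle>"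
    by (rule bounded_bilinear.tendsto[OF bounded_bilinear_cinner tendsto_const assms(3)])
  moreover have "(\<lambda>n. - \<langle>test_vector \<phi>, v n\<rangle>) \<longlonglongrightarrow> - \<langle>test_vector \<phi>, v'\<rangle>"
    by (intro tendsto_minus bounded_bilinear.tendsto[OF bounded_bilinear_cinner tendsto_const assms(4)])
  moreover have "\<langle>test_vector (pderiv b \<phi>), u n\<rangle> = - \<langle>test_vector \<phi>, v n\<rangle>" for n
    using assms(2) \<phi> unfolding has_weak_deriv_iff[OF b] by blast
  ultimately show "\<langle>test_vector (pderiv b \<phi>), u'\<rangle> = - \<langle>test_vector \<phi>, v'\<rangle>"
    using LIMSEQ_unique by simp blast
qed

section \<open>Translations\<close>

lemma lborel_translate: "distr lborel borel (\<lambda>x. x + y) = (lborel :: 'a::euclidean_space measure)"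
proof -
  have "(\<lambda>x. x + y) = (+) y" by (simp add: fun_eq_iff add.commute)
  then show ?thesis using lborel_distr_plus[of y] by simp
qed

lemma integral_translate:
  fixes f :: "'a::euclidean_space \<Rightarrow> 'b::{banach, second_countable_topology}"
  assumes "f \<in> borel_measurable borel"
  shows "(LINT x|lborel. f (x + y)) = (LINT x|lborel. f x)"
  by (subst (2) lborel_translate[of y, symmetric]) (simp add: integral_distr assms)

lemma integrable_translate:
  fixes f :: "'a::euclidean_space \<Rightarrow> 'b::{banach, second_countable_topology}"
  assumes "integrable lborel f"
  shows "integrable lborel (\<lambda>x. f (x + y))"
proof -
  have "integrable (distr lborel borel (\<lambda>x. x + y)) f" using assms by (simp add: lborel_translate)
  then show ?thesis by (rule integrable_distr[rotated]) measurable
qed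

lemma AE_translate:
  fixes y :: "'a::euclidean_space"
  assumes "AE x in lborel. P x"
  shows "AE x in lborel. P (x + y)"
proof -
  have "AE x in distr lborel borel (\<lambda>x. x + y). P x" using assms unfolding lborel_translate .
  then show ?thesis by (rule AE_distrD[rotated]) measurable
qed

lemma square_integrable_translate:
  assumes "square_integrable f"
  shows "square_integrable (\<lambda>x. f (x + y))"
proof -
  have [measurable]: "f \<in> borel_measurable borel" using assms by (simp add: square_integrable_def)
  then show ?thesis
    using assms integrable_translate[of "\<lambda>x. (norm (f x))\<^sup>2" y] by (simp add: square_integrable_def)
qed

lift_definition translate :: "'a::euclidean_space \<Rightarrow> 'a L2 \<Rightarrow> 'a L2" is "\<lambda>y f x. f (x + y)"
proof -
  fix y and f g :: "'a \<Rightarrow> complex" assume "L2_rel f g"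
  then show "L2_rel (\<lambda>x. f (x + y)) (\<lambda>x. g (x + y))"
    unfolding L2_rel_def using square_integrable_translate AE_translate[of "\<lambda>x. f x = g x" y] by auto
qed

lemma translate_eq_abs: "translate y u = abs_L2 (\<lambda>x. rep_L2 u (x + y))"
  by (simp add: translate_def)

lemma rep_translate: "AE x in lborel. rep_L2 (translate y u) x = rep_L2 u (x + y)"
  unfolding translate_eq_abs by (intro rep_abs_L2 square_integrable_translate square_integrable_rep)

lemma translate_add: "translate y (u + v) = translate y u + translate y v"
  by transfer (auto simp: L2_rel_def intro!: square_integrable_add square_integrable_translate)

lemma translate_scaleC: "translate y (c *\<^sub>C u) = c *\<^sub>C translate y u"
  by transfer (auto simp: L2_rel_def intro!: square_integrable_scale square_integrable_translate)

lemma translate_scaleR: "translate y (r *\<^sub>R u) = r *\<^sub>R translate y u"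
  by (simp add: scaleC_of_real[symmetric] translate_scaleC)

lemma translate_minus: "translate y (- u) = - translate y u"
  using translate_scaleC[of y "-1" u] by (simp add: scaleC_minus_one)

lemma translate_diff: "translate y (u - v) = translate y u - translate y v"
  by (simp only: diff_conv_add_uminus translate_add translate_minus)

lemma translate_translate: "translate y (translate z u) = translate (y + z) u"
  by transfer (auto simp: L2_rel_def add.assoc intro!: square_integrable_translate)

lemma translate_0 [simp]: "translate 0 u = u"
  by transfer (auto simp: L2_rel_def)

lemma cinner_translate: "\<langle>translate y u, translate y v\<rangle> = \<langle>u, v\<rangle>"
proof transfer
  fix y and f g :: "'a \<Rightarrow> complex"
  assume "L2_rel f f" "L2_rel g g"
  then have [measurable]: "f \<in> borel_measurable borel" "g \<in> borel_measurable borel"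
    by (auto simp: L2_rel_def square_integrable_def)
  show "(LINT x|lborel. cnj (f (x + y)) * g (x + y)) = (LINT x|lborel. cnj (f x) * g x)"
    by (rule integral_translate[of "\<lambda>x. cnj (f x) * g x"]) measurable
qed

lemma inner_translate: "inner (translate y u) (translate y v) = inner u v"
  by (simp add: inner_L2_def cinner_translate)

lemma norm_translate [simp]: "norm (translate y u) = norm u"
  by (simp add: norm_eq_sqrt_inner inner_translate)

lemma inner_translate_left: "inner (translate (- y) u) v = inner u (translate y v)"
  using inner_translate[of y "translate (- y) u" v] by (simp add: translate_translate)

lemma bounded_linear_translate: "bounded_linear (translate y)"
  by (rule bounded_linear_intro[where K = 1]) (simp_all add: translate_add translate_scaleR)

lemma translate_test_vector:
  assumes "test_function \<phi>"
  shows "translate y (test_vector \<phi>) = test_vector (\<lambda>x. \<phi> (x + y))"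
proof (rule L2_eqI)
  show "AE x in lborel. rep_L2 (translate y (test_vector \<phi>)) x = rep_L2 (test_vector (\<lambda>x. \<phi> (x + y))) x"
    using rep_translate[of y "test_vector \<phi>"] rep_test_vector[OF test_function_translate[OF assms, of y]]
      AE_translate[OF rep_test_vector[OF assms], of y]
    by eventually_elim simp
qed

lemma test_vector_bounded_support:
  assumes \<phi>: "test_function \<phi>" and C: "compact C" and supp: "\<And>x. x \<notin> C \<Longrightarrow> \<phi> x = 0"
    and M: "\<And>x. \<bar>\<phi> x\<bar> \<le> M"
  shows "norm (test_vector \<phi>) \<le> M * sqrt (measure lborel C)"
  unfolding test_vector_def using assms
  by (intro square_integrable_bounded_support(2)) auto

lemma test_function_supported_in_ball:
  assumes "test_function \<phi>"
  obtains R where "R > 0" "\<And>x y. x \<notin> cball 0 (R + 1) \<Longrightarrow> norm y \<le> 1 \<Longrightarrow> \<phi> (x + y) = 0"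
proof -
  obtain C where C: "compact C" "\<And>x. x \<notin> C \<Longrightarrow> \<phi> x = 0"
    using test_function_compact_support[OF assms] by blast
  obtain R where R: "R > 0" "\<And>x. x \<in> C \<Longrightarrow> norm x \<le> R"
    using compact_imp_bounded[OF C(1)] by (auto simp: bounded_pos)
  show ?thesis
  proof (rule that[OF R(1)])
    fix x y :: 'a assume x: "x \<notin> cball 0 (R + 1)" and y: "norm y \<le> 1"
    have "norm x \<le> norm (x + y) + norm y" using norm_triangle_ineq4[of "x + y" y] by simp
    then have "norm (x + y) > R" using x y by simp
    then show "\<phi> (x + y) = 0" using C(2) R(2) by (meson not_less)
  qed
qed

text \<open>Test functions are Lipschitz with compact support, so they depend continuously on
  translation; by density and isometry this extends to the whole space.\<close>

lemma translate_test_vector_tendsto: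
  assumes \<phi>: "test_function \<phi>"
  shows "((\<lambda>y. translate y (test_vector \<phi>)) \<longlongrightarrow> test_vector \<phi>) (at 0)"
proof -
  obtain L where L: "L \<ge> 0" "\<And>x y. \<bar>\<phi> x - \<phi> y\<bar> \<le> L * norm (x - y)"
    using test_function_Lipschitz[OF \<phi>] by metis
  obtain R where R: "R > 0" "\<And>x y. x \<notin> cball 0 (R + 1) \<Longrightarrow> norm y \<le> 1 \<Longrightarrow> \<phi> (x + y) = 0"
    using test_function_supported_in_ball[OF \<phi>] by metis
  let ?K = "L * sqrt (measure lborel (cball (0::'a) (R + 1)))"
  have bound: "norm (translate y (test_vector \<phi>) - test_vector \<phi>) \<le> norm y * ?K" if y: "norm y \<le> 1" for y
  proof -
    have eq: "translate y (test_vector \<phi>) - test_vector \<phi> = test_vector (\<lambda>x. 1 * \<phi> (x + y) + (-1) * \<phi> x)"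
      by (simp only: test_vector_linear_combination test_function_translate \<phi> translate_test_vector) simp
    have "norm (test_vector (\<lambda>x. 1 * \<phi> (x + y) + (-1) * \<phi> x)) \<le> (L * norm y) * sqrt (measure lborel (cball (0::'a) (R + 1)))"
    proof (rule test_vector_bounded_support)
      show "test_function (\<lambda>x. 1 * \<phi> (x + y) + (-1) * \<phi> x)"
        by (intro test_function_linear_combination test_function_translate \<phi>)
      show "1 * \<phi> (x + y) + (-1) * \<phi> x = 0" if "x \<notin> cball 0 (R + 1)" for x
        using R(2)[OF that y] R(2)[OF that, of 0] by simp
      show "\<bar>1 * \<phi> (x + y) + (-1) * \<phi> x\<bar> \<le> L * norm y" for x
        using L(2)[of "x + y" x] by simp
    qed simp
    then show ?thesis unfolding eq by (simp only: mult_ac)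
  qed
  have "((\<lambda>y. translate y (test_vector \<phi>) - test_vector \<phi>) \<longlongrightarrow> 0) (at 0)"
  proof (rule Lim_null_comparison)
    show "\<forall>\<^sub>F y in at 0. norm (translate y (test_vector \<phi>) - test_vector \<phi>) \<le> norm y * ?K"
      unfolding eventually_at using bound by (intro exI[of _ 1]) auto
    have "((\<lambda>y::'a. norm y * ?K) \<longlongrightarrow> norm (0::'a) * ?K) (at 0)" by (intro tendsto_intros)
    then show "((\<lambda>y::'a. norm y * ?K) \<longlongrightarrow> 0) (at 0)" by simp
  qed
  then show ?thesis by (simp add: LIM_zero_iff)
qed

lemma translate_tendsto: "((\<lambda>y. translate y u) \<longlongrightarrow> u) (at 0)"
proof (rule tendstoI)
  fix e :: real assume e: "e > 0"
  obtain d where "\<And>n. d n \<in> complex_tests" "d \<longlonglongrightarrow> u" using complex_tests_dense by blast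
  then obtain w where w: "w \<in> complex_tests" "dist w u < e / 3"
    using metric_LIMSEQ_D[of d u "e / 3"] e by (metis divide_pos_pos le_refl zero_less_numeral)
  then obtain f g where fg: "test_function f" "test_function g" "w = test_vector f + \<i> *\<^sub>C test_vector g"
    by (auto simp: complex_tests_def)
  have "((\<lambda>y. translate y w) \<longlongrightarrow> w) (at 0)"
    unfolding fg(3) translate_add translate_scaleC
    by (intro tendsto_add translate_test_vector_tendsto fg
        bounded_linear.tendsto[OF bounded_linear_scaleC])
  then have "\<forall>\<^sub>F y in at 0. dist (translate y w) w < e / 3" using e by (intro tendstoD) auto
  then show "\<forall>\<^sub>F y in at 0. dist (translate y u) u < e"
  proof eventually_elim
    case (elim y)
    have "dist (translate y u) (translate y w) = dist u w"
      by (simp add: dist_norm translate_diff[symmetric])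
    then show ?case
      using elim w(2) dist_triangle[of "translate y u" u w] dist_triangle[of "translate y u" w "translate y w"]
      by (simp add: dist_commute)
  qed
qed

lemma continuous_translate: "continuous_on A (\<lambda>y. translate y u)"
proof (rule continuous_at_imp_continuous_on, rule ballI)
  fix y
  have "((\<lambda>h. translate y (translate h u)) \<longlongrightarrow> translate y u) (at 0)"
    by (rule bounded_linear.tendsto[OF bounded_linear_translate translate_tendsto])
  then show "isCont (\<lambda>y. translate y u) y"
    by (simp add: isCont_iff translate_translate)
qed

lemma test_function_Taylor:
  assumes "test_function \<phi>" "b \<in> Basis"
  obtains L where "L \<ge> 0" "\<And>x h. \<bar>\<phi> (x + h *\<^sub>R b) - \<phi> x - h * pderiv b \<phi> x\<bar> \<le> L * h\<^sup>2"
proof -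
  obtain L where L: "L \<ge> 0" "\<And>x y. \<bar>pderiv b \<phi> x - pderiv b \<phi> y\<bar> \<le> L * norm (x - y)"
    using test_function_Lipschitz[OF test_function_pderiv[OF assms]] by metis
  have "\<bar>\<phi> (x + h *\<^sub>R b) - \<phi> x - h * pderiv b \<phi> x\<bar> \<le> L * h\<^sup>2" for x h
  proof -
    define g where "g = (\<lambda>r. \<phi> (x + r *\<^sub>R b) - r * pderiv b \<phi> x)"
    have der: "(g has_field_derivative (pderiv b \<phi> (x + r *\<^sub>R b) - pderiv b \<phi> x)) (at r within S)" for r S
    proof -
      have 1: "(\<phi> has_derivative (\<lambda>h. \<Sum>c\<in>Basis. inner h c * pderiv c \<phi> (x + r *\<^sub>R b))) (at (x + r *\<^sub>R b))"
        by (rule smooth_pderiv(1)[OF test_function_smooth[OF assms(1)]])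
      have 2: "((\<lambda>r. x + r *\<^sub>R b) has_derivative (\<lambda>s. s *\<^sub>R b)) (at r within S)"
        by (auto intro!: derivative_eq_intros)
      have "(\<Sum>c\<in>Basis. inner (s *\<^sub>R b) c * pderiv c \<phi> y) = s * pderiv b \<phi> y" for s y
      proof -
        have "(\<Sum>c\<in>Basis. inner (s *\<^sub>R b) c * pderiv c \<phi> y) = (\<Sum>c\<in>Basis. if c = b then s * pderiv b \<phi> y else 0)"
          using assms(2) by (intro sum.cong) (auto simp: inner_Basis)
        then show ?thesis using assms(2) by simp
      qed
      then have "((\<lambda>r. \<phi> (x + r *\<^sub>R b)) has_derivative (\<lambda>s. s * pderiv b \<phi> (x + r *\<^sub>R b))) (at r within S)"
        using has_derivative_compose[OF 2 1] by simp
      then have "((\<lambda>r. \<phi> (x + r *\<^sub>R b)) has_field_derivative pderiv b \<phi> (x + r *\<^sub>R b)) (at r within S)"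
        by (rule has_derivative_imp_has_field_derivative) (simp add: mult.commute)
      then show ?thesis unfolding g_def by (auto intro!: derivative_eq_intros)
    qed
    have "norm (g h - g 0) \<le> (L * \<bar>h\<bar>) * norm (h - 0)"
    proof (rule field_differentiable_bound[of "{- \<bar>h\<bar>..\<bar>h\<bar>}"])
      show "norm (pderiv b \<phi> (x + r *\<^sub>R b) - pderiv b \<phi> x) \<le> L * \<bar>h\<bar>" if "r \<in> {- \<bar>h\<bar>..\<bar>h\<bar>}" for r
      proof -
        have "norm (pderiv b \<phi> (x + r *\<^sub>R b) - pderiv b \<phi> x) \<le> L * \<bar>r\<bar>"
          using L(2)[of "x + r *\<^sub>R b" x] assms(2) by simp
        also have "\<dots> \<le> L * \<bar>h\<bar>" using that L(1) by (intro mult_left_mono) auto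
        finally show ?thesis .
      qed
    qed (use der in auto)
    then show ?thesis by (simp add: g_def power2_eq_square algebra_simps)
  qed
  then show ?thesis using that L(1) by blast
qed

lemma translate_test_vector_has_derivative_0:
  assumes \<phi>: "test_function \<phi>" and b: "b \<in> Basis"
  shows "((\<lambda>r. translate (r *\<^sub>R b) (test_vector \<phi>)) has_vector_derivative test_vector (pderiv b \<phi>)) (at 0)"
proof -
  obtain L where L: "L \<ge> 0" "\<And>x h. \<bar>\<phi> (x + h *\<^sub>R b) - \<phi> x - h * pderiv b \<phi> x\<bar> \<le> L * h\<^sup>2"
    using test_function_Taylor[OF assms] by metis
  obtain R where R: "R > 0" "\<And>x y. x \<notin> cball 0 (R + 1) \<Longrightarrow> norm y \<le> 1 \<Longrightarrow> \<phi> (x + y) = 0"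
    using test_function_supported_in_ball[OF \<phi>] by metis
  obtain R' where R': "R' > 0" "\<And>x y. x \<notin> cball 0 (R' + 1) \<Longrightarrow> norm y \<le> 1 \<Longrightarrow> pderiv b \<phi> (x + y) = 0"
    using test_function_supported_in_ball[OF test_function_pderiv[OF assms]] by metis
  define C where "C = cball (0::'a) (max R R' + 1)"
  let ?K = "L * sqrt (measure lborel C)"
  have bound: "norm (translate (h *\<^sub>R b) (test_vector \<phi>) - test_vector \<phi> - h *\<^sub>R test_vector (pderiv b \<phi>)) \<le> h\<^sup>2 * ?K"
    if h: "\<bar>h\<bar> \<le> 1" for h
  proof -
    let ?f = "\<lambda>x. 1 * (1 * \<phi> (x + h *\<^sub>R b) + (-1) * \<phi> x) + (- h) * pderiv b \<phi> x"
    have eq: "translate (h *\<^sub>R b) (test_vector \<phi>) - test_vector \<phi> - h *\<^sub>R test_vector (pderiv b \<phi>) = test_vector ?f"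
      by (simp only: test_vector_linear_combination test_function_linear_combination test_function_translate
          test_function_pderiv assms translate_test_vector) simp
    have "norm (test_vector ?f) \<le> (L * h\<^sup>2) * sqrt (measure lborel C)"
    proof (rule test_vector_bounded_support)
      show "test_function ?f"
        by (intro test_function_linear_combination test_function_translate test_function_pderiv assms)
      show "?f x = 0" if "x \<notin> C" for x
      proof -
        have "x \<notin> cball 0 (R + 1)" "x \<notin> cball 0 (R' + 1)" using that by (auto simp: C_def)
        then show ?thesis
          using R(2)[of x "h *\<^sub>R b"] R(2)[of x 0] R'(2)[of x 0] h b by simp
      qed
      show "\<bar>?f x\<bar> \<le> L * h\<^sup>2" for x using L(2)[of x h] by simp
    qed (simp add: C_def)
    then show ?thesis unfolding eq by (simp only: mult_ac)
  qed
  have "((\<lambda>h. (translate (h *\<^sub>R b) (test_vector \<phi>) - test_vector \<phi> - h *\<^sub>R test_vector (pderiv b \<phi>)) /\<^sub>R norm h) \<longlongrightarrow> 0) (at 0)"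
  proof (rule Lim_null_comparison)
    show "\<forall>\<^sub>F h in at 0. norm ((translate (h *\<^sub>R b) (test_vector \<phi>) - test_vector \<phi> - h *\<^sub>R test_vector (pderiv b \<phi>)) /\<^sub>R norm h)
        \<le> \<bar>h\<bar> * ?K"
      unfolding eventually_at
    proof (intro exI[of _ 1] conjI ballI impI)
      fix h :: real assume h: "h \<noteq> 0 \<and> dist h 0 < 1"
      then have "inverse \<bar>h\<bar> * norm (translate (h *\<^sub>R b) (test_vector \<phi>) - test_vector \<phi> - h *\<^sub>R test_vector (pderiv b \<phi>))
          \<le> inverse \<bar>h\<bar> * (h\<^sup>2 * ?K)"
        using bound[of h] by (intro mult_left_mono) auto
      also have "\<dots> = \<bar>h\<bar> * ?K" using h by (simp add: power2_eq_square abs_if field_simps)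
      finally show "norm ((translate (h *\<^sub>R b) (test_vector \<phi>) - test_vector \<phi> - h *\<^sub>R test_vector (pderiv b \<phi>)) /\<^sub>R norm h)
        \<le> \<bar>h\<bar> * ?K" by simp
    qed simp
    have "((\<lambda>h::real. \<bar>h\<bar> * ?K) \<longlongrightarrow> \<bar>0\<bar> * ?K) (at 0)" by (intro tendsto_intros)
    then show "((\<lambda>h::real. \<bar>h\<bar> * ?K) \<longlongrightarrow> 0) (at 0)" by simp
  qed
  then show ?thesis
    unfolding has_vector_derivative_def has_derivative_def
    by (simp add: bounded_linear_scaleR_left)
qed

lemma translate_test_vector_has_derivative:
  assumes \<phi>: "test_function \<phi>" and b: "b \<in> Basis"
  shows "((\<lambda>r. translate (r *\<^sub>R b) (test_vector \<phi>)) has_vector_derivative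
    translate (r *\<^sub>R b) (test_vector (pderiv b \<phi>))) (at r)"
proof -
  have "((\<lambda>s. translate (r *\<^sub>R b) (translate ((s - r) *\<^sub>R b) (test_vector \<phi>))) has_vector_derivative
    translate (r *\<^sub>R b) (test_vector (pderiv b \<phi>))) (at r)"
  proof (rule bounded_linear.has_vector_derivative[OF bounded_linear_translate])
    have "((\<lambda>s. s - r) has_vector_derivative 1) (at r)"
      by (auto intro!: derivative_eq_intros simp: has_vector_derivative_def)
    then show "((\<lambda>s. translate ((s - r) *\<^sub>R b) (test_vector \<phi>)) has_vector_derivative test_vector (pderiv b \<phi>)) (at r)"
      using vector_diff_chain_at[of "\<lambda>s. s - r" 1 r "\<lambda>r. translate (r *\<^sub>R b) (test_vector \<phi>)"]
        translate_test_vector_has_derivative_0[OF assms] by (simp add: o_def)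
  qed
  then show ?thesis by (simp add: translate_translate algebra_simps)
qed

text \<open>The mean value theorem along translations, tested against smooth functions.\<close>

lemma norm_translate_Basis_diff_le:
  fixes u :: "'a::euclidean_space L2"
  assumes u: "has_weak_deriv u b v" and b: "b \<in> Basis"
  shows "norm (translate (s *\<^sub>R b) u - u) \<le> \<bar>s\<bar> * norm v"
proof (rule norm_le_if_tested)
  fix d :: "'a L2" assume "d \<in> complex_tests"
  then obtain f g where fg: "test_function f" "test_function g" and d: "d = test_vector f + \<i> *\<^sub>C test_vector g"
    by (auto simp: complex_tests_def)
  let ?d' = "test_vector (pderiv b f) + \<i> *\<^sub>C test_vector (pderiv b g)"
  have der: "((\<lambda>r. translate (r *\<^sub>R b) d) has_vector_derivative translate (r *\<^sub>R b) ?d') (at r)" for r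
    unfolding d translate_add translate_scaleC
    by (intro has_vector_derivative_add bounded_linear.has_vector_derivative[OF bounded_linear_scaleC]
        translate_test_vector_has_derivative fg b)
  have parts: "\<langle>test_vector (pderiv b f'), u\<rangle> = - \<langle>test_vector f', v\<rangle>" if "test_function f'" for f'
    using u that unfolding has_weak_deriv_iff[OF b] by blast
  have comm: "translate y (test_vector (pderiv b f')) = test_vector (pderiv b (\<lambda>x. f' (x + y)))"
    if "test_function f'" for f' y
  proof -
    have "pderiv b (\<lambda>x. f' (x + y)) = (\<lambda>x. pderiv b f' (x + y))"
      using pderiv_translate[OF test_function_smooth[OF that] b] by (simp add: fun_eq_iff)
    then show ?thesis by (simp only: translate_test_vector test_function_pderiv that b)
  qed
  have ibp: "inner (translate y ?d') u = - inner (translate y d) v" for y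
    unfolding d inner_L2_def
    by (simp add: translate_add translate_scaleC comm translate_test_vector fg cinner_add_left
        cinner_scaleC_left parts test_function_translate)
  define G where "G = (\<lambda>r. inner (translate (r *\<^sub>R b) d) u)"
  have derG: "(G has_field_derivative (- inner (translate (r *\<^sub>R b) d) v)) (at r within UNIV)" for r
    using bounded_linear.has_vector_derivative[OF bounded_linear_inner_left[of u] der[of r]]
    unfolding G_def ibp has_real_derivative_iff_has_vector_derivative by simp
  have "norm (G (- s) - G 0) \<le> (norm d * norm v) * norm (- s - 0)"
  proof (rule field_differentiable_bound[of UNIV G])
    show "norm (- inner (translate (r *\<^sub>R b) d) v) \<le> norm d * norm v" for r
      using Cauchy_Schwarz_ineq2[of "translate (r *\<^sub>R b) d" v] by simp
  qed (use derG in auto)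
  moreover have "G (- s) - G 0 = inner d (translate (s *\<^sub>R b) u - u)"
    using inner_translate_left[of "s *\<^sub>R b" d u] by (simp add: G_def inner_diff_right)
  ultimately show "\<bar>inner d (translate (s *\<^sub>R b) u - u)\<bar> \<le> \<bar>s\<bar> * norm v * norm d"
    by (simp add: mult_ac)
qed simp

lemma norm_translate_diff_le:
  assumes u: "u \<in> H1"
  shows "norm (translate y u - u) \<le> (\<Sum>b\<in>Basis. \<bar>inner y b\<bar> * norm (weak_deriv u b))"
proof -
  have "norm (translate (\<Sum>b\<in>F. inner y b *\<^sub>R b) u - u) \<le> (\<Sum>b\<in>F. \<bar>inner y b\<bar> * norm (weak_deriv u b))"
    if "F \<subseteq> Basis" for F
    using finite_subset[OF that finite_Basis] that
  proof (induction F rule: finite_induct)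
    case (insert c F)
    let ?z = "\<Sum>b\<in>F. inner y b *\<^sub>R b"
    have "translate (inner y c *\<^sub>R c + ?z) u - u
        = translate ?z (translate (inner y c *\<^sub>R c) u - u) + (translate ?z u - u)"
      by (simp only: translate_diff translate_translate add.commute[of ?z]) simp
    also have "norm \<dots> \<le> norm (translate ?z (translate (inner y c *\<^sub>R c) u - u)) + norm (translate ?z u - u)"
      by (rule norm_triangle_ineq)
    also have "\<dots> = norm (translate (inner y c *\<^sub>R c) u - u) + norm (translate ?z u - u)"
      by simp
    also have "\<dots> \<le> \<bar>inner y c\<bar> * norm (weak_deriv u c) + (\<Sum>b\<in>F. \<bar>inner y b\<bar> * norm (weak_deriv u b))"
      using insert by (intro add_mono norm_translate_Basis_diff_le has_weak_deriv_weak_deriv u) auto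
    finally show ?case using insert by simp
  qed simp
  from this[OF order_refl] show ?thesis by (simp add: euclidean_representation)
qed

section \<open>Averages over small cubes\<close>

text \<open>The average of \<open>u\<close> over the cube with side \<open>h\<close> based at each point, as a vector-valued integral in
  \<open>L2\<close>. In this form, commutation with bounded operators is commutation with the integral.\<close>

definition cube_average :: "real \<Rightarrow> 'a::euclidean_space L2 \<Rightarrow> 'a L2" where
  "cube_average h u = integral (cbox 0 One) (\<lambda>z. translate (h *\<^sub>R z) u)"

lemma translate_integrable: "(\<lambda>z. translate (h *\<^sub>R z) u) integrable_on cbox 0 (One :: 'a::euclidean_space)"
proof (rule integrable_continuous)
  have "continuous_on (cbox 0 (One::'a)) ((\<lambda>y. translate y u) \<circ> (\<lambda>z. h *\<^sub>R z))"
    by (intro continuous_on_compose continuous_intros continuous_translate)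
  then show "continuous_on (cbox 0 One) (\<lambda>z. translate (h *\<^sub>R z) u)" by (simp add: o_def)
qed

text \<open>Applied to translations and to averages at another scale, this makes all averages commute.\<close>

lemma cube_average_commute:
  fixes T :: "'a::euclidean_space L2 \<Rightarrow> 'a L2"
  assumes "bounded_linear T" "\<And>y. T (translate y u) = translate y (T u)"
  shows "T (cube_average h u) = cube_average h (T u)"
  using integral_linear[OF translate_integrable assms(1), of h u]
  by (simp add: cube_average_def o_def assms(2))

lemma cube_average_add: "cube_average h (u + v) = cube_average h u + cube_average h v"
  unfolding cube_average_def translate_add by (intro integral_add translate_integrable)

lemma cube_average_scaleR: "cube_average h (r *\<^sub>R u) = r *\<^sub>R cube_average h u"
  unfolding cube_average_def translate_scaleR by (rule integral_cmul)

lemma norm_cube_average_le: "norm (cube_average h u) \<le> norm u"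
proof -
  have "norm (cube_average h u) \<le> norm u * measure lborel (cbox 0 (One :: 'a))"
    unfolding cube_average_def
    by (rule has_integral_bound[OF _ integrable_integral[OF translate_integrable]]) auto
  then show ?thesis by simp
qed

lemma bounded_linear_cube_average: "bounded_linear (cube_average h)"
  by (rule bounded_linear_intro[where K = 1])
     (simp_all add: cube_average_add cube_average_scaleR norm_cube_average_le)

lemma cube_average_cube_average_commute:
  "cube_average h (cube_average k u) = cube_average k (cube_average h u)"
proof (rule cube_average_commute[OF bounded_linear_cube_average])
  fix y
  show "cube_average h (translate y u) = translate y (cube_average h u)"
    by (rule cube_average_commute[OF bounded_linear_translate, symmetric])
       (simp add: translate_translate add.commute)
qed

definition grad_norm :: "'a::euclidean_space L2 \<Rightarrow> real" where
  "grad_norm u = (\<Sum>b\<in>Basis. norm (weak_deriv u b))"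

lemma grad_norm_nonneg: "0 \<le> grad_norm u"
  by (simp add: grad_norm_def sum_nonneg)

lemma norm_cube_average_diff_le:
  assumes u: "u \<in> H1" and h: "h \<ge> 0"
  shows "norm (cube_average h u - u) \<le> h * grad_norm u"
proof -
  have "((\<lambda>z. translate (h *\<^sub>R z) u - u) has_integral (cube_average h u - measure lborel (cbox 0 (One::'a)) *\<^sub>R u)) (cbox 0 One)"
    unfolding cube_average_def
    by (intro has_integral_diff integrable_integral translate_integrable has_integral_const)
  then have int: "((\<lambda>z. translate (h *\<^sub>R z) u - u) has_integral (cube_average h u - u)) (cbox 0 One)" by simp
  have "norm (cube_average h u - u) \<le> (h * grad_norm u) * measure lborel (cbox 0 (One::'a))"
  proof (rule has_integral_bound[OF _ int])
    show "0 \<le> h * grad_norm u" by (intro mult_nonneg_nonneg h grad_norm_nonneg)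
    fix z :: 'a assume z: "z \<in> cbox 0 One"
    have "norm (translate (h *\<^sub>R z) u - u) \<le> (\<Sum>b\<in>Basis. \<bar>inner (h *\<^sub>R z) b\<bar> * norm (weak_deriv u b))"
      by (rule norm_translate_diff_le[OF u])
    also have "\<dots> \<le> (\<Sum>b\<in>Basis. h * norm (weak_deriv u b))"
    proof (intro sum_mono mult_right_mono norm_ge_zero)
      fix b :: 'a assume b: "b \<in> Basis"
      then have "0 \<le> inner z b" "inner z b \<le> 1" using z by (auto simp: mem_box)
      then show "\<bar>inner (h *\<^sub>R z) b\<bar> \<le> h" using h by (simp add: abs_mult mult_left_le)
    qed
    finally show "norm (translate (h *\<^sub>R z) u - u) \<le> h * grad_norm u"
      by (simp add: grad_norm_def sum_distrib_left)
  qed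
  then show ?thesis by simp
qed

section \<open>Weights and the smoothing effect of averages\<close>

text \<open>The square root turns the potential energy \<open>\<integral> W |u|\<^sup>2\<close> into the squared norm of a vector that is
  linear in \<open>u\<close>, so that energies can be estimated by the triangle inequality along a telescoping
  sum.\<close>

definition mult_sqrt :: "('a::euclidean_space \<Rightarrow> real) \<Rightarrow> 'a L2 \<Rightarrow> 'a L2" where
  "mult_sqrt W u = abs_L2 (\<lambda>x. complex_of_real (sqrt (W x)) * rep_L2 u x)"

text \<open>Boundedness serves to make \<open>mult_sqrt W\<close> a bounded operator. The estimates
  have constants independent of the bound \<open>n\<close>, so they survive the removal of a truncation at level
  \<open>n\<close>.\<close>

locale bounded_weight =
  fixes W :: "'a::euclidean_space \<Rightarrow> real" and n :: real
  assumes W_measurable [measurable]: "W \<in> borel_measurable borel"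
    and W_nonneg: "\<And>x. 0 \<le> W x" and W_le: "\<And>x. W x \<le> n"
begin

lemma W_sq_le: "W x * (norm z)\<^sup>2 \<le> n * (norm z)\<^sup>2"
  by (intro mult_right_mono W_le) simp

lemma mult_sqrt_square_integrable:
  "square_integrable (\<lambda>x. complex_of_real (sqrt (W x)) * rep_L2 u x)"
  unfolding square_integrable_def
proof
  have "integrable lborel (\<lambda>x. n * (norm (rep_L2 u x))\<^sup>2)"
    by (intro integrable_mult_right integrable_rep_L2_sq)
  then show "integrable lborel (\<lambda>x. (norm (complex_of_real (sqrt (W x)) * rep_L2 u x))\<^sup>2)"
    by (rule Bochner_Integration.integrable_bound)
       (auto simp: norm_mult power_mult_distrib W_nonneg abs_mult intro!: AE_I2 mult_right_mono order_trans[OF W_le])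
qed measurable

lemma rep_mult_sqrt: "AE x in lborel. rep_L2 (mult_sqrt W u) x = complex_of_real (sqrt (W x)) * rep_L2 u x"
  unfolding mult_sqrt_def by (rule rep_abs_L2[OF mult_sqrt_square_integrable])

lemma norm_mult_sqrt:
  "ennreal ((norm (mult_sqrt W u))\<^sup>2) = (\<integral>\<^sup>+ x. ennreal (W x * (norm (rep_L2 u x))\<^sup>2) \<partial>lborel)"
  unfolding norm_sq_L2_nn
proof (rule nn_integral_cong_AE)
  show "AE x in lborel. ennreal ((norm (rep_L2 (mult_sqrt W u) x))\<^sup>2) = ennreal (W x * (norm (rep_L2 u x))\<^sup>2)"
    using rep_mult_sqrt[of u] by eventually_elim (simp add: norm_mult power_mult_distrib W_nonneg)
qed

lemma mult_sqrt_add: "mult_sqrt W (u + v) = mult_sqrt W u + mult_sqrt W v"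
proof (rule L2_eqI)
  show "AE x in lborel. rep_L2 (mult_sqrt W (u + v)) x = rep_L2 (mult_sqrt W u + mult_sqrt W v) x"
    using rep_mult_sqrt[of "u + v"] rep_mult_sqrt[of u] rep_mult_sqrt[of v] rep_plus_L2[of u v]
      rep_plus_L2[of "mult_sqrt W u" "mult_sqrt W v"]
    by eventually_elim (simp add: algebra_simps)
qed

lemma mult_sqrt_scaleR: "mult_sqrt W (r *\<^sub>R u) = r *\<^sub>R mult_sqrt W u"
proof (rule L2_eqI)
  show "AE x in lborel. rep_L2 (mult_sqrt W (r *\<^sub>R u)) x = rep_L2 (r *\<^sub>R mult_sqrt W u) x"
    using rep_mult_sqrt[of "r *\<^sub>R u"] rep_mult_sqrt[of u] rep_scaleR_L2[of r u]
      rep_scaleR_L2[of r "mult_sqrt W u"]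
    by eventually_elim simp
qed

lemma bounded_linear_mult_sqrt: "bounded_linear (mult_sqrt W)"
proof (rule bounded_linear_intro[where K = "sqrt n"])
  fix u :: "'a L2"
  have n: "0 \<le> n" using W_nonneg W_le order_trans by blast
  have "ennreal ((norm (mult_sqrt W u))\<^sup>2) \<le> (\<integral>\<^sup>+ x. ennreal (n * (norm (rep_L2 u x))\<^sup>2) \<partial>lborel)"
    unfolding norm_mult_sqrt by (intro nn_integral_mono ennreal_leI W_sq_le)
  also have "\<dots> = ennreal n * ennreal ((norm u)\<^sup>2)"
    unfolding norm_sq_L2_nn by (subst nn_integral_cmult[symmetric]) (auto simp: ennreal_mult n)
  also have "\<dots> = ennreal ((norm u * sqrt n)\<^sup>2)"
    using n by (simp add: ennreal_mult[symmetric] power_mult_distrib mult.commute)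
  finally have "(norm (mult_sqrt W u))\<^sup>2 \<le> (norm u * sqrt n)\<^sup>2"
    by (subst (asm) ennreal_le_iff) auto
  then show "norm (mult_sqrt W u) \<le> norm u * sqrt n"
    by (rule power2_le_imp_le) (use n in simp)
qed (simp_all add: mult_sqrt_add mult_sqrt_scaleR)

lemmas mult_sqrt_diff = linear_diff[OF bounded_linear.linear[OF bounded_linear_mult_sqrt]]

end

lemma square_integral_le_integral_square:
  fixes g :: "'a::euclidean_space \<Rightarrow> real"
  assumes g: "continuous_on (cbox 0 One) g"
  shows "(integral (cbox 0 One) g)\<^sup>2 \<le> integral (cbox 0 One) (\<lambda>z. (g z)\<^sup>2)"
proof -
  let ?Q = "cbox 0 (One :: 'a)" and ?c = "integral (cbox 0 One) g"
  have ig: "g integrable_on ?Q" and ig2: "(\<lambda>z. (g z)\<^sup>2) integrable_on ?Q"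
    using g by (auto intro!: integrable_continuous continuous_intros)
  have "((\<lambda>z. (g z)\<^sup>2 - (2 * ?c) * g z + ?c\<^sup>2) has_integral
      (integral ?Q (\<lambda>z. (g z)\<^sup>2) - (2 * ?c) * ?c + measure lborel ?Q *\<^sub>R ?c\<^sup>2)) ?Q"
    by (intro has_integral_add has_integral_diff has_integral_mult_right integrable_integral ig ig2 has_integral_const)
  then have "0 \<le> integral ?Q (\<lambda>z. (g z)\<^sup>2) - (2 * ?c) * ?c + measure lborel ?Q *\<^sub>R ?c\<^sup>2"
  proof (rule has_integral_nonneg)
    fix z
    have "(g z)\<^sup>2 - (2 * ?c) * g z + ?c\<^sup>2 = (g z - ?c)\<^sup>2" by (simp add: power2_diff algebra_simps)
    then show "0 \<le> (g z)\<^sup>2 - (2 * ?c) * g z + ?c\<^sup>2" by simp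
  qed
  then show ?thesis by (simp add: power2_eq_square)
qed

lemma nn_integral_affine:
  fixes F :: "'a::euclidean_space \<Rightarrow> ennreal"
  assumes [measurable]: "F \<in> borel_measurable borel" and c: "c \<noteq> 0"
  shows "(\<integral>\<^sup>+ z. F (y + c *\<^sub>R z) \<partial>lborel) = ennreal (inverse (\<bar>c\<bar> ^ DIM('a))) * (\<integral>\<^sup>+ z. F z \<partial>lborel)"
proof -
  have "(\<integral>\<^sup>+ z. F z \<partial>lborel) = ennreal (\<bar>c\<bar> ^ DIM('a)) * (\<integral>\<^sup>+ z. F (y + c *\<^sub>R z) \<partial>lborel)"
    by (subst lborel_affine[OF c, of y])
       (simp add: nn_integral_density nn_integral_distr nn_integral_cmult)
  then show ?thesis
    using c by (simp add: mult.assoc[symmetric] ennreal_mult[symmetric])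
qed

text \<open>Young's inequality in the form that replaces Hoelder: a large value of \<open>W\<close> is paid for by its
  \<open>p\<close>-th power.\<close>

lemma le_add_powr:
  fixes w t p :: real
  assumes "w \<ge> 0" "t > 0" "p > 1"
  shows "w \<le> t + t powr (1 - p) * w powr p"
proof (cases "w \<le> t")
  case False
  then have "w powr (1 - p) \<le> t powr (1 - p)" using assms by (intro powr_mono2') auto
  then have "w powr (1 - p) * w powr p \<le> t powr (1 - p) * w powr p" by (intro mult_right_mono) auto
  moreover have "w powr (1 - p) * w powr p = w" using False assms by (simp add: powr_add[symmetric])
  ultimately show ?thesis using assms by simp
qed (use assms in \<open>auto intro: add_increasing2\<close>)

text \<open>The exponent \<open>\<gamma>\<close> is the order of the singularity produced by averaging at small scales; \<open>\<gamma> < 1\<close> is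
  the condition \<open>p > d / 2\<close>.\<close>

locale Lp_weight = bounded_weight W n for W :: "'a::euclidean_space \<Rightarrow> real" and n +
  fixes p I \<gamma> :: real
  assumes p: "p > 1" and I: "I \<ge> 0" and \<gamma>_def: "\<gamma> = real DIM('a) / (2 * p)"
    and W_Lp: "(\<integral>\<^sup>+ x. ennreal (W x powr p) \<partial>lborel) \<le> ennreal I"
begin

text \<open>Averages of \<open>W\<close> over cubes of side \<open>h\<close>. The truncation level \<open>t = h powr (- d / p)\<close> in the
  pointwise inequality balances its two terms, since rescaling the cube costs the factor
  \<open>h powr (- d)\<close>.\<close>

lemma cube_integral_weight_le:
  assumes h: "h > 0"
  shows "(\<integral>\<^sup>+ z. ennreal (W (y - h *\<^sub>R z)) * indicator (cbox 0 One) z \<partial>lborel)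
    \<le> ennreal (h powr (- 2 * \<gamma>) * (1 + I))"
proof -
  define t where "t = h powr (- 2 * \<gamma>)"
  have t: "t > 0" using h by (simp add: t_def)
  have "(\<integral>\<^sup>+ z. ennreal (W (y - h *\<^sub>R z)) * indicator (cbox 0 One) z \<partial>lborel)
      \<le> (\<integral>\<^sup>+ z. ennreal t * indicator (cbox 0 One) z
            + ennreal (t powr (1 - p)) * ennreal (W (y + (- h) *\<^sub>R z) powr p) \<partial>lborel)"
  proof (rule nn_integral_mono)
    fix z :: 'a
    have "ennreal (W (y - h *\<^sub>R z)) \<le> ennreal (t + t powr (1 - p) * W (y - h *\<^sub>R z) powr p)"
      by (intro ennreal_leI le_add_powr W_nonneg t p)
    also have "\<dots> = ennreal t + ennreal (t powr (1 - p)) * ennreal (W (y + (- h) *\<^sub>R z) powr p)"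
      using t by (simp add: ennreal_plus ennreal_mult)
    finally show "ennreal (W (y - h *\<^sub>R z)) * indicator (cbox 0 One) z \<le> ennreal t * indicator (cbox 0 One) z
        + ennreal (t powr (1 - p)) * ennreal (W (y + (- h) *\<^sub>R z) powr p)"
      by (auto simp: indicator_def)
  qed
  also have "\<dots> = ennreal t + ennreal (t powr (1 - p)) * (\<integral>\<^sup>+ z. ennreal (W (y + (- h) *\<^sub>R z) powr p) \<partial>lborel)"
  proof -
    have "emeasure lborel (cbox 0 (One::'a)) = 1" by (simp add: emeasure_lborel_cbox)
    then show ?thesis
      by (subst nn_integral_add) (auto simp: nn_integral_cmult nn_integral_cmult_indicator)
  qed
  also have "(\<integral>\<^sup>+ z. ennreal (W (y + (- h) *\<^sub>R z) powr p) \<partial>lborel)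
      = ennreal (inverse (h ^ DIM('a))) * (\<integral>\<^sup>+ x. ennreal (W x powr p) \<partial>lborel)"
    using nn_integral_affine[of "\<lambda>x. ennreal (W x powr p)" "- h" y] h by simp
  also have "ennreal t + ennreal (t powr (1 - p)) * (ennreal (inverse (h ^ DIM('a))) * (\<integral>\<^sup>+ x. ennreal (W x powr p) \<partial>lborel))
      \<le> ennreal t + ennreal (t powr (1 - p)) * (ennreal (inverse (h ^ DIM('a))) * ennreal I)"
    by (intro add_left_mono mult_left_mono W_Lp) auto
  also have "\<dots> = ennreal (t + t powr (1 - p) * inverse (h ^ DIM('a)) * I)"
    using t h I by (simp add: ennreal_mult ennreal_plus mult.assoc)
  also have "t powr (1 - p) * inverse (h ^ DIM('a)) = t"
  proof -
    have "h ^ DIM('a) = h powr (2 * \<gamma> * p)"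
      using h p by (simp add: \<gamma>_def powr_realpow)
    then have "inverse (h ^ DIM('a)) = h powr (- 2 * \<gamma> * p)" by (simp add: powr_minus)
    then show ?thesis
      unfolding t_def by (simp add: powr_powr powr_add[symmetric] algebra_simps)
  qed
  finally show ?thesis by (simp add: t_def algebra_simps)
qed

text \<open>Averaging is smoothing: after Fubini and a shift of the integration variable, the average falls on
  \<open>W\<close> instead of \<open>f\<close>, where the previous estimate applies uniformly in the base point.\<close>

lemma norm_mult_sqrt_cube_average_le:
  assumes h: "h > 0"
  shows "norm (mult_sqrt W (cube_average h f)) \<le> sqrt (1 + I) * h powr (- \<gamma>) * norm f"
proof -
  let ?Q = "cbox 0 (One :: 'a)"
  define g where "g = (\<lambda>z. norm (mult_sqrt W (translate (h *\<^sub>R z) f)))"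
  have cg: "continuous_on ?Q g"
  proof -
    have "continuous_on ?Q ((\<lambda>y. translate y f) \<circ> (\<lambda>z. h *\<^sub>R z))"
      by (intro continuous_on_compose continuous_intros continuous_translate)
    then show ?thesis
      unfolding g_def o_def
      by (intro continuous_intros bounded_linear.continuous_on[OF bounded_linear_mult_sqrt])
  qed
  have "mult_sqrt W (cube_average h f) = integral ?Q (\<lambda>z. mult_sqrt W (translate (h *\<^sub>R z) f))"
    using integral_linear[OF translate_integrable bounded_linear_mult_sqrt, of h f]
    by (simp add: cube_average_def o_def)
  also have "norm \<dots> \<le> integral ?Q g"
  proof (rule integral_norm_bound_integral)
    show "(\<lambda>z. mult_sqrt W (translate (h *\<^sub>R z) f)) integrable_on ?Q"
      using integrable_linear[OF translate_integrable bounded_linear_mult_sqrt, of h f] by (simp add: o_def)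
    show "g integrable_on ?Q" by (rule integrable_continuous[OF cg])
  qed (simp add: g_def)
  finally have 1: "(norm (mult_sqrt W (cube_average h f)))\<^sup>2 \<le> integral ?Q (\<lambda>z. (g z)\<^sup>2)"
    using square_integral_le_integral_square[OF cg]
    by (meson norm_ge_zero order_trans power_mono)
  have g2_int: "(\<lambda>z. (g z)\<^sup>2) integrable_on ?Q"
    using cg by (intro integrable_continuous continuous_intros)
  have meas_g: "(\<lambda>z. if z \<in> ?Q then (g z)\<^sup>2 else 0) \<in> borel_measurable borel"
    using cg by (intro borel_measurable_continuous_on_if continuous_intros) auto
  have "ennreal (integral ?Q (\<lambda>z. (g z)\<^sup>2)) = (\<integral>\<^sup>+ z. ennreal (if z \<in> ?Q then (g z)\<^sup>2 else 0) \<partial>lborel)"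
    by (rule nn_integral_has_integral_lborel[symmetric, OF meas_g])
       (auto simp: has_integral_restrict_UNIV intro!: integrable_integral g2_int)
  also have "\<dots> = (\<integral>\<^sup>+ z. \<integral>\<^sup>+ x. ennreal (W x * (norm (rep_L2 f (x + h *\<^sub>R z)))\<^sup>2) * indicator ?Q z \<partial>lborel \<partial>lborel)"
  proof (rule nn_integral_cong)
    fix z :: 'a
    have "ennreal ((g z)\<^sup>2) = (\<integral>\<^sup>+ x. ennreal (W x * (norm (rep_L2 f (x + h *\<^sub>R z)))\<^sup>2) \<partial>lborel)"
      unfolding g_def norm_mult_sqrt using rep_translate[of "h *\<^sub>R z" f]
      by (intro nn_integral_cong_AE) auto
    then show "ennreal (if z \<in> ?Q then (g z)\<^sup>2 else 0)
        = (\<integral>\<^sup>+ x. ennreal (W x * (norm (rep_L2 f (x + h *\<^sub>R z)))\<^sup>2) * indicator ?Q z \<partial>lborel)"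
      by (simp add: indicator_def)
  qed
  also have "\<dots> = (\<integral>\<^sup>+ z. \<integral>\<^sup>+ y. ennreal (W (y - h *\<^sub>R z) * (norm (rep_L2 f y))\<^sup>2) * indicator ?Q z \<partial>lborel \<partial>lborel)"
  proof (rule nn_integral_cong)
    fix z :: 'a
    have "(\<integral>\<^sup>+ y. ennreal (W (y - h *\<^sub>R z) * (norm (rep_L2 f y))\<^sup>2) * indicator ?Q z \<partial>lborel)
        = (\<integral>\<^sup>+ y. ennreal (W (y - h *\<^sub>R z) * (norm (rep_L2 f y))\<^sup>2) * indicator ?Q z \<partial>distr lborel borel (\<lambda>x. x + h *\<^sub>R z))"
      by (simp only: lborel_translate)
    also have "\<dots> = (\<integral>\<^sup>+ x. ennreal (W x * (norm (rep_L2 f (x + h *\<^sub>R z)))\<^sup>2) * indicator ?Q z \<partial>lborel)"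
      by (subst nn_integral_distr) auto
    finally show "(\<integral>\<^sup>+ x. ennreal (W x * (norm (rep_L2 f (x + h *\<^sub>R z)))\<^sup>2) * indicator ?Q z \<partial>lborel)
        = (\<integral>\<^sup>+ y. ennreal (W (y - h *\<^sub>R z) * (norm (rep_L2 f y))\<^sup>2) * indicator ?Q z \<partial>lborel)" ..
  qed
  also have "\<dots> = (\<integral>\<^sup>+ y. \<integral>\<^sup>+ z. ennreal (W (y - h *\<^sub>R z) * (norm (rep_L2 f y))\<^sup>2) * indicator ?Q z \<partial>lborel \<partial>lborel)"
    by (rule lborel_pair.Fubini') measurable
  also have "\<dots> = (\<integral>\<^sup>+ y. ennreal ((norm (rep_L2 f y))\<^sup>2) *
      (\<integral>\<^sup>+ z. ennreal (W (y - h *\<^sub>R z)) * indicator ?Q z \<partial>lborel) \<partial>lborel)"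
    by (intro nn_integral_cong, subst nn_integral_cmult[symmetric])
       (auto simp: ennreal_mult W_nonneg mult_ac intro!: nn_integral_cong)
  also have "\<dots> \<le> (\<integral>\<^sup>+ y. ennreal ((norm (rep_L2 f y))\<^sup>2) * ennreal (h powr (- 2 * \<gamma>) * (1 + I)) \<partial>lborel)"
    by (intro nn_integral_mono mult_left_mono cube_integral_weight_le h) auto
  also have "\<dots> = ennreal ((norm f)\<^sup>2) * ennreal (h powr (- 2 * \<gamma>) * (1 + I))"
    by (subst nn_integral_multc) (auto simp: norm_sq_L2_nn)
  also have "\<dots> = ennreal ((norm f)\<^sup>2 * (h powr (- 2 * \<gamma>) * (1 + I)))"
    using I by (intro ennreal_mult[symmetric]) auto
  finally have "integral ?Q (\<lambda>z. (g z)\<^sup>2) \<le> (norm f)\<^sup>2 * (h powr (- 2 * \<gamma>) * (1 + I))"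
    using I by (subst (asm) ennreal_le_iff) auto
  with 1 have "(norm (mult_sqrt W (cube_average h f)))\<^sup>2 \<le> (norm f)\<^sup>2 * (h powr (- 2 * \<gamma>) * (1 + I))" by linarith
  also have "h powr (- 2 * \<gamma>) = (h powr (- \<gamma>))\<^sup>2"
    by (simp add: power2_eq_square powr_add[symmetric])
  also have "(norm f)\<^sup>2 * ((h powr (- \<gamma>))\<^sup>2 * (1 + I)) = (sqrt (1 + I) * h powr (- \<gamma>) * norm f)\<^sup>2"
    using I by (simp add: power_mult_distrib)
  finally show ?thesis
    by (rule power2_le_imp_le) (use I in simp)
qed

text \<open>Dyadic scales. Averages at different scales commute, so the difference of two consecutive
  averages splits into averages of \<open>u\<close> minus its averages: the smoothing costs
  \<open>h powr (- \<gamma>)\<close> and the difference gains \<open>h\<close>. The geometric series converges because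
  \<open>\<gamma> < 1\<close>.\<close>

lemma norm_mult_sqrt_le:
  assumes u: "u \<in> H1" and h: "h > 0" and \<gamma>: "\<gamma> < 1"
  shows "norm (mult_sqrt W u) \<le> sqrt (1 + I) * h powr (- \<gamma>) * norm u
    + 3 * sqrt (1 + I) / (1 - (1/2) powr (1 - \<gamma>)) * h powr (1 - \<gamma>) * grad_norm u"
proof -
  define k where "k = (\<lambda>j::nat. h * (1/2) ^ j)"
  define A :: "nat \<Rightarrow> 'a L2 \<Rightarrow> 'a L2" where "A = (\<lambda>j. cube_average (k j))"
  define c where "c = sqrt (1 + I)"
  define r where "r = (1/2 :: real) powr (1 - \<gamma>)"
  let ?G = "grad_norm u"
  have k_pos: "k j > 0" for j using h by (simp add: k_def)
  have c: "c \<ge> 0" using I by (simp add: c_def)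
  have \<gamma>0: "\<gamma> > 0" using p by (simp add: \<gamma>_def)
  have r: "0 < r" "r < 1" using \<gamma> powr_less_mono2[of "1 - \<gamma>" "1/2" 1] by (auto simp: r_def)
  have smooth: "norm (mult_sqrt W (A j f)) \<le> c * k j powr (- \<gamma>) * norm f" for j f
    unfolding A_def c_def by (rule norm_mult_sqrt_cube_average_le[OF k_pos])
  have approx: "norm (A j u - u) \<le> k j * ?G" for j
    unfolding A_def using norm_cube_average_diff_le[OF u] k_pos[of j] by simp
  have bl: "bounded_linear (A j)" for j unfolding A_def by (rule bounded_linear_cube_average)
  have step: "norm (mult_sqrt W (A (Suc j) u) - mult_sqrt W (A j u)) \<le> 3 * c * h powr (1 - \<gamma>) * ?G * r ^ j" for j
  proof -
    have half: "k (Suc j) = k j / 2" by (simp add: k_def)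
    have comm: "A (Suc j) (A j u) = A j (A (Suc j) u)" unfolding A_def by (rule cube_average_cube_average_commute)
    \<comment> \<open>Adding and subtracting the double average, in either order of the two scales.\<close>
    have "A (Suc j) u - A j u = A (Suc j) (u - A j u) + A j (A (Suc j) u - u)"
      by (simp add: linear_diff[OF bounded_linear.linear[OF bl]] comm)
    then have "mult_sqrt W (A (Suc j) u) - mult_sqrt W (A j u)
        = mult_sqrt W (A (Suc j) (u - A j u)) + mult_sqrt W (A j (A (Suc j) u - u))"
      by (simp add: mult_sqrt_diff[symmetric] mult_sqrt_add[symmetric])
    then have "norm (mult_sqrt W (A (Suc j) u) - mult_sqrt W (A j u))
        \<le> norm (mult_sqrt W (A (Suc j) (u - A j u))) + norm (mult_sqrt W (A j (A (Suc j) u - u)))"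
      using norm_triangle_ineq by simp
    also have "\<dots> \<le> c * k (Suc j) powr (- \<gamma>) * (k j * ?G) + c * k j powr (- \<gamma>) * (k (Suc j) * ?G)"
      using approx[of j] approx[of "Suc j"] c
      by (intro add_mono order_trans[OF smooth] mult_left_mono) (auto simp: norm_minus_commute)
    also have "k (Suc j) powr (- \<gamma>) = 2 powr \<gamma> * k j powr (- \<gamma>)"
      unfolding half using k_pos[of j] by (simp add: powr_divide powr_minus field_simps)
    also have "c * (2 powr \<gamma> * k j powr (- \<gamma>)) * (k j * ?G) + c * k j powr (- \<gamma>) * (k (Suc j) * ?G)
        = c * (2 powr \<gamma> + 1/2) * ((k j powr (- \<gamma>) * k j) * ?G)"
      unfolding half by (simp add: algebra_simps)
    also have "k j powr (- \<gamma>) * k j = h powr (1 - \<gamma>) * r ^ j"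
    proof -
      have "k j powr (- \<gamma>) * k j = k j powr (- \<gamma>) * k j powr 1" using k_pos[of j] by simp
      also have "\<dots> = k j powr (1 - \<gamma>)" by (simp only: powr_add[symmetric]) simp
      also have "\<dots> = h powr (1 - \<gamma>) * ((1/2) ^ j) powr (1 - \<gamma>)"
        unfolding k_def using h by (simp add: powr_mult)
      also have "((1/2 :: real) ^ j) powr (1 - \<gamma>) = r ^ j"
        unfolding r_def by (simp add: powr_realpow[symmetric] powr_powr mult.commute)
      finally show ?thesis .
    qed
    also have "c * (2 powr \<gamma> + 1/2) * (h powr (1 - \<gamma>) * r ^ j * ?G) \<le> c * 3 * (h powr (1 - \<gamma>) * r ^ j * ?G)"
    proof -
      have "2 powr \<gamma> \<le> 2 powr 1" using \<gamma> by (intro powr_mono) auto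
      then show ?thesis
        using c r by (intro mult_right_mono mult_left_mono mult_nonneg_nonneg grad_norm_nonneg) auto
    qed
    finally show ?thesis by (simp add: mult_ac)
  qed
  let ?B = "c * h powr (- \<gamma>) * norm u + 3 * c / (1 - r) * h powr (1 - \<gamma>) * ?G"
  have bound: "norm (mult_sqrt W (A m u)) \<le> ?B" for m
  proof -
    have partial: "norm (mult_sqrt W (A m u)) \<le> c * h powr (- \<gamma>) * norm u + 3 * c * h powr (1 - \<gamma>) * ?G * (\<Sum>j<m. r ^ j)"
    proof (induction m)
      case 0
      then show ?case using smooth[of 0 u] by (simp add: k_def)
    next
      case (Suc m)
      have "norm (mult_sqrt W (A (Suc m) u)) \<le> norm (mult_sqrt W (A m u)) + norm (mult_sqrt W (A (Suc m) u) - mult_sqrt W (A m u))"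
        by (rule norm_triangle_sub)
      then show ?case using Suc step[of m] by (simp add: distrib_left)
    qed
    have "(\<Sum>j<m. r ^ j) \<le> 1 / (1 - r)"
      using sum_le_suminf[of "\<lambda>j. r ^ j" "{..<m}"] r suminf_geometric[of r] by (simp add: summable_geometric)
    then have "3 * c * h powr (1 - \<gamma>) * ?G * (\<Sum>j<m. r ^ j) \<le> 3 * c * h powr (1 - \<gamma>) * ?G * (1 / (1 - r))"
      using c by (intro mult_left_mono mult_nonneg_nonneg grad_norm_nonneg) auto
    with partial show ?thesis by simp
  qed
  have "(\<lambda>m. A m u - u) \<longlonglongrightarrow> 0"
  proof (rule Lim_null_comparison)
    show "\<forall>\<^sub>F m in sequentially. norm (A m u - u) \<le> k m * ?G" using approx by simp
    have "(\<lambda>m. h * (1/2) ^ m * ?G) \<longlonglongrightarrow> h * 0 * ?G"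
      by (intro tendsto_mult tendsto_const LIMSEQ_realpow_zero) auto
    then show "(\<lambda>m. k m * ?G) \<longlonglongrightarrow> 0" by (simp add: k_def)
  qed
  then have "(\<lambda>m. A m u) \<longlonglongrightarrow> u" by (simp add: LIM_zero_iff)
  then have "(\<lambda>m. norm (mult_sqrt W (A m u))) \<longlonglongrightarrow> norm (mult_sqrt W u)"
    by (intro tendsto_norm bounded_linear.tendsto[OF bounded_linear_mult_sqrt])
  then show ?thesis
    unfolding c_def[symmetric] r_def[symmetric]
    by (rule LIMSEQ_le_const2) (use bound in blast)
qed

end

section \<open>Infinitesimal form-boundedness of the potential\<close>

definition grad_sq :: "'a::euclidean_space L2 \<Rightarrow> real" where
  "grad_sq u = (\<Sum>b\<in>Basis. (norm (weak_deriv u b))\<^sup>2)"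

lemma grad_sq_nonneg: "0 \<le> grad_sq u"
  by (simp add: grad_sq_def sum_nonneg)

lemma grad_norm_sq_le: "(grad_norm (u :: 'a::euclidean_space L2))\<^sup>2 \<le> grad_sq u * real DIM('a)"
  unfolding grad_norm_def grad_sq_def by (rule sum_squared_le_sum_of_squares)

text \<open>In the dyadic estimate, the gradient carries a positive power of the scale \<open>h\<close>; a small \<open>h\<close> makes its
  coefficient as small as desired. Truncations of \<open>|V|\<close> satisfy the estimate with common constants,
  and monotone convergence removes the truncation.\<close>

lemma Lp_form_bound:
  fixes V :: "'a::euclidean_space \<Rightarrow> real"
  assumes p: "p > max 1 (real DIM('a) / 2)" and [measurable]: "V \<in> borel_measurable borel"
    and int: "integrable lborel (\<lambda>x. \<bar>V x\<bar> powr p)" and \<epsilon>: "\<epsilon> > 0"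
  shows "\<exists>C\<ge>0. \<forall>u\<in>H1. (\<integral>\<^sup>+ x. ennreal (\<bar>V x\<bar> * (norm (rep_L2 u x))\<^sup>2) \<partial>lborel)
    \<le> ennreal (\<epsilon> * grad_sq u + C * (norm u)\<^sup>2)"
proof -
  define I where "I = (LINT x|lborel. \<bar>V x\<bar> powr p)"
  define \<gamma> where "\<gamma> = real DIM('a) / (2 * p)"
  have p1: "p > 1" and \<gamma>: "\<gamma> < 1" using p by (auto simp: \<gamma>_def field_simps)
  have I: "I \<ge> 0" unfolding I_def by simp
  define W where "W = (\<lambda>n::nat. \<lambda>x. min \<bar>V x\<bar> (real n))"
  have weight: "Lp_weight (W n) (real n) p I \<gamma>" for n
  proof
    show "W n \<in> borel_measurable borel" unfolding W_def by measurable
    have "(\<integral>\<^sup>+ x. ennreal (W n x powr p) \<partial>lborel) \<le> (\<integral>\<^sup>+ x. ennreal (\<bar>V x\<bar> powr p) \<partial>lborel)"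
      using p1 by (intro nn_integral_mono ennreal_leI powr_mono2) (auto simp: W_def)
    also have "\<dots> = ennreal I" unfolding I_def by (rule nn_integral_eq_integral[OF int]) simp
    finally show "(\<integral>\<^sup>+ x. ennreal (W n x powr p) \<partial>lborel) \<le> ennreal I" .
  qed (use p1 I in \<open>auto simp: W_def \<gamma>_def\<close>)
  define c where "c = 3 * sqrt (1 + I) / (1 - (1/2) powr (1 - \<gamma>))"
  have "(1/2 :: real) powr (1 - \<gamma>) < 1" using \<gamma> powr_less_mono2[of "1 - \<gamma>" "1/2" 1] by simp
  then have c: "c > 0" using I by (simp add: c_def)
  define s where "s = sqrt (\<epsilon> / (2 * real DIM('a)))"
  have s: "s > 0" and s2: "2 * s\<^sup>2 * real DIM('a) = \<epsilon>" using \<epsilon> by (auto simp: s_def)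
  \<comment> \<open>The scale at which the gradient term has coefficient exactly \<open>s\<close>; by Cauchy-Schwarz over the directions, \<open>s\<close> leads to \<open>\<epsilon>\<close>.\<close>
  define h where "h = (s / c) powr (1 / (1 - \<gamma>))"
  have h: "h > 0" and hs: "c * h powr (1 - \<gamma>) = s" using s c \<gamma> by (auto simp: h_def powr_powr)
  define a where "a = sqrt (1 + I) * h powr (- \<gamma>)"
  have trunc: "(\<integral>\<^sup>+ x. ennreal (W n x * (norm (rep_L2 u x))\<^sup>2) \<partial>lborel)
      \<le> ennreal (\<epsilon> * grad_sq u + 2 * a\<^sup>2 * (norm u)\<^sup>2)" if u: "u \<in> H1" for n u
  proof -
    interpret Lp_weight "W n" "real n" p I \<gamma> by (rule weight)
    have "norm (mult_sqrt (W n) u) \<le> a * norm u + s * grad_norm u"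
      using norm_mult_sqrt_le[OF u h \<gamma>] by (simp only: a_def[symmetric] c_def[symmetric] hs)
    then have "(norm (mult_sqrt (W n) u))\<^sup>2 \<le> (a * norm u + s * grad_norm u)\<^sup>2"
      by (intro power_mono) auto
    also have "\<dots> \<le> 2 * (a * norm u)\<^sup>2 + 2 * (s * grad_norm u)\<^sup>2"
      using sum_squares_bound[of "a * norm u" "s * grad_norm u"] by (simp add: power2_sum)
    also have "2 * (s * grad_norm u)\<^sup>2 \<le> 2 * s\<^sup>2 * (grad_sq u * real DIM('a))"
      unfolding power_mult_distrib using grad_norm_sq_le[of u] by (simp add: mult_left_mono)
    finally have "(norm (mult_sqrt (W n) u))\<^sup>2 \<le> \<epsilon> * grad_sq u + 2 * a\<^sup>2 * (norm u)\<^sup>2"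
      using s2 by (simp add: power_mult_distrib algebra_simps)
    then show ?thesis unfolding norm_mult_sqrt[symmetric] by (rule ennreal_leI)
  qed
  have "(\<integral>\<^sup>+ x. ennreal (\<bar>V x\<bar> * (norm (rep_L2 u x))\<^sup>2) \<partial>lborel) \<le> ennreal (\<epsilon> * grad_sq u + 2 * a\<^sup>2 * (norm u)\<^sup>2)"
    if u: "u \<in> H1" for u
  proof -
    let ?f = "\<lambda>n x. ennreal (W n x * (norm (rep_L2 u x))\<^sup>2)"
    have "ennreal (\<bar>V x\<bar> * (norm (rep_L2 u x))\<^sup>2) \<le> (SUP n. ?f n x)" for x
    proof -
      obtain n :: nat where "\<bar>V x\<bar> \<le> real n" using real_arch_simple by blast
      then have "ennreal (\<bar>V x\<bar> * (norm (rep_L2 u x))\<^sup>2) = ?f n x" by (simp add: W_def)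
      also have "?f n x \<le> (SUP n. ?f n x)" by (rule SUP_upper) simp
      finally show ?thesis .
    qed
    then have "(\<integral>\<^sup>+ x. ennreal (\<bar>V x\<bar> * (norm (rep_L2 u x))\<^sup>2) \<partial>lborel) \<le> (\<integral>\<^sup>+ x. (SUP n. ?f n x) \<partial>lborel)"
      by (rule nn_integral_mono)
    also have "\<dots> = (SUP n. \<integral>\<^sup>+ x. ?f n x \<partial>lborel)"
    proof (rule nn_integral_monotone_convergence_SUP)
      show "incseq ?f"
        by (auto simp: incseq_def le_fun_def W_def intro!: ennreal_leI mult_right_mono)
      show "?f n \<in> borel_measurable lborel" for n unfolding W_def by measurable
    qed
    also have "\<dots> \<le> ennreal (\<epsilon> * grad_sq u + 2 * a\<^sup>2 * (norm u)\<^sup>2)"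
      by (intro SUP_least trunc u)
    finally show ?thesis .
  qed
  then show ?thesis by (intro exI[of _ "2 * a\<^sup>2"]) auto
qed

text \<open>Infinitesimal form-boundedness relative to the Dirichlet form means that for every \<open>\<epsilon> > 0\<close> this
  holds for some \<open>C\<close>.\<close>

definition form_bounded :: "('a::euclidean_space \<Rightarrow> real) \<Rightarrow> real \<Rightarrow> real \<Rightarrow> bool" where
  "form_bounded V \<epsilon> C \<longleftrightarrow> C \<ge> 0 \<and> V \<in> borel_measurable borel \<and>
    (\<forall>u\<in>H1. integrable lborel (\<lambda>x. \<bar>V x\<bar> * (norm (rep_L2 u x))\<^sup>2) \<and>
       (LINT x|lborel. \<bar>V x\<bar> * (norm (rep_L2 u x))\<^sup>2) \<le> \<epsilon> * grad_sq u + C * (norm u)\<^sup>2)"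

lemma Lp_plus_Linfty_form_bounded:
  fixes V :: "'a::euclidean_space \<Rightarrow> real"
  assumes p: "p > max 1 (real DIM('a) / 2)" and V: "Lp_plus_Linfty p V" and \<epsilon>: "\<epsilon> > 0"
  shows "\<exists>C. form_bounded V \<epsilon> C"
proof -
  obtain V1 V2 B where [measurable]: "V1 \<in> borel_measurable borel" "V2 \<in> borel_measurable borel"
    and int: "integrable lborel (\<lambda>x. \<bar>V1 x\<bar> powr p)"
    and B: "AE x in lborel. \<bar>V2 x\<bar> \<le> B" and V_eq: "V = (\<lambda>x. V1 x + V2 x)"
    using V unfolding Lp_plus_Linfty_def by auto
  have [measurable]: "V \<in> borel_measurable borel" unfolding V_eq by measurable
  obtain C where C: "C \<ge> 0" and bound: "\<And>u. u \<in> H1 \<Longrightarrow>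
      (\<integral>\<^sup>+ x. ennreal (\<bar>V1 x\<bar> * (norm (rep_L2 u x))\<^sup>2) \<partial>lborel) \<le> ennreal (\<epsilon> * grad_sq u + C * (norm u)\<^sup>2)"
    using Lp_form_bound[OF p _ int \<epsilon>] by auto
  define B' where "B' = max B 0"
  have main: "(\<integral>\<^sup>+ x. ennreal (\<bar>V x\<bar> * (norm (rep_L2 u x))\<^sup>2) \<partial>lborel)
      \<le> ennreal (\<epsilon> * grad_sq u + (C + B') * (norm u)\<^sup>2)" if u: "u \<in> H1" for u
  proof -
    have "(\<integral>\<^sup>+ x. ennreal (\<bar>V x\<bar> * (norm (rep_L2 u x))\<^sup>2) \<partial>lborel)
        \<le> (\<integral>\<^sup>+ x. ennreal (\<bar>V1 x\<bar> * (norm (rep_L2 u x))\<^sup>2) + ennreal B' * ennreal ((norm (rep_L2 u x))\<^sup>2) \<partial>lborel)"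
    proof (rule nn_integral_mono_AE)
      show "AE x in lborel. ennreal (\<bar>V x\<bar> * (norm (rep_L2 u x))\<^sup>2)
          \<le> ennreal (\<bar>V1 x\<bar> * (norm (rep_L2 u x))\<^sup>2) + ennreal B' * ennreal ((norm (rep_L2 u x))\<^sup>2)"
        using B
      proof eventually_elim
        case (elim x)
        have "\<bar>V x\<bar> \<le> \<bar>V1 x\<bar> + B'" using elim by (auto simp: V_eq B'_def)
        then have "ennreal (\<bar>V x\<bar> * (norm (rep_L2 u x))\<^sup>2) \<le> ennreal ((\<bar>V1 x\<bar> + B') * (norm (rep_L2 u x))\<^sup>2)"
          by (intro ennreal_leI mult_right_mono) auto
        also have "\<dots> = ennreal (\<bar>V1 x\<bar> * (norm (rep_L2 u x))\<^sup>2) + ennreal B' * ennreal ((norm (rep_L2 u x))\<^sup>2)"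
          by (simp add: distrib_right ennreal_plus ennreal_mult B'_def)
        finally show ?case .
      qed
    qed
    also have "\<dots> = (\<integral>\<^sup>+ x. ennreal (\<bar>V1 x\<bar> * (norm (rep_L2 u x))\<^sup>2) \<partial>lborel) + ennreal B' * ennreal ((norm u)\<^sup>2)"
      by (subst nn_integral_add) (auto simp: nn_integral_cmult norm_sq_L2_nn)
    also have "\<dots> \<le> ennreal (\<epsilon> * grad_sq u + C * (norm u)\<^sup>2) + ennreal B' * ennreal ((norm u)\<^sup>2)"
      by (intro add_right_mono bound u)
    also have "\<dots> = ennreal (\<epsilon> * grad_sq u + (C + B') * (norm u)\<^sup>2)"
      using C \<epsilon> grad_sq_nonneg[of u]
      by (simp add: ennreal_mult[symmetric] ennreal_plus[symmetric] B'_def algebra_simps del: ennreal_plus)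
    finally show ?thesis .
  qed
  have "integrable lborel (\<lambda>x. \<bar>V x\<bar> * (norm (rep_L2 u x))\<^sup>2) \<and>
     (LINT x|lborel. \<bar>V x\<bar> * (norm (rep_L2 u x))\<^sup>2) \<le> \<epsilon> * grad_sq u + (C + B') * (norm u)\<^sup>2" if u: "u \<in> H1" for u
  proof
    show int: "integrable lborel (\<lambda>x. \<bar>V x\<bar> * (norm (rep_L2 u x))\<^sup>2)"
      using main[OF u] by (intro integrableI_nonneg) (auto intro: le_less_trans)
    have "ennreal (LINT x|lborel. \<bar>V x\<bar> * (norm (rep_L2 u x))\<^sup>2)
        = (\<integral>\<^sup>+ x. ennreal (\<bar>V x\<bar> * (norm (rep_L2 u x))\<^sup>2) \<partial>lborel)"
      by (rule nn_integral_eq_integral[symmetric, OF int]) simp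
    with main[OF u] have "ennreal (LINT x|lborel. \<bar>V x\<bar> * (norm (rep_L2 u x))\<^sup>2)
        \<le> ennreal (\<epsilon> * grad_sq u + (C + B') * (norm u)\<^sup>2)" by simp
    then show "(LINT x|lborel. \<bar>V x\<bar> * (norm (rep_L2 u x))\<^sup>2) \<le> \<epsilon> * grad_sq u + (C + B') * (norm u)\<^sup>2"
      using \<epsilon> C grad_sq_nonneg[of u] by (subst (asm) ennreal_le_iff) (auto simp: B'_def)
  qed
  then show ?thesis
    unfolding form_bounded_def using C by (intro exI[of _ "C + B'"]) (auto simp: B'_def)
qed

section \<open>The energy form\<close>

text \<open>Relative bound \<open>1/4\<close> is less than the coefficient \<open>1/2\<close> of the Dirichlet form in the energy, so a
  quarter of the Dirichlet form survives the subtraction of the potential energy.\<close>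

locale energy_form =
  fixes V :: "'a::euclidean_space \<Rightarrow> real" and C :: real
  assumes V_form_bounded: "form_bounded V (1/4) C"
begin

lemma V_measurable [measurable]: "V \<in> borel_measurable borel"
  using V_form_bounded by (auto simp: form_bounded_def)

lemma V_integrable: "u \<in> H1 \<Longrightarrow> integrable lborel (\<lambda>x. \<bar>V x\<bar> * (norm (rep_L2 u x))\<^sup>2)"
  and V_bound: "u \<in> H1 \<Longrightarrow>
    (LINT x|lborel. \<bar>V x\<bar> * (norm (rep_L2 u x))\<^sup>2) \<le> (1/4) * grad_sq u + C * (norm u)\<^sup>2"
  using V_form_bounded by (auto simp: form_bounded_def)

definition potential :: "'a L2 \<Rightarrow> 'a L2 \<Rightarrow> complex" where
  "potential \<phi> u = (LINT x|lborel. cnj (rep_L2 \<phi> x) * complex_of_real (V x) * rep_L2 u x)"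

lemma potential_integrable:
  assumes "\<phi> \<in> H1" "u \<in> H1"
  shows "integrable lborel (\<lambda>x. cnj (rep_L2 \<phi> x) * complex_of_real (V x) * rep_L2 u x)"
proof (rule Bochner_Integration.integrable_bound)
  show "integrable lborel (\<lambda>x. \<bar>V x\<bar> * (norm (rep_L2 \<phi> x))\<^sup>2 + \<bar>V x\<bar> * (norm (rep_L2 u x))\<^sup>2)"
    using assms by (intro Bochner_Integration.integrable_add V_integrable)
  have "norm (cnj a * complex_of_real v * b) \<le> norm (\<bar>v\<bar> * (norm a)\<^sup>2 + \<bar>v\<bar> * (norm b)\<^sup>2)" for a b :: complex and v
  proof -
    have "2 * (norm a * norm b) \<le> (norm a)\<^sup>2 + (norm b)\<^sup>2" using sum_squares_bound[of "norm a" "norm b"] by simp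
    then have "norm a * norm b \<le> (norm a)\<^sup>2 + (norm b)\<^sup>2"
      using mult_nonneg_nonneg[OF norm_ge_zero[of a] norm_ge_zero[of b]] by linarith
    then have "\<bar>v\<bar> * (norm a * norm b) \<le> \<bar>v\<bar> * ((norm a)\<^sup>2 + (norm b)\<^sup>2)" by (rule mult_left_mono) simp
    then show ?thesis by (simp add: norm_mult distrib_left mult_ac)
  qed
  then show "AE x in lborel. norm (cnj (rep_L2 \<phi> x) * complex_of_real (V x) * rep_L2 u x)
      \<le> norm (\<bar>V x\<bar> * (norm (rep_L2 \<phi> x))\<^sup>2 + \<bar>V x\<bar> * (norm (rep_L2 u x))\<^sup>2)" by simp
qed measurable

lemma potential_commute: "potential u \<phi> = cnj (potential \<phi> u)"
  unfolding potential_def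
  by (subst Bochner_Integration.integral_cnj[symmetric], rule Bochner_Integration.integral_cong) (auto simp: mult_ac)

lemma potential_add:
  assumes "\<phi> \<in> H1" "\<psi> \<in> H1" "u \<in> H1"
  shows "potential (\<phi> + \<psi>) u = potential \<phi> u + potential \<psi> u"
proof -
  have "potential (\<phi> + \<psi>) u = (LINT x|lborel. cnj (rep_L2 \<phi> x) * complex_of_real (V x) * rep_L2 u x
      + cnj (rep_L2 \<psi> x) * complex_of_real (V x) * rep_L2 u x)"
    unfolding potential_def
  proof (rule integral_cong_AE)
    show "AE x in lborel. cnj (rep_L2 (\<phi> + \<psi>) x) * complex_of_real (V x) * rep_L2 u x
        = cnj (rep_L2 \<phi> x) * complex_of_real (V x) * rep_L2 u x + cnj (rep_L2 \<psi> x) * complex_of_real (V x) * rep_L2 u x"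
      using rep_plus_L2[of \<phi> \<psi>] by eventually_elim (simp add: algebra_simps)
  qed measurable
  also have "\<dots> = potential \<phi> u + potential \<psi> u"
    unfolding potential_def by (intro Bochner_Integration.integral_add potential_integrable assms)
  finally show ?thesis .
qed

lemma potential_scaleC: "potential (c *\<^sub>C \<phi>) u = cnj c * potential \<phi> u"
proof -
  have "potential (c *\<^sub>C \<phi>) u = (LINT x|lborel. cnj c * (cnj (rep_L2 \<phi> x) * complex_of_real (V x) * rep_L2 u x))"
    unfolding potential_def
  proof (rule integral_cong_AE)
    show "AE x in lborel. cnj (rep_L2 (c *\<^sub>C \<phi>) x) * complex_of_real (V x) * rep_L2 u x
        = cnj c * (cnj (rep_L2 \<phi> x) * complex_of_real (V x) * rep_L2 u x)"
      using rep_scaleC[of c \<phi>] by eventually_elim simp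
  qed measurable
  also have "\<dots> = cnj c * potential \<phi> u" unfolding potential_def by (rule integral_mult_right_zero)
  finally show ?thesis .
qed

lemma potential_diagonal_bound: 
  assumes "u \<in> H1"
  shows "\<bar>Re (potential u u)\<bar> \<le> (1/4) * grad_sq u + C * (norm u)\<^sup>2"
proof -
  have "\<bar>Re (potential u u)\<bar> \<le> norm (potential u u)" by (rule abs_Re_le_cmod)
  also have "\<dots> \<le> (LINT x|lborel. norm (cnj (rep_L2 u x) * complex_of_real (V x) * rep_L2 u x))"
    unfolding potential_def by (rule integral_norm_bound)
  also have "\<dots> = (LINT x|lborel. \<bar>V x\<bar> * (norm (rep_L2 u x))\<^sup>2)"
    by (rule Bochner_Integration.integral_cong) (auto simp: norm_mult power2_eq_square mult_ac)
  finally show ?thesis using V_bound[OF assms] by linarith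
qed

definition Q :: "'a L2 \<Rightarrow> 'a L2 \<Rightarrow> complex" where
  "Q \<phi> u = (1/2) * (\<Sum>b\<in>Basis. \<langle>weak_deriv \<phi> b, weak_deriv u b\<rangle>) + potential \<phi> u"

lemma schroedinger_op_iff: "schroedinger_op V u w \<longleftrightarrow> u \<in> H1 \<and> (\<forall>\<phi>\<in>H1. Q \<phi> u = \<langle>\<phi>, w\<rangle>)"
  by (simp add: schroedinger_op_def Q_def potential_def)

lemma Q_commute: "Q u \<phi> = cnj (Q \<phi> u)"
  by (simp add: Q_def potential_commute[of u \<phi>] cinner_commute[of "weak_deriv \<phi> _" "weak_deriv u _"])

lemma Q_add: "\<phi> \<in> H1 \<Longrightarrow> \<psi> \<in> H1 \<Longrightarrow> u \<in> H1 \<Longrightarrow> Q (\<phi> + \<psi>) u = Q \<phi> u + Q \<psi> u"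
  by (simp add: Q_def potential_add weak_deriv_add cinner_add_left sum.distrib algebra_simps)

lemma Q_scaleC: "\<phi> \<in> H1 \<Longrightarrow> Q (c *\<^sub>C \<phi>) u = cnj c * Q \<phi> u"
  by (simp add: Q_def potential_scaleC weak_deriv_scaleC cinner_scaleC_left sum_distrib_left algebra_simps)

text \<open>The shift by \<open>C\<close> absorbs the lower-order term of the form bound, and the additional \<open>1\<close> makes the
  form dominate the \<open>L2\<close> norm. Unitary maps preserve the shift, so conservation of this form is
  conservation of energy.\<close>

definition E :: "'a L2 \<Rightarrow> 'a L2 \<Rightarrow> real" where
  "E \<phi> u = Re (Q \<phi> u) + (C + 1) * inner \<phi> u"

lemma Re_Q_diagonal: "Re (Q u u) = grad_sq u / 2 + Re (potential u u)"
proof -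
  have "(\<Sum>b\<in>Basis. \<langle>weak_deriv u b, weak_deriv u b\<rangle>) = complex_of_real (grad_sq u)"
    by (simp only: grad_sq_def cinner_self of_real_sum)
  then show ?thesis by (simp add: Q_def)
qed

lemma E_lower: "u \<in> H1 \<Longrightarrow> grad_sq u / 4 + (norm u)\<^sup>2 \<le> E u u"
  using potential_diagonal_bound[of u]
  by (simp add: E_def Re_Q_diagonal power2_norm_eq_inner[symmetric] abs_le_iff algebra_simps)

lemma E_upper: "u \<in> H1 \<Longrightarrow> E u u \<le> grad_sq u + (2 * C + 1) * (norm u)\<^sup>2"
  using potential_diagonal_bound[of u] grad_sq_nonneg[of u]
  by (simp add: E_def Re_Q_diagonal power2_norm_eq_inner[symmetric] abs_le_iff algebra_simps)

lemma norm_sq_le_E: "u \<in> H1 \<Longrightarrow> (norm u)\<^sup>2 \<le> E u u"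
  using E_lower[of u] grad_sq_nonneg[of u] by linarith

lemma weak_deriv_sq_le_E:
  assumes "u \<in> H1" "b \<in> Basis"
  shows "(norm (weak_deriv u b))\<^sup>2 \<le> 4 * E u u"
proof -
  have "(norm (weak_deriv u b))\<^sup>2 \<le> grad_sq u"
    unfolding grad_sq_def using assms(2) by (intro member_le_sum) auto
  then show ?thesis using E_lower[OF assms(1)] zero_le_power2[of "norm u"] by linarith
qed

text \<open>The form is equivalent to the squared Sobolev norm, and weak derivatives are closed under \<open>L2\<close>
  limits.\<close>

sublocale complete_form H1 E
proof
  show "subspace (H1 :: 'a L2 set)" by (rule subspace_H1)
  show "E x y = E y x" for x y
    using Q_commute[of x y] by (simp add: E_def inner_commute)
  show "E (x + y) z = E x z + E y z" if "x \<in> H1" "y \<in> H1" "z \<in> H1" for x y z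
    using that by (simp add: E_def Q_add inner_add_left algebra_simps)
  show "E (r *\<^sub>R x) y = r * E x y" if "x \<in> H1" "y \<in> H1" for r x y
    using Q_scaleC[OF that(1), of "complex_of_real r" y]
    by (simp add: E_def scaleC_of_real algebra_simps)
  show "0 \<le> E x x" if "x \<in> H1" for x
    using norm_sq_le_E[OF that] zero_le_power2[of "norm x"] by linarith
next
  fix X :: "nat \<Rightarrow> 'a L2"
  assume X: "\<And>n. X n \<in> H1" and C: "\<And>e. e > 0 \<Longrightarrow> \<exists>M. \<forall>m\<ge>M. \<forall>n\<ge>M. E (X m - X n) (X m - X n) < e"
  have "\<exists>x. X \<longlonglongrightarrow> x"
  proof (rule Cauchy_L2I)
    fix e :: real assume "e > 0"
    then obtain M where "\<forall>m\<ge>M. \<forall>n\<ge>M. E (X m - X n) (X m - X n) < e" using C by blast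
    then show "\<exists>M. \<forall>m\<ge>M. \<forall>n\<ge>M. (norm (X m - X n))\<^sup>2 < e"
      using norm_sq_le_E[OF H1_diff[OF X X]] by (meson le_less_trans)
  qed
  then obtain x where x: "X \<longlonglongrightarrow> x" by blast
  have "\<exists>v. (\<lambda>n. weak_deriv (X n) b) \<longlonglongrightarrow> v" if b: "b \<in> Basis" for b
  proof (rule Cauchy_L2I)
    fix e :: real assume "e > 0"
    then obtain M where M: "\<forall>m\<ge>M. \<forall>n\<ge>M. E (X m - X n) (X m - X n) < e / 4" using C[of "e / 4"] by auto
    have "(norm (weak_deriv (X m) b - weak_deriv (X n) b))\<^sup>2 < e" if "m \<ge> M" "n \<ge> M" for m n
      using weak_deriv_sq_le_E[OF H1_diff[OF X X] b, of m n] M that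
      by (simp add: weak_deriv_diff X b) (smt (verit))
    then show "\<exists>M. \<forall>m\<ge>M. \<forall>n\<ge>M. (norm (weak_deriv (X m) b - weak_deriv (X n) b))\<^sup>2 < e" by blast
  qed
  then obtain v where v: "\<And>b. b \<in> Basis \<Longrightarrow> (\<lambda>n. weak_deriv (X n) b) \<longlonglongrightarrow> v b" by metis
  have wd: "has_weak_deriv x b (v b)" if "b \<in> Basis" for b
    by (rule has_weak_deriv_closed[OF that has_weak_deriv_weak_deriv[OF X that] x v[OF that]])
  then have xH: "x \<in> H1" by (auto simp: H1_def)
  have v_eq: "v b = weak_deriv x b" if "b \<in> Basis" for b using weak_deriv_eqI[OF that wd[OF that]] by simp
  have "(\<lambda>n. grad_sq (X n - x)) \<longlonglongrightarrow> (\<Sum>b\<in>(Basis :: 'a set). 0)"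
    unfolding grad_sq_def
  proof (rule tendsto_sum)
    fix b :: 'a assume b: "b \<in> Basis"
    show "(\<lambda>n. (norm (weak_deriv (X n - x) b))\<^sup>2) \<longlonglongrightarrow> 0"
      using tendsto_norm_diff_sq[OF v[OF b]] by (simp add: weak_deriv_diff[OF b X xH] v_eq[OF b])
  qed
  then have "(\<lambda>n. grad_sq (X n - x) + (2 * C + 1) * (norm (X n - x))\<^sup>2) \<longlonglongrightarrow> 0 + (2 * C + 1) * 0"
    by (intro tendsto_add tendsto_mult tendsto_const tendsto_norm_diff_sq x) simp
  then have lim: "(\<lambda>n. grad_sq (X n - x) + (2 * C + 1) * (norm (X n - x))\<^sup>2) \<longlonglongrightarrow> 0" by simp
  have "(\<lambda>n. E (X n - x) (X n - x)) \<longlonglongrightarrow> 0"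
  proof (rule tendsto_sandwich[OF _ _ tendsto_const lim])
    have "0 \<le> E (X n - x) (X n - x)" for n
      using norm_sq_le_E[OF H1_diff[OF X xH], of n] zero_le_power2[of "norm (X n - x)"] by linarith
    then show "\<forall>\<^sub>F n in sequentially. 0 \<le> E (X n - x) (X n - x)" by simp
    show "\<forall>\<^sub>F n in sequentially. E (X n - x) (X n - x) \<le> grad_sq (X n - x) + (2 * C + 1) * (norm (X n - x))\<^sup>2"
      using E_upper[OF H1_diff[OF X xH]] by simp
  qed
  then show "\<exists>x\<in>H1. (\<lambda>n. E (X n - x) (X n - x)) \<longlonglongrightarrow> 0" using xH by blast
qed

text \<open>The domain of the Schroedinger operator, defined through its form.\<close>

definition Dom :: "'a L2 set" where "Dom = {u. \<exists>w. schroedinger_op V u w}"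

lemma Dom_subset: "Dom \<subseteq> H1"
  by (auto simp: Dom_def schroedinger_op_iff)

lemma subspace_Dom: "subspace Dom"
proof (rule subspaceI)
  have "Q \<phi> 0 = 0" if "\<phi> \<in> H1" for \<phi>
    using Q_scaleC[OF H1_0, of 0 \<phi>] Q_commute[of \<phi> 0] by simp
  then have "schroedinger_op V 0 0" by (simp add: schroedinger_op_iff H1_0)
  then show "0 \<in> Dom" by (auto simp: Dom_def)
next
  fix x y assume "x \<in> Dom" "y \<in> Dom"
  then obtain v w where "schroedinger_op V x v" "schroedinger_op V y w" by (auto simp: Dom_def)
  then have "schroedinger_op V (x + y) (v + w)"
    by (auto simp: schroedinger_op_iff H1_add cinner_add_right Q_commute[of _ "x + y"] Q_add Q_commute[of x] Q_commute[of y])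
  then show "x + y \<in> Dom" by (auto simp: Dom_def)
next
  fix r x assume "x \<in> Dom"
  then obtain v where "schroedinger_op V x v" by (auto simp: Dom_def)
  then have "schroedinger_op V (complex_of_real r *\<^sub>C x) (complex_of_real r *\<^sub>C v)"
    by (auto simp: schroedinger_op_iff H1_scaleC cinner_scaleC_right Q_commute[of _ "complex_of_real r *\<^sub>C x"] Q_scaleC Q_commute[of x])
  then show "r *\<^sub>R x \<in> Dom" by (auto simp: Dom_def scaleC_of_real)
qed

text \<open>Lax--Milgram for the shifted operator. The Riesz theorem gives the equation for real parts; testing
  with \<open>\<i> \<phi>\<close> recovers the imaginary parts.\<close>

lemma Dom_solve: "\<exists>u\<in>Dom. \<forall>\<phi>\<in>H1. E \<phi> u = inner \<phi> w"
proof -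
  have "\<exists>u\<in>H1. (\<exists>d. (\<forall>n. d n \<in> H1) \<and> (\<lambda>n. E (d n - u) (d n - u)) \<longlonglongrightarrow> 0) \<and> (\<forall>\<phi>\<in>H1. E \<phi> u = inner \<phi> w)"
  proof (rule Riesz_on_subspace[OF subspace_H1 order_refl, of "\<lambda>\<phi>. inner \<phi> w" "(norm w)\<^sup>2"])
    show "(inner x w)\<^sup>2 \<le> (norm w)\<^sup>2 * E x x" if "x \<in> H1" for x
    proof -
      have "(inner x w)\<^sup>2 \<le> inner x x * inner w w" by (rule Cauchy_Schwarz_ineq)
      also have "\<dots> = (norm w)\<^sup>2 * (norm x)\<^sup>2" by (simp add: power2_norm_eq_inner)
      also have "\<dots> \<le> (norm w)\<^sup>2 * E x x" by (intro mult_left_mono norm_sq_le_E that) simp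
      finally show ?thesis .
    qed
  qed (auto simp: inner_add_left)
  then obtain u where u: "u \<in> H1" "\<And>\<phi>. \<phi> \<in> H1 \<Longrightarrow> E \<phi> u = inner \<phi> w" by blast
  have "Q \<phi> u = \<langle>\<phi>, w - (C + 1) *\<^sub>R u\<rangle>" if \<phi>: "\<phi> \<in> H1" for \<phi>
  proof -
    have re: "Re (Q \<phi> u) = Re \<langle>\<phi>, w - (C + 1) *\<^sub>R u\<rangle>" if "\<phi> \<in> H1" for \<phi>
      using u(2)[OF that] by (simp add: E_def inner_L2_def cinner_diff_right cinner_scaleR_right)
    show ?thesis
      using re[OF \<phi>] re[OF H1_scaleC[OF \<phi>, of \<i>]]
      by (simp add: Q_scaleC[OF \<phi>] cinner_scaleC_left complex_eq_iff)
  qed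
  then have "schroedinger_op V u (w - (C + 1) *\<^sub>R u)" using u(1) by (simp add: schroedinger_op_iff)
  then show ?thesis using u(2) by (auto simp: Dom_def)
qed

text \<open>A vector orthogonal to the domain is in particular orthogonal to the solution of the equation whose
  right-hand side it is.\<close>

lemma Dom_dense:
  assumes "u \<in> H1"
  shows "\<exists>d. (\<forall>n. d n \<in> Dom) \<and> (\<lambda>n. E (d n - u) (d n - u)) \<longlonglongrightarrow> 0"
proof (rule dense_subspace[OF subspace_Dom Dom_subset assms])
  fix y assume y: "y \<in> H1" "\<And>d. d \<in> Dom \<Longrightarrow> E d y = 0"
  obtain d where d: "d \<in> Dom" "\<And>\<phi>. \<phi> \<in> H1 \<Longrightarrow> E \<phi> d = inner \<phi> y" using Dom_solve[of y] by blast
  have "inner y y = E d y" using d(2)[OF y(1)] sym[of y d] y(1) d(1) Dom_subset by auto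
  then have "y = 0" using y(2)[OF d(1)] by simp
  then show "E y y = 0" using scale_left[of y y 0] y(1) by simp
qed

end

section \<open>The group preserves the energy\<close>

lemma unitary_groupD:
  assumes "unitary_group U"
  shows "U t (u + v) = U t u + U t v" "U t (c *\<^sub>C u) = c *\<^sub>C U t u" "\<langle>U t u, U t v\<rangle> = \<langle>u, v\<rangle>"
    "U 0 u = u" "U (s + t) u = U s (U t u)" "continuous_on A (\<lambda>t. U t u)"
  using assms continuous_on_subset[of UNIV "\<lambda>t. U t u" A] unfolding unitary_group_def by blast+

lemma unitary_group_linear:
  assumes U: "unitary_group U"
  shows "U t (r *\<^sub>R u) = r *\<^sub>R U t u" "U t (u - v) = U t u - U t v" "norm (U t u) = norm u"
    "bounded_linear (U t)" "U (- t) (U t u) = u" "U t (U (- t) u) = u"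
    "U t (\<Sum>i\<in>F. f i) = (\<Sum>i\<in>F. U t (f i))"
proof -
  show 1: "U t (r *\<^sub>R u) = r *\<^sub>R U t u" for r u
    using unitary_groupD(2)[OF U, of t "complex_of_real r" u] by (simp add: scaleC_of_real)
  show 3: "norm (U t u) = norm u" for u
    by (simp add: norm_eq_sqrt_inner inner_L2_def unitary_groupD(3)[OF U])
  show bl: "bounded_linear (U t)"
    by (rule bounded_linear_intro[where K = 1]) (simp_all add: 1 3 unitary_groupD(1)[OF U])
  show "U t (u - v) = U t u - U t v" by (rule linear_diff[OF bounded_linear.linear[OF bl]])
  show "U t (\<Sum>i\<in>F. f i) = (\<Sum>i\<in>F. U t (f i))" by (rule linear_sum[OF bounded_linear.linear[OF bl]])
  show "U (- t) (U t u) = u" "U t (U (- t) u) = u"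
    by (simp_all add: unitary_groupD(5)[OF U, symmetric] unitary_groupD(4)[OF U])
qed

text \<open>The group commutes with its own difference quotients, hence with its generator.\<close>

lemma schroedinger_group_op:
  assumes U: "schroedinger_group V U" and op: "schroedinger_op V u w"
  shows "schroedinger_op V (U t u) (U t w)"
proof -
  have un: "unitary_group U" using U by (simp add: schroedinger_group_def)
  have "((\<lambda>s. U s u) has_vector_derivative (- \<i>) *\<^sub>C w) (at 0)"
    using U op by (simp add: schroedinger_group_def)
  then have "((\<lambda>s. U t (U s u)) has_vector_derivative U t ((- \<i>) *\<^sub>C w)) (at 0)"
    by (rule bounded_linear.has_vector_derivative[OF unitary_group_linear(4)[OF un]])
  moreover have "U t (U s u) = U s (U t u)" for s
    by (simp add: unitary_groupD(5)[OF un, symmetric] add.commute)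
  ultimately have "((\<lambda>s. U s (U t u)) has_vector_derivative (- \<i>) *\<^sub>C U t w) (at 0)"
    by (simp add: unitary_groupD(2)[OF un])
  then show ?thesis using U by (simp add: schroedinger_group_def)
qed

context energy_form
begin

lemma E_group_Dom:
  assumes U: "schroedinger_group V U" and u: "u \<in> Dom"
  shows "U t u \<in> Dom" "E (U t u) (U t u) = E u u"
proof -
  have un: "unitary_group U" using U by (simp add: schroedinger_group_def)
  obtain w where w: "schroedinger_op V u w" using u by (auto simp: Dom_def)
  have w': "schroedinger_op V (U t u) (U t w)" by (rule schroedinger_group_op[OF U w])
  then show "U t u \<in> Dom" unfolding Dom_def by blast
  have "Q u u = \<langle>u, w\<rangle>" "Q (U t u) (U t u) = \<langle>U t u, U t w\<rangle>"
    using w w' unfolding schroedinger_op_iff by blast+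
  then show "E (U t u) (U t u) = E u u"
    by (simp add: E_def inner_L2_def unitary_groupD(3)[OF un])
qed

text \<open>Isometry for the energy form extends from the dense domain by completeness: images of an
  approximating sequence form an energy-Cauchy sequence, and its limit can only be \<open>U t u\<close>, because
  energy convergence implies \<open>L2\<close> convergence.\<close>

lemma E_group:
  assumes U: "schroedinger_group V U" and u: "u \<in> H1"
  shows "U t u \<in> H1" "E (U t u) (U t u) = E u u"
proof -
  have un: "unitary_group U" using U by (simp add: schroedinger_group_def)
  obtain d where d: "\<And>n. d n \<in> Dom" and lim: "(\<lambda>n. E (d n - u) (d n - u)) \<longlonglongrightarrow> 0"
    using Dom_dense[OF u] by blast
  have dH: "d n \<in> H1" for n using d Dom_subset by blast
  have UdH: "U t (d n) \<in> H1" for n using E_group_Dom(1)[OF U d] Dom_subset by blast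
  have "\<exists>x\<in>H1. (\<lambda>n. E (U t (d n) - x) (U t (d n) - x)) \<longlonglongrightarrow> 0"
  proof (rule complete[OF UdH])
    fix e :: real assume "e > 0"
    then obtain M where M: "\<And>n. n \<ge> M \<Longrightarrow> E (d n - u) (d n - u) < e / 4"
      using order_tendstoD(2)[OF lim, of "e / 4"] by (auto simp: eventually_sequentially)
    have "E (U t (d m) - U t (d n)) (U t (d m) - U t (d n)) < e" if "m \<ge> M" "n \<ge> M" for m n
    proof -
      have "E (U t (d m) - U t (d n)) (U t (d m) - U t (d n)) = E (d m - d n) (d m - d n)"
        unfolding unitary_group_linear(2)[OF un, symmetric]
        by (intro E_group_Dom(2)[OF U] subspace_diff[OF subspace_Dom] d)
      also have "\<dots> \<le> 2 * E (d m - u) (d m - u) + 2 * E (d n - u) (d n - u)"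
      proof -
        have "E (x - y) (x - y) + E (x + y) (x + y) = 2 * E x x + 2 * E y y" if "x \<in> H1" "y \<in> H1" for x y
          using that by (simp add: bilinear)
        from this[of "d m - u" "d n - u"] show ?thesis
          using nonneg[of "(d m - u) + (d n - u)"] dH u by (simp add: closed_ops)
      qed
      also have "\<dots> < e" using M[OF that(1)] M[OF that(2)] by linarith
      finally show ?thesis .
    qed
    then show "\<exists>M. \<forall>m\<ge>M. \<forall>n\<ge>M. E (U t (d m) - U t (d n)) (U t (d m) - U t (d n)) < e" by blast
  qed
  then obtain x where x: "x \<in> H1" and xlim: "(\<lambda>n. E (U t (d n) - x) (U t (d n) - x)) \<longlonglongrightarrow> 0" by blast
  have L2_lim: "X \<longlonglongrightarrow> y" if "\<And>n. X n \<in> H1" "y \<in> H1" "(\<lambda>n. E (X n - y) (X n - y)) \<longlonglongrightarrow> 0" for X y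
  proof -
    have "(\<lambda>n. (norm (X n - y))\<^sup>2) \<longlonglongrightarrow> 0"
    proof (rule tendsto_sandwich[OF _ _ tendsto_const that(3)])
      show "\<forall>\<^sub>F n in sequentially. (norm (X n - y))\<^sup>2 \<le> E (X n - y) (X n - y)"
        by (intro always_eventually allI norm_sq_le_E H1_diff that(1,2))
    qed simp
    then have "(\<lambda>n. sqrt ((norm (X n - y))\<^sup>2)) \<longlonglongrightarrow> sqrt 0" by (rule tendsto_real_sqrt)
    then have "(\<lambda>n. norm (X n - y)) \<longlonglongrightarrow> 0" by simp
    then show ?thesis by (simp add: tendsto_norm_zero_iff LIM_zero_iff)
  qed
  have "(\<lambda>n. U t (d n)) \<longlonglongrightarrow> x" by (rule L2_lim[OF UdH x xlim])
  moreover have "(\<lambda>n. U t (d n)) \<longlonglongrightarrow> U t u"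
    by (rule bounded_linear.tendsto[OF unitary_group_linear(4)[OF un] L2_lim[OF dH u lim]])
  ultimately have x_eq: "x = U t u" by (rule LIMSEQ_unique)
  then show "U t u \<in> H1" using x by simp
  have "(\<lambda>n. E (U t (d n)) (U t (d n))) \<longlonglongrightarrow> E x x" by (rule tendsto_diagonal[OF UdH x xlim])
  moreover have "(\<lambda>n. E (U t (d n)) (U t (d n))) \<longlonglongrightarrow> E u u"
    unfolding E_group_Dom(2)[OF U d] by (rule tendsto_diagonal[OF dH u lim])
  ultimately show "E (U t u) (U t u) = E u u" using LIMSEQ_unique x_eq by blast
qed

end

lemma schroedinger_group_H1_bounded:
  fixes V :: "'a::euclidean_space \<Rightarrow> real"
  assumes "p > max 1 (real DIM('a) / 2)" "Lp_plus_Linfty p V" and U: "schroedinger_group V U"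
    and u: "u \<in> H1"
  shows "U t u \<in> H1" "\<exists>M. \<forall>t. \<forall>b\<in>Basis. norm (weak_deriv (U t u) b) \<le> M"
proof -
  obtain C where "form_bounded V (1/4) C"
    using Lp_plus_Linfty_form_bounded[OF assms(1,2), of "1/4"] by auto
  then interpret energy_form V C by unfold_locales
  show "U t u \<in> H1" by (rule E_group(1)[OF U u])
  have "norm (weak_deriv (U t u) b) \<le> sqrt (4 * E u u)" if "b \<in> Basis" for t b
    using weak_deriv_sq_le_E[OF E_group(1)[OF U u] that, of t] E_group(2)[OF U u]
    by (intro real_le_rsqrt) simp
  then show "\<exists>M. \<forall>t. \<forall>b\<in>Basis. norm (weak_deriv (U t u) b) \<le> M" by blast
qed

section \<open>Differential inequalities\<close>

lemma nonincreasing_if_deriv_nonpos: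
  fixes f :: "real \<Rightarrow> real"
  assumes der: "\<And>t. t \<ge> 0 \<Longrightarrow> (f has_real_derivative f' t) (at t within {0..})"
    and neg: "\<And>t. 0 \<le> t \<Longrightarrow> t \<le> b \<Longrightarrow> f' t \<le> 0" and ab: "0 \<le> a" "a \<le> b"
  shows "f b \<le> f a"
proof (rule DERIV_nonpos_imp_decreasing_open[OF ab(2)])
  fix x assume x: "a < x" "x < b"
  have "at x within {0..} = at x"
    by (rule at_within_open_subset[of x "{0<..}"]) (use x ab in auto)
  then show "\<exists>y. DERIV f x :> y \<and> y \<le> 0" using der[of x] neg[of x] x ab by auto
next
  have "continuous_on {0..} f"
    unfolding continuous_on_eq_continuous_within using der has_field_derivative_imp_has_derivative
    by (auto intro: DERIV_continuous)
  then show "continuous_on {a..b} f" by (rule continuous_on_subset) (use ab in auto)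
qed

lemma Gronwall_nonpos:
  fixes f :: "real \<Rightarrow> real"
  assumes der: "\<And>t. t \<ge> 0 \<Longrightarrow> (f has_real_derivative f' t) (at t within {0..})"
    and le: "\<And>t. 0 \<le> t \<Longrightarrow> t \<le> T \<Longrightarrow> f' t \<le> A * f t" and f0: "f 0 \<le> 0" and T: "0 \<le> T"
  shows "f T \<le> 0"
proof -
  have "exp (- A * T) * f T \<le> exp (- A * 0) * f 0"
  proof (rule nonincreasing_if_deriv_nonpos[where f = "\<lambda>t. exp (- A * t) * f t" and
        f' = "\<lambda>t. exp (- A * t) * (f' t - A * f t)"])
    show "((\<lambda>t. exp (- A * t) * f t) has_real_derivative exp (- A * t) * (f' t - A * f t)) (at t within {0..})"
      if "t \<ge> 0" for t
      by (rule DERIV_cong[OF DERIV_mult[OF _ der[OF that]], of _ "- A * exp (- A * t)"])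
         (auto intro!: derivative_eq_intros simp: algebra_simps)
    show "exp (- A * t) * (f' t - A * f t) \<le> 0" if "0 \<le> t" "t \<le> T" for t
      using le[OF that] by (intro mult_nonneg_nonpos) auto
  qed (use T in auto)
  then have "exp (- A * T) * f T \<le> 0" using f0 by simp
  then show ?thesis by (simp add: mult_le_0_iff)
qed

lemma has_real_derivative_inner_self:
  fixes w :: "real \<Rightarrow> 'b::real_inner"
  assumes "(w has_vector_derivative w') (at t within S)"
  shows "((\<lambda>t. inner (w t) (w t)) has_real_derivative 2 * inner (w t) w') (at t within S)"
  using bounded_bilinear.has_vector_derivative[OF bounded_bilinear_inner assms assms]
  by (simp add: has_real_derivative_iff_has_vector_derivative inner_commute[of w'])

text \<open>Gronwall's inequality for the squared norm.\<close>

lemma ode_unique_zero: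
  fixes w :: "real \<Rightarrow> 'b::real_inner"
  assumes der: "\<And>t. t \<ge> 0 \<Longrightarrow> (w has_vector_derivative w' t) (at t within {0..})"
    and le: "\<And>t. 0 \<le> t \<Longrightarrow> t \<le> T \<Longrightarrow> inner (w t) (w' t) \<le> A * inner (w t) (w t)"
    and "w 0 = 0" and "0 \<le> T"
  shows "w T = 0"
proof -
  have "inner (w T) (w T) \<le> 0"
  proof (rule Gronwall_nonpos[where f = "\<lambda>t. inner (w t) (w t)" and A = "2 * A"])
    show "2 * inner (w t) (w' t) \<le> 2 * A * inner (w t) (w t)" if "0 \<le> t" "t \<le> T" for t
      using le[OF that] by simp
  qed (use assms in \<open>auto intro: has_real_derivative_inner_self\<close>)
  then have "inner (w T) (w T) = 0" using inner_ge_zero[of "w T"] by linarith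
  then show ?thesis by simp
qed

lemma complex_linear_ode_unique_zero:
  fixes w \<alpha> :: "real \<Rightarrow> complex"
  assumes der: "\<And>t. t \<ge> 0 \<Longrightarrow> (w has_vector_derivative \<alpha> t * w t) (at t within {0..})"
    and le: "\<And>t. t \<ge> 0 \<Longrightarrow> norm (\<alpha> t) \<le> A" and "w 0 = 0" and "0 \<le> T"
  shows "w T = 0"
proof (rule ode_unique_zero[OF der _ assms(3,4)])
  fix t :: real assume t: "0 \<le> t"
  have "inner (w t) (\<alpha> t * w t) \<le> norm (w t) * norm (\<alpha> t * w t)" by (rule norm_cauchy_schwarz)
  also have "\<dots> = norm (\<alpha> t) * (norm (w t))\<^sup>2" by (simp add: norm_mult power2_eq_square)
  also have "\<dots> \<le> A * (norm (w t))\<^sup>2" using le[OF t] by (intro mult_right_mono) auto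
  finally show "inner (w t) (\<alpha> t * w t) \<le> A * inner (w t) (w t)" by (simp add: power2_norm_eq_inner)
qed

text \<open>Barbalat's lemma: a value \<open>D t \<ge> e\<close> would persist at the level \<open>e / 2\<close> for a time
  \<open>e / (2 L)\<close>, and late increments of a bounded monotone function are too small for that.\<close>

lemma Barbalat:
  fixes f D :: "real \<Rightarrow> real"
  assumes der: "\<And>t. t \<ge> 0 \<Longrightarrow> (f has_real_derivative D t) (at t within {0..})"
    and D: "\<And>t. t \<ge> 0 \<Longrightarrow> 0 \<le> D t" and f: "\<And>t. t \<ge> 0 \<Longrightarrow> f t \<le> M"
    and Lip: "\<And>s t. s \<ge> 0 \<Longrightarrow> t \<ge> 0 \<Longrightarrow> \<bar>D s - D t\<bar> \<le> L * \<bar>s - t\<bar>" and L: "L > 0"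
  shows "(D \<longlongrightarrow> 0) at_top"
proof (rule tendstoI)
  fix e :: real assume e: "e > 0"
  have mono: "f a \<le> f b" if "0 \<le> a" "a \<le> b" for a b
  proof -
    have "- f b \<le> - f a"
      using that D by (intro nonincreasing_if_deriv_nonpos[where f = "\<lambda>t. - f t" and f' = "\<lambda>t. - D t"])
        (auto intro: DERIV_minus der)
    then show ?thesis by simp
  qed
  let ?\<delta> = "e / (2 * L)"
  have gain: "f t + ?\<delta> * (e / 2) \<le> f (t + ?\<delta>)" if t: "t \<ge> 0" and De: "D t \<ge> e" for t
  proof -
    have shift: "((\<lambda>s. (e / 2) * s - f (t + s)) has_real_derivative e / 2 - D (t + s)) (at s within {0..})" if s: "s \<ge> 0" for s
    proof -
      have "(f has_real_derivative D (t + s)) (at (t + s) within (\<lambda>s. t + s) ` {0..})"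
        by (rule DERIV_subset[OF der]) (use t s in auto)
      moreover have "((\<lambda>s. t + s) has_real_derivative 1) (at s within {0..})"
        by (auto intro!: derivative_eq_intros)
      ultimately have "((\<lambda>s. f (t + s)) has_real_derivative D (t + s) * 1) (at s within {0..})"
        using DERIV_image_chain[of f "D (t + s)" "\<lambda>s. t + s" s "{0..}" 1] by (simp add: o_def)
      then show ?thesis by (auto intro!: derivative_eq_intros)
    qed
    have "(e / 2) * ?\<delta> - f (t + ?\<delta>) \<le> (e / 2) * 0 - f (t + 0)"
    proof (rule nonincreasing_if_deriv_nonpos[OF shift])
      fix s assume s: "0 \<le> s" "s \<le> ?\<delta>"
      have "D t - D (t + s) \<le> L * s" using Lip[of t "t + s"] t s by simp
      also have "\<dots> \<le> L * ?\<delta>" using s L by (intro mult_left_mono) auto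
      also have "\<dots> = e / 2" using L by simp
      finally show "e / 2 - D (t + s) \<le> 0" using De by simp
    qed (use e L in auto)
    then show ?thesis by (simp add: mult.commute)
  qed
  have bdd: "bdd_above (f ` {0..})" using f by (auto intro!: bdd_aboveI2)
  have pos: "?\<delta> * (e / 2) > 0" using e L by simp
  then have "\<exists>x\<in>f ` {0..}. Sup (f ` {0..}) - ?\<delta> * (e / 2) < x"
    using bdd by (intro less_cSupD) auto
  then obtain t1 where t1: "t1 \<ge> 0" "Sup (f ` {0..}) - ?\<delta> * (e / 2) < f t1" by auto
  have "D t < e" if "t \<ge> t1" for t
  proof (rule ccontr)
    assume "\<not> D t < e"
    then have "f t + ?\<delta> * (e / 2) \<le> f (t + ?\<delta>)" using gain that t1 by auto
    also have "\<dots> \<le> Sup (f ` {0..})" using that t1 e L bdd by (intro cSup_upper) auto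
    finally show False using mono[of t1 t] that t1 by linarith
  qed
  then show "\<forall>\<^sub>F t in at_top. dist (D t) 0 < e"
    unfolding eventually_at_top_linorder using D t1(1) by (intro exI[of _ t1]) auto
qed

section \<open>The Lohe system in the interaction picture\<close>

lemma lohe_term_scaled:
  "(- \<i>) *\<^sub>C lohe_term N K \<Omega> \<psi> j = (- \<i> * complex_of_real (\<Omega> j)) *\<^sub>C \<psi> j
     + (K / (2 * real N)) *\<^sub>R (\<Sum>l=1..N. \<psi> l - \<langle>\<psi> l, \<psi> j\<rangle> *\<^sub>C \<psi> j)"
  by (simp add: lohe_term_def scaleC_add_right scaleC_scaleC scaleC_of_real[symmetric])

text \<open>The system in the interaction picture: an ordinary differential equation in \<open>L2\<close>, in which the
  unbounded Schroedinger operator no longer appears.\<close>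

locale lohe_flow =
  fixes N :: nat and K :: real and \<Omega> :: "nat \<Rightarrow> real" and \<phi> :: "nat \<Rightarrow> real \<Rightarrow> 'a::euclidean_space L2"
  assumes K: "K > 0" and N: "N \<ge> 1"
    and flow: "\<And>j t. j \<in> {1..N} \<Longrightarrow> t \<ge> 0 \<Longrightarrow>
      (\<phi> j has_vector_derivative (- \<i>) *\<^sub>C lohe_term N K \<Omega> (\<lambda>l. \<phi> l t) j) (at t within {0..})"
    and unit_init: "\<And>j. j \<in> {1..N} \<Longrightarrow> norm (\<phi> j 0) = 1"
begin

definition \<kappa> :: real where "\<kappa> = K / (2 * real N)"

lemma \<kappa>_pos: "\<kappa> > 0" and \<kappa>_N: "\<kappa> * real N = K / 2"
  using K N by (auto simp: \<kappa>_def)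

definition velocity :: "nat \<Rightarrow> real \<Rightarrow> 'a L2" where
  "velocity j t = (- \<i> * complex_of_real (\<Omega> j)) *\<^sub>C \<phi> j t
     + \<kappa> *\<^sub>R (\<Sum>l=1..N. \<phi> l t - \<langle>\<phi> l t, \<phi> j t\<rangle> *\<^sub>C \<phi> j t)"

lemma has_velocity: "j \<in> {1..N} \<Longrightarrow> t \<ge> 0 \<Longrightarrow> (\<phi> j has_vector_derivative velocity j t) (at t within {0..})"
  using flow[of j t] by (simp only: velocity_def \<kappa>_def lohe_term_scaled)

lemma cinner_velocity:
  "\<langle>w, velocity j t\<rangle> = - \<i> * complex_of_real (\<Omega> j) * \<langle>w, \<phi> j t\<rangle>
     + complex_of_real \<kappa> * (\<Sum>l=1..N. \<langle>w, \<phi> l t\<rangle> - \<langle>\<phi> l t, \<phi> j t\<rangle> * \<langle>w, \<phi> j t\<rangle>)"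
  by (simp add: velocity_def cinner_add_right cinner_scaleC_right cinner_scaleR_right cinner_sum_right cinner_diff_right)

lemma continuous_\<phi>: "j \<in> {1..N} \<Longrightarrow> continuous_on {0..} (\<phi> j)"
  by (rule continuous_on_vector_derivative[where f' = "velocity j"]) (use has_velocity in auto)

lemma has_derivative_cinner:
  assumes "j \<in> {1..N}" "t \<ge> 0"
  shows "((\<lambda>t. \<langle>w, \<phi> j t\<rangle>) has_vector_derivative \<langle>w, velocity j t\<rangle>) (at t within {0..})"
  using bounded_linear.has_vector_derivative[OF bounded_bilinear.bounded_linear_right[OF bounded_bilinear_cinner] has_velocity[OF assms]] .

text \<open>\<open>1 - |\<phi> j|^2\<close> solves a homogeneous linear equation, so it stays zero.\<close>

lemma norm_\<phi>:
  assumes j: "j \<in> {1..N}" and T: "T \<ge> 0"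
  shows "norm (\<phi> j T) = 1"
proof -
  define a where "a = (\<lambda>t. 2 * \<kappa> * (\<Sum>l=1..N. Re \<langle>\<phi> l t, \<phi> j t\<rangle>))"
  have vel: "2 * inner (\<phi> j t) (velocity j t) = a t * (1 - inner (\<phi> j t) (\<phi> j t))" for t
  proof -
    have "Re \<langle>\<phi> l t, \<phi> j t\<rangle> = Re \<langle>\<phi> j t, \<phi> l t\<rangle>" for l
      using cinner_commute[of "\<phi> l t" "\<phi> j t"] by simp
    then show ?thesis
      unfolding inner_L2_def cinner_velocity a_def
      by (simp add: cinner_self sum_subtractf sum_distrib_left sum_distrib_right algebra_simps flip: of_real_power)
  qed
  have "continuous_on {0..T} a"
    unfolding a_def
  proof (intro continuous_intros)
    fix l assume "l \<in> {1..N}"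
    then show "continuous_on {0..T} (\<lambda>t. \<langle>\<phi> l t, \<phi> j t\<rangle>)"
      using j by (intro bounded_bilinear.continuous_on[OF bounded_bilinear_cinner] continuous_on_subset[OF continuous_\<phi>]) auto
  qed
  then have "bounded (a ` {0..T})" by (intro compact_imp_bounded compact_continuous_image) auto
  then obtain A where "\<forall>x\<in>a ` {0..T}. norm x \<le> A" unfolding bounded_iff by blast
  then have A: "\<bar>a t\<bar> \<le> A" if "0 \<le> t" "t \<le> T" for t using that by auto
  have "1 - inner (\<phi> j T) (\<phi> j T) = 0"
  proof (rule ode_unique_zero[where w = "\<lambda>t. 1 - inner (\<phi> j t) (\<phi> j t)" and A = A and
        w' = "\<lambda>t. - (a t * (1 - inner (\<phi> j t) (\<phi> j t)))"])
    show "((\<lambda>t. 1 - inner (\<phi> j t) (\<phi> j t)) has_vector_derivative - (a t * (1 - inner (\<phi> j t) (\<phi> j t)))) (at t within {0..})"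
      if "t \<ge> 0" for t
      using DERIV_diff[OF DERIV_const[of 1] has_real_derivative_inner_self[OF has_velocity[OF j that]]]
      unfolding vel by (simp add: has_real_derivative_iff_has_vector_derivative)
    show "inner (1 - inner (\<phi> j t) (\<phi> j t)) (- (a t * (1 - inner (\<phi> j t) (\<phi> j t))))
        \<le> A * inner (1 - inner (\<phi> j t) (\<phi> j t)) (1 - inner (\<phi> j t) (\<phi> j t))" if "0 \<le> t" "t \<le> T" for t
    proof -
      have "- a t * (1 - inner (\<phi> j t) (\<phi> j t))\<^sup>2 \<le> A * (1 - inner (\<phi> j t) (\<phi> j t))\<^sup>2"
        using A[OF that] by (intro mult_right_mono) auto
      then show ?thesis by (simp add: power2_eq_square mult_ac)
    qed
    show "1 - inner (\<phi> j 0) (\<phi> j 0) = 0" using unit_init[OF j] by (simp add: power2_norm_eq_inner[symmetric])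
  qed (rule T)
  then have "(norm (\<phi> j T))\<^sup>2 = 1" by (simp add: power2_norm_eq_inner)
  then show ?thesis by (simp add: power2_eq_1_iff) (use norm_ge_zero[of "\<phi> j T"] in linarith)
qed

lemma cmod_cinner_le_1: "j \<in> {1..N} \<Longrightarrow> k \<in> {1..N} \<Longrightarrow> t \<ge> 0 \<Longrightarrow> cmod \<langle>\<phi> j t, \<phi> k t\<rangle> \<le> 1"
  using cinner_Cauchy_Schwarz[of "\<phi> j t" "\<phi> k t"] by (simp add: norm_\<phi>)

text \<open>The equation is linear in the states with scalar coefficients; hence the orthogonal complement
  of the initial states is never entered.\<close>

lemma orthogonal_to_flow:
  assumes w: "\<And>l. l \<in> {1..N} \<Longrightarrow> \<langle>w, \<phi> l 0\<rangle> = 0" and j: "j \<in> {1..N}" and T: "T \<ge> 0"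
  shows "\<langle>w, \<phi> j T\<rangle> = 0"
proof -
  define y where "y = (\<lambda>j t. \<langle>w, \<phi> j t\<rangle>)"
  define f where "f = (\<lambda>t. \<Sum>j=1..N. inner (y j t) (y j t))"
  have "f T \<le> 0"
  proof (rule Gronwall_nonpos[where f = f and T = T and A = "2 * K" and f' = "\<lambda>t. \<Sum>j=1..N. 2 * inner (y j t) \<langle>w, velocity j t\<rangle>"])
    show "(f has_real_derivative (\<Sum>j=1..N. 2 * inner (y j t) \<langle>w, velocity j t\<rangle>)) (at t within {0..})" if "t \<ge> 0" for t
      unfolding f_def y_def
      by (intro DERIV_sum has_real_derivative_inner_self has_derivative_cinner that)
    show "(\<Sum>j=1..N. 2 * inner (y j t) \<langle>w, velocity j t\<rangle>) \<le> 2 * K * f t" if t: "0 \<le> t" for t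
    proof -
      have single: "2 * inner (y j t) \<langle>w, velocity j t\<rangle>
          \<le> (\<Sum>l=1..N. \<kappa> * (3 * (norm (y j t))\<^sup>2 + (norm (y l t))\<^sup>2))" if j: "j \<in> {1..N}" for j
      proof -
        have rot: "inner (y j t) (- \<i> * complex_of_real (\<Omega> j) * y j t) = 0"
          by (simp add: inner_complex_def algebra_simps)
        have pair: "2 * inner (y j t) (y l t - \<langle>\<phi> l t, \<phi> j t\<rangle> * y j t) \<le> 3 * (norm (y j t))\<^sup>2 + (norm (y l t))\<^sup>2"
          if l: "l \<in> {1..N}" for l
        proof -
          have "inner (y j t) (y l t) \<le> norm (y j t) * norm (y l t)" by (rule norm_cauchy_schwarz)
          moreover have "2 * (norm (y j t) * norm (y l t)) \<le> (norm (y j t))\<^sup>2 + (norm (y l t))\<^sup>2"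
            using sum_squares_bound[of "norm (y j t)" "norm (y l t)"] by simp
          moreover have "- inner (y j t) (\<langle>\<phi> l t, \<phi> j t\<rangle> * y j t) \<le> norm (y j t) * norm (\<langle>\<phi> l t, \<phi> j t\<rangle> * y j t)"
            using Cauchy_Schwarz_ineq2[of "y j t" "\<langle>\<phi> l t, \<phi> j t\<rangle> * y j t"] by linarith
          moreover have "norm (y j t) * norm (\<langle>\<phi> l t, \<phi> j t\<rangle> * y j t) \<le> 1 * (norm (y j t))\<^sup>2"
            using mult_right_mono[OF cmod_cinner_le_1[OF l j t], of "(norm (y j t))\<^sup>2"]
            by (simp add: norm_mult power2_eq_square mult_ac)
          ultimately show ?thesis by (simp add: inner_diff_right)
        qed
        have "2 * inner (y j t) \<langle>w, velocity j t\<rangle>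
            = \<kappa> * (\<Sum>l=1..N. 2 * inner (y j t) (y l t - \<langle>\<phi> l t, \<phi> j t\<rangle> * y j t))"
          unfolding cinner_velocity y_def[symmetric] inner_add_right
          using rot by (simp add: y_def scaleR_conv_of_real[symmetric] inner_sum_right sum_distrib_left mult_ac)
        also have "\<dots> \<le> \<kappa> * (\<Sum>l=1..N. 3 * (norm (y j t))\<^sup>2 + (norm (y l t))\<^sup>2)"
          using \<kappa>_pos by (intro mult_left_mono sum_mono pair) auto
        finally show ?thesis by (simp add: sum_distrib_left)
      qed
      have "(\<Sum>j=1..N. 2 * inner (y j t) \<langle>w, velocity j t\<rangle>)
          \<le> (\<Sum>j=1..N. \<Sum>l=1..N. \<kappa> * (3 * (norm (y j t))\<^sup>2 + (norm (y l t))\<^sup>2))"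
        by (intro sum_mono single)
      also have "\<dots> = 4 * (\<kappa> * real N) * (\<Sum>j=1..N. (norm (y j t))\<^sup>2)"
        by (simp add: distrib_left sum.distrib sum_distrib_left sum_distrib_right mult_ac)
           (simp add: sum.distrib[symmetric] algebra_simps)
      also have "\<dots> = 2 * K * f t" by (simp add: \<kappa>_N f_def power2_norm_eq_inner)
      finally show ?thesis .
    qed
    show "f 0 \<le> 0" using w by (simp add: f_def y_def)
  qed (rule T)
  then have "f T = 0" unfolding f_def by (intro antisym sum_nonneg) auto
  then have "inner (y j T) (y j T) = 0"
    using j unfolding f_def by (subst (asm) sum_nonneg_eq_0_iff) auto
  then show ?thesis by (simp add: y_def)
qed

lemma has_derivative_overlap:
  assumes "j \<in> {1..N}" "k \<in> {1..N}" "t \<ge> 0"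
  shows "((\<lambda>t. \<langle>\<phi> j t, \<phi> k t\<rangle>) has_vector_derivative (\<langle>\<phi> j t, velocity k t\<rangle> + \<langle>velocity j t, \<phi> k t\<rangle>)) (at t within {0..})"
  using bounded_bilinear.has_vector_derivative[OF bounded_bilinear_cinner has_velocity[OF assms(1,3)] has_velocity[OF assms(2,3)]] .

subsection \<open>Two detuned states\<close>

lemma overlap_Riccati:
  assumes N2: "N = 2" and \<Omega>: "\<Omega> 1 = \<omega>" "\<Omega> 2 = - \<omega>" and t: "t \<ge> 0"
  shows "((\<lambda>t. \<langle>\<phi> 1 t, \<phi> 2 t\<rangle>) has_vector_derivative
    2 * \<i> * complex_of_real \<omega> * \<langle>\<phi> 1 t, \<phi> 2 t\<rangle> + complex_of_real (K / 2) * (1 - \<langle>\<phi> 1 t, \<phi> 2 t\<rangle>\<^sup>2)) (at t within {0..})"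
proof -
  let ?z = "\<langle>\<phi> 1 t, \<phi> 2 t\<rangle>"
  have in12: "1 \<in> {1..N}" "2 \<in> {1..N}" using N2 by auto
  have self: "\<langle>\<phi> 1 t, \<phi> 1 t\<rangle> = 1" "\<langle>\<phi> 2 t, \<phi> 2 t\<rangle> = 1"
    using norm_\<phi>[OF in12(1) t] norm_\<phi>[OF in12(2) t] by (simp_all add: cinner_self)
  have z: "\<langle>\<phi> 2 t, \<phi> 1 t\<rangle> = cnj ?z" by (rule cinner_commute)
  have sum2: "(\<Sum>l=1..N. g l) = g 1 + g 2" for g :: "nat \<Rightarrow> complex"
    unfolding N2 by (simp add: numeral_2_eq_2)
  have \<kappa>: "\<kappa> = K / 4" unfolding \<kappa>_def by (simp add: N2)
  have "\<langle>\<phi> 1 t, velocity 2 t\<rangle> = \<i> * complex_of_real \<omega> * ?z + complex_of_real (K / 4) * (1 - ?z\<^sup>2)"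
    unfolding cinner_velocity sum2 \<kappa> \<Omega> self z by (simp add: self power2_eq_square algebra_simps)
  moreover have "\<langle>velocity 1 t, \<phi> 2 t\<rangle> = \<i> * complex_of_real \<omega> * ?z + complex_of_real (K / 4) * (1 - ?z\<^sup>2)"
  proof -
    have "\<langle>\<phi> 2 t, velocity 1 t\<rangle> = - \<i> * complex_of_real \<omega> * cnj ?z + complex_of_real (K / 4) * (1 - (cnj ?z)\<^sup>2)"
      unfolding cinner_velocity sum2 \<kappa> \<Omega> self z by (simp add: self z power2_eq_square algebra_simps)
    then show ?thesis by (subst cinner_commute) simp
  qed
  moreover have "(\<i> * complex_of_real \<omega> * ?z + complex_of_real (K / 4) * (1 - ?z\<^sup>2))
      + (\<i> * complex_of_real \<omega> * ?z + complex_of_real (K / 4) * (1 - ?z\<^sup>2))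
      = 2 * \<i> * complex_of_real \<omega> * ?z + complex_of_real (K / 2) * (1 - ?z\<^sup>2)"
    by (simp add: field_simps)
  ultimately show ?thesis using has_derivative_overlap[OF in12 t] by (simp only:)
qed

text \<open>The Riccati equation for the overlap factorises as \<open>z' = - (K/2) u v\<close>, where \<open>u = z - p\<close> and
  \<open>v = z - m\<close> are the differences to the two fixed points \<open>p\<close> and \<open>m\<close>, and \<open>p - m = 2 s\<close>. Then \<open>u\<close> and
  \<open>exp (- K s t) v\<close> solve the same linear equation \<open>w' = - (K/2) v w\<close>, so they stay proportional.
  Since \<open>v\<close> is bounded, \<open>u\<close> decays exponentially unless \<open>v\<close> vanishes initially.\<close>

lemma overlap_limit_subcritical:
  assumes N2: "N = 2" and \<Omega>: "\<Omega> 1 = \<omega>" "\<Omega> 2 = - \<omega>" and \<Lambda>: "\<Lambda> = 2 * \<omega> / K" "0 \<le> \<Lambda>" "\<Lambda> < 1"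
    and init: "\<langle>\<phi> 1 0, \<phi> 2 0\<rangle> \<noteq> - complex_of_real (sqrt (1 - \<Lambda>\<^sup>2)) + \<i> * complex_of_real \<Lambda>"
  shows "((\<lambda>t. cmod \<langle>\<phi> 1 t, \<phi> 2 t\<rangle>) \<longlongrightarrow> 1) at_top"
proof -
  define s where "s = sqrt (1 - \<Lambda>\<^sup>2)"
  have \<Lambda>1: "\<Lambda>\<^sup>2 < 1" using \<Lambda>(2,3) by (simp add: power_less_one_iff)
  then have s: "s > 0" and s2: "s\<^sup>2 = 1 - \<Lambda>\<^sup>2" by (auto simp: s_def)
  define z where "z = (\<lambda>t. \<langle>\<phi> 1 t, \<phi> 2 t\<rangle>)"
  define p where "p = complex_of_real s + \<i> * complex_of_real \<Lambda>"
  define m where "m = - complex_of_real s + \<i> * complex_of_real \<Lambda>"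
  have norm_pm: "cmod p = 1" "cmod m = 1"
    using s2 by (simp_all add: p_def m_def cmod_def)
  define u where "u = (\<lambda>t. z t - p)"
  define v where "v = (\<lambda>t. z t - m)"
  define \<alpha> where "\<alpha> = (\<lambda>t. - complex_of_real (K / 2) * v t)"
  have vu: "v t = u t + 2 * complex_of_real s" for t by (simp add: u_def v_def p_def m_def)
  have z1: "cmod (z t) \<le> 1" if "t \<ge> 0" for t unfolding z_def by (rule cmod_cinner_le_1) (use N2 that in auto)
  have vb: "cmod (v t) \<le> 2" if "t \<ge> 0" for t
    using norm_triangle_ineq4[of "z t" m] z1[OF that] norm_pm by (simp add: v_def)
  have s2c: "complex_of_real s * complex_of_real s = 1 - complex_of_real \<Lambda> * complex_of_real \<Lambda>"
    using s2 by (metis of_real_1 of_real_diff of_real_mult power2_eq_square)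
  have dz: "(z has_vector_derivative \<alpha> t * u t) (at t within {0..})" if "t \<ge> 0" for t
  proof -
    have h: "\<omega> = K * \<Lambda> / 2" using \<Lambda>(1) K by simp
    have "complex_of_real \<omega> = complex_of_real K * complex_of_real \<Lambda> / 2" by (subst h) simp
    then have "2 * \<i> * complex_of_real \<omega> * z t + complex_of_real (K / 2) * (1 - (z t)\<^sup>2)
        = complex_of_real (K / 2) * (1 + 2 * \<i> * complex_of_real \<Lambda> * z t - (z t)\<^sup>2)"
      by (simp add: algebra_simps)
    also have "1 + 2 * \<i> * complex_of_real \<Lambda> * z t - (z t)\<^sup>2 = - (v t * u t)"
      using s2c by (simp add: u_def v_def p_def m_def power2_eq_square algebra_simps)
    finally have eq: "2 * \<i> * complex_of_real \<omega> * z t + complex_of_real (K / 2) * (1 - (z t)\<^sup>2) = \<alpha> t * u t"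
      by (simp add: \<alpha>_def)
    show ?thesis
      using overlap_Riccati[OF N2 \<Omega> that] unfolding z_def[symmetric] using eq by (simp add: z_def)
  qed
  have du: "(u has_vector_derivative \<alpha> t * u t) (at t within {0..})" if "t \<ge> 0" for t
    unfolding u_def[abs_def] using has_vector_derivative_diff[OF dz[OF that] has_vector_derivative_const[of p]]
    by (simp add: u_def)
  have dv: "(v has_vector_derivative \<alpha> t * u t) (at t within {0..})" if "t \<ge> 0" for t
    unfolding v_def[abs_def] using has_vector_derivative_diff[OF dz[OF that] has_vector_derivative_const[of m]]
    by simp
  \<comment> \<open>The exponential factor compensates \<open>v = u + 2 s\<close>, so that \<open>y\<close> satisfies the linear equation of \<open>u\<close>.\<close>
  define y where "y = (\<lambda>t. exp (- K * s * t) *\<^sub>R v t)"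
  have dy: "(y has_vector_derivative \<alpha> t * y t) (at t within {0..})" if "t \<ge> 0" for t
  proof -
    have "((\<lambda>t. exp (- K * s * t)) has_real_derivative (- K * s) * exp (- K * s * t)) (at t within {0..})"
      by (auto intro!: derivative_eq_intros)
    from has_vector_derivative_scaleR[OF this dv[OF that]]
    have "(y has_vector_derivative exp (- K * s * t) *\<^sub>R (\<alpha> t * u t) + ((- K * s) * exp (- K * s * t)) *\<^sub>R v t) (at t within {0..})"
      unfolding y_def .
    moreover have "exp (- K * s * t) *\<^sub>R (\<alpha> t * u t) + ((- K * s) * exp (- K * s * t)) *\<^sub>R v t = \<alpha> t * y t"
      unfolding y_def \<alpha>_def vu by (simp add: scaleR_conv_of_real field_simps)
    ultimately show ?thesis by simp
  qed
  have u_eq: "v 0 * u t = u 0 * y t" if t: "t \<ge> 0" for t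
  proof -
    have "v 0 * u t - u 0 * y t = 0"
    proof (rule complex_linear_ode_unique_zero[where w = "\<lambda>t. v 0 * u t - u 0 * y t" and \<alpha> = \<alpha> and A = K])
      show "((\<lambda>t. v 0 * u t - u 0 * y t) has_vector_derivative \<alpha> t * (v 0 * u t - u 0 * y t)) (at t within {0..})"
        if "t \<ge> 0" for t
        using has_vector_derivative_diff[OF has_vector_derivative_mult_right[OF du[OF that], of "v 0"]
            has_vector_derivative_mult_right[OF dy[OF that], of "u 0"]]
        by (simp add: algebra_simps)
      show "cmod (\<alpha> t) \<le> K" if "t \<ge> 0" for t
        using vb[OF that] K by (simp add: \<alpha>_def norm_mult)
    qed (auto simp: y_def t)
    then show ?thesis by simp
  qed
  have v0: "v 0 \<noteq> 0" using init by (simp add: v_def z_def m_def s_def)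
  have "(u \<longlongrightarrow> 0) at_top"
  proof (rule Lim_null_comparison)
    show "\<forall>\<^sub>F t in at_top. norm (u t) \<le> (cmod (u 0) * 2 / cmod (v 0)) * exp (- (K * s) * t)"
      unfolding eventually_at_top_linorder
    proof (intro exI[of _ 0] allI impI)
      fix t :: real assume t: "0 \<le> t"
      have "cmod (v 0) * cmod (u t) = cmod (u 0) * (exp (- (K * s) * t) * cmod (v t))"
        using arg_cong[OF u_eq[OF t], of cmod] by (simp add: norm_mult y_def)
      also have "\<dots> \<le> cmod (u 0) * (exp (- (K * s) * t) * 2)"
        using vb[OF t] by (intro mult_left_mono) auto
      finally show "norm (u t) \<le> (cmod (u 0) * 2 / cmod (v 0)) * exp (- (K * s) * t)"
        using v0 by (simp add: field_simps)
    qed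
    have "((\<lambda>t. exp (- (K * s) * t)) \<longlongrightarrow> 0) at_top"
      using K s by (intro filterlim_compose[OF exp_at_bot] filterlim_tendsto_neg_mult_at_bot[OF tendsto_const _ filterlim_ident]) auto
    then show "((\<lambda>t. (cmod (u 0) * 2 / cmod (v 0)) * exp (- (K * s) * t)) \<longlongrightarrow> 0) at_top"
      by (rule tendsto_mult_right_zero)
  qed
  then have "(z \<longlongrightarrow> p) at_top" unfolding u_def by (simp add: LIM_zero_iff)
  then have "((\<lambda>t. cmod (z t)) \<longlongrightarrow> cmod p) at_top" by (rule tendsto_norm)
  then show ?thesis by (simp add: norm_pm z_def)
qed

text \<open>The two fixed points merge at \<open>\<i>\<close>, and \<open>u = z - \<i>\<close> solves \<open>u' = - (K/2) u\<^sup>2\<close>. The product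
  \<open>u (1 + (K/2) u(0) t)\<close> is therefore constant, which gives decay of order \<open>1/t\<close>. Comparing the two
  sides through a linear equation avoids any division by \<open>u\<close>.\<close>

lemma overlap_limit_critical:
  assumes N2: "N = 2" and \<Omega>: "\<Omega> 1 = \<omega>" "\<Omega> 2 = - \<omega>" and \<Lambda>: "2 * \<omega> / K = 1"
    and init: "\<langle>\<phi> 1 0, \<phi> 2 0\<rangle> \<noteq> \<i>"
  shows "((\<lambda>t. cmod \<langle>\<phi> 1 t, \<phi> 2 t\<rangle>) \<longlongrightarrow> 1) at_top"
proof -
  define z where "z = (\<lambda>t. \<langle>\<phi> 1 t, \<phi> 2 t\<rangle>)"
  define u where "u = (\<lambda>t. z t - \<i>)"
  define \<alpha> where "\<alpha> = (\<lambda>t. - complex_of_real (K / 2) * u t)"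
  have u0: "u 0 \<noteq> 0" using init by (simp add: u_def z_def)
  have z1: "cmod (z t) \<le> 1" if "t \<ge> 0" for t unfolding z_def by (rule cmod_cinner_le_1) (use N2 that in auto)
  have ub: "cmod (u t) \<le> 2" if "t \<ge> 0" for t
    using norm_triangle_ineq4[of "z t" \<i>] z1[OF that] by (simp add: u_def)
  have du: "(u has_vector_derivative \<alpha> t * u t) (at t within {0..})" if "t \<ge> 0" for t
  proof -
    have "2 * \<omega> = K" using \<Lambda> K by simp
    then have "2 * \<i> * complex_of_real \<omega> * z t = \<i> * complex_of_real K * z t"
      by (metis mult.assoc mult.commute of_real_mult of_real_numeral)
    then have eq: "2 * \<i> * complex_of_real \<omega> * z t + complex_of_real (K / 2) * (1 - (z t)\<^sup>2) = \<alpha> t * u t"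
      by (simp add: \<alpha>_def u_def power2_eq_square field_simps)
    have "(z has_vector_derivative \<alpha> t * u t) (at t within {0..})"
      using overlap_Riccati[OF N2 \<Omega> that] unfolding z_def[symmetric] using eq by (simp add: z_def)
    from has_vector_derivative_diff[OF this has_vector_derivative_const[of \<i>]]
    show ?thesis unfolding u_def[abs_def] by (simp add: u_def)
  qed
  define y where "y = (\<lambda>t. u t * (1 + complex_of_real (K / 2) * u 0 * complex_of_real t) - u 0)"
  have y0: "y t = 0" if t: "t \<ge> 0" for t
  proof (rule complex_linear_ode_unique_zero[where \<alpha> = \<alpha> and A = K])
    show "(y has_vector_derivative \<alpha> t * y t) (at t within {0..})" if "t \<ge> 0" for t
    proof -
      have "((\<lambda>t. 1 + complex_of_real (K / 2) * u 0 * complex_of_real t) has_vector_derivative complex_of_real (K / 2) * u 0) (at t within {0..})"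
        by (auto intro!: derivative_eq_intros has_vector_derivative_real_field)
      from has_vector_derivative_diff[OF has_vector_derivative_mult[OF du[OF that] this] has_vector_derivative_const[of "u 0"]]
      show ?thesis
        unfolding y_def by (rule has_vector_derivative_eq_rhs) (simp add: \<alpha>_def algebra_simps)
    qed
    show "cmod (\<alpha> t) \<le> K" if "t \<ge> 0" for t
      using ub[OF that] K by (simp add: \<alpha>_def norm_mult)
  qed (auto simp: y_def t)
  have "(u \<longlongrightarrow> 0) at_top"
  proof (rule Lim_null_comparison)
    show "\<forall>\<^sub>F t in at_top. norm (u t) \<le> (4 / K) * inverse t"
      unfolding eventually_at_top_linorder
    proof (intro exI[of _ "4 / (K * cmod (u 0))"] allI impI)
      fix t assume t: "t \<ge> 4 / (K * cmod (u 0))"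
      have pos: "K * cmod (u 0) > 0" using K u0 by simp
      then have "4 / (K * cmod (u 0)) > 0" by simp
      then have t0: "t > 0" using t by linarith
      have "4 \<le> K * cmod (u 0) * t" using t pos by (simp add: field_simps)
      moreover have "(K / 4) * cmod (u 0) * t = K * cmod (u 0) * t / 4" "(K / 2) * cmod (u 0) * t = K * cmod (u 0) * t / 2"
        by simp_all
      ultimately have "(K / 4) * cmod (u 0) * t \<le> (K / 2) * cmod (u 0) * t - 1" by linarith
      also have "\<dots> = cmod (complex_of_real (K / 2) * u 0 * complex_of_real t) - cmod 1"
        using K t0 by (simp add: norm_mult)
      also have "\<dots> \<le> cmod (1 + complex_of_real (K / 2) * u 0 * complex_of_real t)"
        using norm_diff_ineq[of "complex_of_real (K / 2) * u 0 * complex_of_real t" 1] by (simp add: add.commute)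
      finally have "cmod (u t) * ((K / 4) * cmod (u 0) * t)
          \<le> cmod (u t) * cmod (1 + complex_of_real (K / 2) * u 0 * complex_of_real t)"
        by (intro mult_left_mono) auto
      also have "\<dots> = cmod (u 0)"
        using y0[of t] t0 by (simp add: y_def norm_mult[symmetric])
      finally have "cmod (u 0) * (cmod (u t) * (K / 4) * t) \<le> cmod (u 0) * 1" by (simp add: mult_ac)
      then have "cmod (u t) * (K / 4) * t \<le> 1" by (rule mult_left_le_imp_le) (use u0 in simp)
      then show "norm (u t) \<le> (4 / K) * inverse t" using K t0 by (simp add: field_simps)
    qed
    show "((\<lambda>t. (4 / K) * inverse t) \<longlongrightarrow> 0) at_top"
      by (rule tendsto_mult_right_zero[OF tendsto_inverse_0_at_top[OF filterlim_ident]])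
  qed
  then have "(z \<longlongrightarrow> \<i>) at_top" unfolding u_def by (simp add: LIM_zero_iff)
  then have "((\<lambda>t. cmod (z t)) \<longlongrightarrow> cmod \<i>) at_top" by (rule tendsto_norm)
  then show ?thesis by (simp add: z_def)
qed

subsection \<open>Identical frequencies\<close>

definition centroid :: "real \<Rightarrow> 'a L2" where
  "centroid t = (1 / real N) *\<^sub>R (\<Sum>l=1..N. \<phi> l t)"

text \<open>The complex amplitude whose real part at time zero is the one in the synchronisation condition for
  identical frequencies.\<close>

definition alignment :: "nat \<Rightarrow> real \<Rightarrow> complex" where
  "alignment j t = \<langle>centroid t, \<phi> j t\<rangle>"

lemma norm_centroid_le_1: "t \<ge> 0 \<Longrightarrow> norm (centroid t) \<le> 1"
proof -
  assume t: "t \<ge> 0"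
  have "norm (\<Sum>l=1..N. \<phi> l t) \<le> (\<Sum>l=1..N. 1)"
    by (rule sum_norm_le) (simp add: norm_\<phi> t)
  then show ?thesis using N by (simp add: centroid_def field_simps)
qed

lemma cmod_alignment_le: "j \<in> {1..N} \<Longrightarrow> t \<ge> 0 \<Longrightarrow> cmod (alignment j t) \<le> norm (centroid t)"
  using cinner_Cauchy_Schwarz[of "centroid t" "\<phi> j t"] by (simp add: alignment_def norm_\<phi>)

lemma velocity_identical:
  assumes "\<forall>j\<in>{1..N}. \<Omega> j = 0" "j \<in> {1..N}"
  shows "velocity j t = (K / 2) *\<^sub>R (centroid t - alignment j t *\<^sub>C \<phi> j t)"
proof -
  have sumC: "(\<Sum>l\<in>L. c l *\<^sub>C x) = (\<Sum>l\<in>L. c l) *\<^sub>C x" for c :: "nat \<Rightarrow> complex" and L and x :: "'a L2"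
    by (induction L rule: infinite_finite_induct) (auto simp: scaleC_add_left)
  have "(\<Sum>l=1..N. \<phi> l t) = real N *\<^sub>R centroid t" using N by (simp add: centroid_def)
  moreover have "(\<Sum>l=1..N. \<langle>\<phi> l t, \<phi> j t\<rangle>) = complex_of_real (real N) * alignment j t"
    unfolding alignment_def cinner_sum_left[symmetric] calculation cinner_scaleR_left ..
  ultimately have "velocity j t = \<kappa> *\<^sub>R (real N *\<^sub>R centroid t - (complex_of_real (real N) * alignment j t) *\<^sub>C \<phi> j t)"
    unfolding velocity_def sum_subtractf sumC using assms by simp
  also have "\<dots> = (\<kappa> * real N) *\<^sub>R (centroid t - alignment j t *\<^sub>C \<phi> j t)"
    by (simp only: scaleC_scaleC[symmetric] scaleC_of_real scaleR_diff_right[symmetric] scaleR_scaleR)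
  finally show ?thesis by (simp add: \<kappa>_N)
qed

text \<open>The squared length of the centroid is a bounded Lyapunov function, and its dissipation
  controls the distance of every state from the complex line spanned by the centroid. Whether
  a state ends up parallel or antiparallel to the centroid is immaterial for \<open>|\<langle>\<phi> j, \<phi> k\<rangle>|\<close>.\<close>

lemma overlap_limit_identical:
  assumes \<Omega>: "\<forall>j\<in>{1..N}. \<Omega> j = 0" and init: "centroid 0 \<noteq> 0"
    and j: "j \<in> {1..N}" and k: "k \<in> {1..N}"
  shows "((\<lambda>t. cmod \<langle>\<phi> j t, \<phi> k t\<rangle>) \<longlongrightarrow> 1) at_top"
proof -
  define R where "R = (\<lambda>t. inner (centroid t) (centroid t))"
  define D where "D = (\<lambda>t. (K / real N) * (\<Sum>j=1..N. R t - Re ((alignment j t)\<^sup>2)))"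
  have Rn: "R t = (norm (centroid t))\<^sup>2" for t by (simp add: R_def power2_norm_eq_inner)
  have cvel: "(centroid has_vector_derivative (1 / real N) *\<^sub>R (\<Sum>l=1..N. velocity l t)) (at t within {0..})"
    if "t \<ge> 0" for t
    unfolding centroid_def
    by (intro bounded_linear.has_vector_derivative[OF bounded_linear_scaleR_right] has_vector_derivative_sum has_velocity that)
  have dR: "(R has_real_derivative D t) (at t within {0..})" if t: "t \<ge> 0" for t
  proof -
    have "inner (centroid t) (velocity l t) = (K / 2) * (R t - Re ((alignment l t)\<^sup>2))" if "l \<in> {1..N}" for l
      unfolding velocity_identical[OF \<Omega> that]
      by (simp add: R_def inner_diff_right) (simp add: inner_L2_def alignment_def cinner_scaleC_right power2_eq_square)
    then have "inner (centroid t) (\<Sum>l=1..N. velocity l t) = (\<Sum>l=1..N. (K / 2) * (R t - Re ((alignment l t)\<^sup>2)))"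
      unfolding inner_sum_right by (intro sum.cong refl)
    also have "\<dots> = (K / 2) * (\<Sum>l=1..N. R t - Re ((alignment l t)\<^sup>2))" by (rule sum_distrib_left[symmetric])
    finally have "2 * inner (centroid t) ((1 / real N) *\<^sub>R (\<Sum>l=1..N. velocity l t)) = D t"
      by (simp add: D_def)
    then show ?thesis unfolding R_def using has_real_derivative_inner_self[OF cvel[OF t]] by simp
  qed
  have gap: "(cmod (alignment j t))\<^sup>2 \<le> R t" "R t - (cmod (alignment j t))\<^sup>2 \<le> R t - Re ((alignment j t)\<^sup>2)"
    if "j \<in> {1..N}" "t \<ge> 0" for j t
  proof -
    show "(cmod (alignment j t))\<^sup>2 \<le> R t" unfolding Rn using cmod_alignment_le[OF that] by (intro power_mono) auto
    have "Re ((alignment j t)\<^sup>2) \<le> cmod ((alignment j t)\<^sup>2)" by (rule complex_Re_le_cmod)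
    then show "R t - (cmod (alignment j t))\<^sup>2 \<le> R t - Re ((alignment j t)\<^sup>2)" by (simp add: norm_power)
  qed
  have gap0: "0 \<le> R t - Re ((alignment j t)\<^sup>2)" if "j \<in> {1..N}" "t \<ge> 0" for j t
    using gap[OF that] by linarith
  have D0: "0 \<le> D t" if "t \<ge> 0" for t
    unfolding D_def using K N gap0 that by (intro mult_nonneg_nonneg sum_nonneg) auto
  have vel_le: "norm (velocity l t) \<le> K" if "l \<in> {1..N}" "t \<ge> 0" for l t
  proof -
    have "norm (centroid t - alignment l t *\<^sub>C \<phi> l t) \<le> norm (centroid t) + cmod (alignment l t)"
      using norm_triangle_ineq4[of "centroid t" "alignment l t *\<^sub>C \<phi> l t"] that by (simp add: norm_scaleC norm_\<phi>)
    also have "\<dots> \<le> 2" using norm_centroid_le_1[OF that(2)] cmod_alignment_le[OF that] by linarith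
    finally show ?thesis unfolding velocity_identical[OF \<Omega> that(1)] using K by simp
  qed
  have Lip_\<phi>: "norm (\<phi> l s - \<phi> l t) \<le> K * \<bar>s - t\<bar>" if l: "l \<in> {1..N}" and st: "s \<ge> 0" "t \<ge> 0" for l s t
  proof -
    have "norm (\<phi> l s - \<phi> l t) \<le> K * norm (s - t)"
    proof (rule differentiable_bound[of "{0..}" "\<phi> l" "\<lambda>x h. h *\<^sub>R velocity l x"])
      show "onorm (\<lambda>h. h *\<^sub>R velocity l x) \<le> K" if "x \<in> {0..}" for x
      proof (rule onorm_bound)
        show "norm (h *\<^sub>R velocity l x) \<le> K * norm h" for h
          using mult_left_mono[OF vel_le[OF l, of x], of "\<bar>h\<bar>"] that by (simp add: mult.commute)
      qed (use K in simp)
    qed (use st has_velocity[OF l] in \<open>auto simp: has_vector_derivative_def\<close>)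
    then show ?thesis by simp
  qed
  have Lip_c: "norm (centroid s - centroid t) \<le> K * \<bar>s - t\<bar>" if st: "s \<ge> 0" "t \<ge> 0" for s t
  proof -
    have "centroid s - centroid t = (1 / real N) *\<^sub>R (\<Sum>l=1..N. \<phi> l s - \<phi> l t)"
      by (simp add: centroid_def sum_subtractf scaleR_diff_right)
    moreover have "norm (\<Sum>l=1..N. \<phi> l s - \<phi> l t) \<le> (\<Sum>l=1..N. K * \<bar>s - t\<bar>)"
      by (rule sum_norm_le) (use Lip_\<phi> st in auto)
    ultimately show ?thesis using N by (simp add: field_simps)
  qed
  have Lip_R: "\<bar>R s - R t\<bar> \<le> 2 * K * \<bar>s - t\<bar>" if st: "s \<ge> 0" "t \<ge> 0" for s t
  proof -
    have "R s - R t = inner (centroid s - centroid t) (centroid s + centroid t)"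
      by (simp add: R_def inner_diff_left inner_add_right inner_commute[of "centroid t" "centroid s"])
    also have "\<bar>\<dots>\<bar> \<le> norm (centroid s - centroid t) * norm (centroid s + centroid t)" by (rule Cauchy_Schwarz_ineq2)
    also have "\<dots> \<le> (K * \<bar>s - t\<bar>) * 2"
      using Lip_c[OF st] norm_triangle_ineq[of "centroid s" "centroid t"] norm_centroid_le_1[OF st(1)] norm_centroid_le_1[OF st(2)] K
      by (intro mult_mono) auto
    finally show ?thesis by simp
  qed
  have Lip_a: "\<bar>Re ((alignment l s)\<^sup>2) - Re ((alignment l t)\<^sup>2)\<bar> \<le> 4 * K * \<bar>s - t\<bar>"
    if l: "l \<in> {1..N}" and st: "s \<ge> 0" "t \<ge> 0" for l s t
  proof -
    have a1: "cmod (alignment l r) \<le> 1" if "r \<ge> 0" for r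
      using cmod_alignment_le[OF l that] norm_centroid_le_1[OF that] by linarith
    have "alignment l s - alignment l t = \<langle>centroid s - centroid t, \<phi> l s\<rangle> + \<langle>centroid t, \<phi> l s - \<phi> l t\<rangle>"
      by (simp add: alignment_def cinner_diff_left cinner_diff_right)
    also have "cmod \<dots> \<le> norm (centroid s - centroid t) * norm (\<phi> l s) + norm (centroid t) * norm (\<phi> l s - \<phi> l t)"
      by (intro norm_triangle_le add_mono cinner_Cauchy_Schwarz)
    also have "\<dots> \<le> (K * \<bar>s - t\<bar>) * 1 + 1 * (K * \<bar>s - t\<bar>)"
      using Lip_c[OF st] Lip_\<phi>[OF l st] norm_centroid_le_1[OF st(2)] norm_\<phi>[OF l st(1)] K
      by (intro add_mono mult_mono) auto
    finally have d: "cmod (alignment l s - alignment l t) \<le> 2 * K * \<bar>s - t\<bar>" by simp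
    have "\<bar>Re ((alignment l s)\<^sup>2) - Re ((alignment l t)\<^sup>2)\<bar> \<le> cmod ((alignment l s)\<^sup>2 - (alignment l t)\<^sup>2)"
      using abs_Re_le_cmod[of "(alignment l s)\<^sup>2 - (alignment l t)\<^sup>2"] by simp
    also have "(alignment l s)\<^sup>2 - (alignment l t)\<^sup>2 = (alignment l s - alignment l t) * (alignment l s + alignment l t)"
      by (simp add: power2_eq_square algebra_simps)
    also have "cmod \<dots> \<le> (2 * K * \<bar>s - t\<bar>) * 2"
      unfolding norm_mult using d norm_triangle_ineq[of "alignment l s" "alignment l t"] a1[OF st(1)] a1[OF st(2)] K
      by (intro mult_mono) auto
    finally show ?thesis by simp
  qed
  have Lip_D: "\<bar>D s - D t\<bar> \<le> (6 * K\<^sup>2) * \<bar>s - t\<bar>" if st: "s \<ge> 0" "t \<ge> 0" for s t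
  proof -
    have "D s - D t = (K / real N) * (\<Sum>l=1..N. (R s - R t) - (Re ((alignment l s)\<^sup>2) - Re ((alignment l t)\<^sup>2)))"
    proof -
      have "D s - D t = (K / real N) * (\<Sum>l=1..N. (R s - Re ((alignment l s)\<^sup>2)) - (R t - Re ((alignment l t)\<^sup>2)))"
        unfolding D_def right_diff_distrib[symmetric] sum_subtractf[symmetric] ..
      moreover have eq: "(R s - Re ((alignment l s)\<^sup>2)) - (R t - Re ((alignment l t)\<^sup>2))
          = (R s - R t) - (Re ((alignment l s)\<^sup>2) - Re ((alignment l t)\<^sup>2))" for l by simp
      ultimately show ?thesis by (simp only: eq)
    qed
    also have "\<bar>\<dots>\<bar> \<le> (K / real N) * (\<Sum>l=1..N. 6 * K * \<bar>s - t\<bar>)"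
    proof -
      have "\<bar>\<Sum>l=1..N. (R s - R t) - (Re ((alignment l s)\<^sup>2) - Re ((alignment l t)\<^sup>2))\<bar> \<le> (\<Sum>l=1..N. 6 * K * \<bar>s - t\<bar>)"
      proof (rule order_trans[OF sum_abs sum_mono])
        fix l assume "l \<in> {1..N}"
        then show "\<bar>(R s - R t) - (Re ((alignment l s)\<^sup>2) - Re ((alignment l t)\<^sup>2))\<bar> \<le> 6 * K * \<bar>s - t\<bar>"
          using Lip_R[OF st] Lip_a[of l s t] st by linarith
      qed
      then have "(K / real N) * \<bar>\<Sum>l=1..N. (R s - R t) - (Re ((alignment l s)\<^sup>2) - Re ((alignment l t)\<^sup>2))\<bar>
          \<le> (K / real N) * (\<Sum>l=1..N. 6 * K * \<bar>s - t\<bar>)"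
        by (rule mult_left_mono) (use K in simp)
      moreover have KN: "\<bar>K / real N\<bar> = K / real N" using K by simp
      ultimately show ?thesis by (simp only: abs_mult KN)
    qed
    also have "\<dots> = (6 * K\<^sup>2) * \<bar>s - t\<bar>" using N by (simp add: power2_eq_square)
    finally show ?thesis .
  qed
  have R1: "R t \<le> 1" if "t \<ge> 0" for t
    unfolding Rn using norm_centroid_le_1[OF that] by (simp add: power_le_one)
  have Dlim: "(D \<longlongrightarrow> 0) at_top"
    by (rule Barbalat[OF dR D0 R1 Lip_D]) (use K in auto)
  have R0: "R 0 > 0" using init by (simp add: R_def)
  have R_ge: "R 0 \<le> R t" if "t \<ge> 0" for t
  proof -
    have "- R t \<le> - R 0"
      using that D0 by (intro nonincreasing_if_deriv_nonpos[where f = "\<lambda>t. - R t" and f' = "\<lambda>t. - D t"])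
        (auto intro: DERIV_minus dR)
    then show ?thesis by simp
  qed
  \<comment> \<open>The distance of the centroid from its orthogonal projection onto the complex line of \<open>\<phi> l t\<close>.\<close>
  define e where "e = (\<lambda>l t. norm (centroid t - cnj (alignment l t) *\<^sub>C \<phi> l t))"
  have e_sq: "(e l t)\<^sup>2 = R t - (cmod (alignment l t))\<^sup>2" if "l \<in> {1..N}" "t \<ge> 0" for l t
  proof -
    let ?o = "alignment l t"
    have "complex_of_real ((e l t)\<^sup>2) = \<langle>centroid t - cnj ?o *\<^sub>C \<phi> l t, centroid t - cnj ?o *\<^sub>C \<phi> l t\<rangle>"
      unfolding e_def cinner_self ..
    also have "\<dots> = \<langle>centroid t, centroid t\<rangle> - cnj ?o * ?o - ?o * cnj ?o + ?o * cnj ?o * \<langle>\<phi> l t, \<phi> l t\<rangle>"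
      unfolding alignment_def
      by (simp add: cinner_diff_left cinner_diff_right cinner_scaleC_left cinner_scaleC_right
          cinner_commute[of "centroid t" "\<phi> l t"] algebra_simps)
    also have "\<langle>\<phi> l t, \<phi> l t\<rangle> = 1" using norm_\<phi>[OF that] by (simp add: cinner_self)
    also have "\<langle>centroid t, centroid t\<rangle> - cnj ?o * ?o - ?o * cnj ?o + ?o * cnj ?o * 1
        = complex_of_real (R t - (cmod ?o)\<^sup>2)"
      unfolding cinner_self Rn by (simp add: complex_norm_square[symmetric] mult.commute del: of_real_power)
    finally show ?thesis by (simp only: of_real_eq_iff)
  qed
  have e_lim: "(e l \<longlongrightarrow> 0) at_top" if l: "l \<in> {1..N}" for l
  proof -
    have bound: "(e l t)\<^sup>2 \<le> (real N / K) * D t" if t: "t \<ge> 0" for t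
    proof -
      have "(e l t)\<^sup>2 \<le> R t - Re ((alignment l t)\<^sup>2)" using e_sq[OF l t] gap(2)[OF l t] by simp
      also have "\<dots> \<le> (\<Sum>j=1..N. R t - Re ((alignment j t)\<^sup>2))"
        using l gap0 t by (intro member_le_sum) auto
      also have "\<dots> = (real N / K) * D t" using K N by (simp add: D_def)
      finally show ?thesis .
    qed
    have "((\<lambda>t. (e l t)\<^sup>2) \<longlongrightarrow> 0) at_top"
    proof (rule Lim_null_comparison)
      show "\<forall>\<^sub>F t in at_top. norm ((e l t)\<^sup>2) \<le> (real N / K) * D t"
        unfolding eventually_at_top_linorder using bound by (intro exI[of _ 0]) auto
      show "((\<lambda>t. (real N / K) * D t) \<longlongrightarrow> 0) at_top" by (rule tendsto_mult_right_zero[OF Dlim])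
    qed
    then have "((\<lambda>t. sqrt ((e l t)\<^sup>2)) \<longlongrightarrow> sqrt 0) at_top" by (rule tendsto_real_sqrt)
    then show ?thesis by (simp add: e_def)
  qed
  have "((\<lambda>t. 1 - cmod \<langle>\<phi> j t, \<phi> k t\<rangle>) \<longlongrightarrow> 0) at_top"
  proof (rule Lim_null_comparison)
    show "\<forall>\<^sub>F t in at_top. norm (1 - cmod \<langle>\<phi> j t, \<phi> k t\<rangle>) \<le> (e j t + e k t) / R 0"
      unfolding eventually_at_top_linorder
    proof (intro exI[of _ 0] allI impI)
      fix t :: real assume t: "0 \<le> t"
      \<comment> \<open>Both projections of the centroid are close to it, so their inner product is close to its squared length, which is bounded below.\<close>
      define x where "x = cnj (alignment j t) *\<^sub>C \<phi> j t"
      define y where "y = cnj (alignment k t) *\<^sub>C \<phi> k t"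
      have nx: "norm x \<le> 1"
        using cmod_alignment_le[OF j t] norm_centroid_le_1[OF t] norm_\<phi>[OF j t] by (simp add: x_def norm_scaleC)
      have "complex_of_real (R t) - \<langle>x, y\<rangle> = \<langle>centroid t - x, centroid t\<rangle> + \<langle>x, centroid t - y\<rangle>"
        by (simp add: cinner_diff_left cinner_diff_right cinner_self Rn)
      also have "cmod \<dots> \<le> norm (centroid t - x) * norm (centroid t) + norm x * norm (centroid t - y)"
        by (intro norm_triangle_le add_mono cinner_Cauchy_Schwarz)
      also have "\<dots> \<le> e j t * 1 + 1 * e k t"
        unfolding e_def x_def[symmetric] y_def[symmetric]
        using norm_centroid_le_1[OF t] nx by (intro add_mono mult_mono) auto
      finally have h: "cmod (complex_of_real (R t) - \<langle>x, y\<rangle>) \<le> e j t + e k t" by simp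
      have "R t - cmod \<langle>x, y\<rangle> \<le> e j t + e k t"
      proof -
        have "R t \<ge> 0" by (simp add: Rn)
        then have "cmod (complex_of_real (R t)) = R t" by (simp only: norm_of_real abs_of_nonneg)
        then show ?thesis using h norm_triangle_ineq2[of "complex_of_real (R t)" "\<langle>x, y\<rangle>"] by linarith
      qed
      moreover have "cmod \<langle>x, y\<rangle> \<le> R t * cmod \<langle>\<phi> j t, \<phi> k t\<rangle>"
      proof -
        have "cmod \<langle>x, y\<rangle> = (cmod (alignment j t) * cmod (alignment k t)) * cmod \<langle>\<phi> j t, \<phi> k t\<rangle>"
          by (simp add: x_def y_def cinner_scaleC_left cinner_scaleC_right norm_mult)
        moreover have "cmod (alignment j t) * cmod (alignment k t) \<le> R t"
          unfolding Rn power2_eq_square using cmod_alignment_le[OF j t] cmod_alignment_le[OF k t] by (intro mult_mono) auto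
        ultimately show ?thesis by (simp add: mult_right_mono)
      qed
      ultimately have "R t * (1 - cmod \<langle>\<phi> j t, \<phi> k t\<rangle>) \<le> e j t + e k t" by (simp add: algebra_simps)
      moreover have z1: "cmod \<langle>\<phi> j t, \<phi> k t\<rangle> \<le> 1" by (rule cmod_cinner_le_1[OF j k t])
      moreover have "R 0 * (1 - cmod \<langle>\<phi> j t, \<phi> k t\<rangle>) \<le> R t * (1 - cmod \<langle>\<phi> j t, \<phi> k t\<rangle>)"
        using R_ge[OF t] z1 by (intro mult_right_mono) auto
      ultimately have "R 0 * (1 - cmod \<langle>\<phi> j t, \<phi> k t\<rangle>) \<le> e j t + e k t" by linarith
      then show "norm (1 - cmod \<langle>\<phi> j t, \<phi> k t\<rangle>) \<le> (e j t + e k t) / R 0"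
        using R0 z1 by (simp add: field_simps)
    qed
    have "((\<lambda>t. (e j t + e k t) / R 0) \<longlongrightarrow> (0 + 0) / R 0) at_top"
      using R0 by (intro tendsto_divide tendsto_add e_lim j k tendsto_const) auto
    then show "((\<lambda>t. (e j t + e k t) / R 0) \<longlongrightarrow> 0) at_top" by simp
  qed
  from tendsto_diff[OF tendsto_const[of 1] this] show ?thesis by simp
qed

end

section \<open>From the Duhamel formula to the interaction picture\<close>

lemma lohe_term_unitary:
  assumes "unitary_group U"
  shows "lohe_term N K \<Omega> (\<lambda>l. U t (\<psi> l)) j = U t (lohe_term N K \<Omega> \<psi> j)"
  unfolding lohe_term_def
  by (simp only: unitary_groupD(1-3)[OF assms] unitary_group_linear(2,7)[OF assms])

lemma norm_le_H1_norm: "norm u \<le> H1_norm u"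
  unfolding H1_norm_def by (rule real_le_rsqrt) (simp add: sum_nonneg)

lemma continuous_on_H1_imp_continuous_on:
  assumes "continuous_on_H1 T \<psi>"
  shows "continuous_on T \<psi>"
  unfolding continuous_on_def
proof
  fix t assume t: "t \<in> T"
  have "((\<lambda>s. \<psi> s - \<psi> t) \<longlongrightarrow> 0) (at t within T)"
  proof (rule Lim_null_comparison)
    show "\<forall>\<^sub>F s in at t within T. norm (\<psi> s - \<psi> t) \<le> H1_norm (\<psi> s - \<psi> t)"
      by (intro always_eventually allI norm_le_H1_norm)
    show "((\<lambda>s. H1_norm (\<psi> s - \<psi> t)) \<longlongrightarrow> 0) (at t within T)"
      using assms t by (simp add: continuous_on_H1_def)
  qed
  then show "(\<psi> \<longlongrightarrow> \<psi> t) (at t within T)" by (simp add: LIM_zero_iff)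
qed

lemma continuous_on_unitary_group:
  assumes U: "unitary_group U" and \<psi>: "continuous_on T \<psi>"
  shows "continuous_on T (\<lambda>t. U (- t) (\<psi> t))"
  unfolding continuous_on_def
proof
  fix t assume t: "t \<in> T"
  have "((\<lambda>s. \<psi> s - \<psi> t) \<longlongrightarrow> 0) (at t within T)"
    using \<psi> t by (simp add: continuous_on_def LIM_zero)
  then have "((\<lambda>s. norm (U (- s) (\<psi> s - \<psi> t))) \<longlongrightarrow> 0) (at t within T)"
    unfolding unitary_group_linear(3)[OF U] by (rule tendsto_norm_zero)
  then have 1: "((\<lambda>s. U (- s) (\<psi> s - \<psi> t)) \<longlongrightarrow> 0) (at t within T)"
    by (rule tendsto_norm_zero_cancel)
  have "continuous_on T ((\<lambda>r. U r (\<psi> t)) \<circ> uminus)"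
    by (intro continuous_on_compose continuous_intros unitary_groupD(6)[OF U])
  then have 2: "((\<lambda>s. U (- s) (\<psi> t)) \<longlongrightarrow> U (- t) (\<psi> t)) (at t within T)"
    using t by (simp add: continuous_on_def o_def)
  have "((\<lambda>s. U (- s) (\<psi> s - \<psi> t) + U (- s) (\<psi> t)) \<longlongrightarrow> 0 + U (- t) (\<psi> t)) (at t within T)"
    by (rule tendsto_add[OF 1 2])
  then show "((\<lambda>s. U (- s) (\<psi> s)) \<longlongrightarrow> U (- t) (\<psi> t)) (at t within T)"
    by (simp add: unitary_group_linear(2)[OF U])
qed

lemma continuous_on_lohe_term:
  assumes "\<And>l. l \<in> {1..N} \<Longrightarrow> continuous_on T (\<phi> l)" "j \<in> {1..N}"
  shows "continuous_on T (\<lambda>s. lohe_term N K \<Omega> (\<lambda>l. \<phi> l s) j)"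
proof -
  have "continuous_on T (\<lambda>s. \<langle>\<phi> l s, \<phi> j s\<rangle>)" if "l \<in> {1..N}" for l
    by (rule bounded_bilinear.continuous_on[OF bounded_bilinear_cinner assms(1)[OF that] assms(1)[OF assms(2)]])
  then have "continuous_on T (\<lambda>s. \<langle>\<phi> l s, \<phi> j s\<rangle> *\<^sub>C \<phi> j s)" if "l \<in> {1..N}" for l
    using bounded_bilinear.continuous_on[OF bounded_bilinear_scaleC _ assms(1)[OF assms(2)]] that by blast
  then have "continuous_on T (\<lambda>s. \<Sum>l=1..N. \<phi> l s - \<langle>\<phi> l s, \<phi> j s\<rangle> *\<^sub>C \<phi> j s)"
    by (intro continuous_on_sum continuous_on_diff assms(1))
  then show ?thesis
    unfolding lohe_term_def
    by (rule continuous_on_add[OF bounded_linear.continuous_on[OF bounded_linear_scaleC assms(1)[OF assms(2)]]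
          bounded_linear.continuous_on[OF bounded_linear_scaleC]])
qed

text \<open>Applying \<open>U (- t)\<close> to the Duhamel formula moves the group inside the coupling term, which commutes
  with unitary maps, and leaves an integral equation with continuous integrand.\<close>

lemma interaction_picture:
  fixes \<psi> :: "nat \<Rightarrow> real \<Rightarrow> 'a::euclidean_space L2"
  assumes U: "unitary_group U" and K: "K > 0" and N: "N \<ge> 1"
    and unit: "\<And>j. j \<in> {1..N} \<Longrightarrow> norm (\<psi>init j) = 1"
    and cont: "\<And>j. j \<in> {1..N} \<Longrightarrow> continuous_on {0..} (\<psi> j)"
    and Duhamel: "\<forall>j\<in>{1..N}. \<forall>t\<ge>0. \<exists>D.
          ((\<lambda>s. U (t - s) (lohe_term N K \<Omega> (\<lambda>l. \<psi> l s) j)) has_integral D) {0..t} \<and>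
          \<psi> j t = U t (\<psi>init j) - \<i> *\<^sub>C D"
  defines "\<phi> \<equiv> \<lambda>j t. U (- t) (\<psi> j t)"
  shows "lohe_flow N K \<Omega> \<phi>" "\<And>j. j \<in> {1..N} \<Longrightarrow> \<phi> j 0 = \<psi>init j"
proof -
  define G where "G = (\<lambda>j s. lohe_term N K \<Omega> (\<lambda>l. \<phi> l s) j)"
  have contG: "continuous_on {0..} (G j)" if "j \<in> {1..N}" for j
    unfolding G_def \<phi>_def using that cont by (intro continuous_on_lohe_term continuous_on_unitary_group[OF U]) auto
  have formula: "\<phi> j t = \<psi>init j - \<i> *\<^sub>C integral {0..t} (G j)" if j: "j \<in> {1..N}" and t: "t \<ge> 0" for j t
  proof -
    obtain D where D: "((\<lambda>s. U (t - s) (lohe_term N K \<Omega> (\<lambda>l. \<psi> l s) j)) has_integral D) {0..t}"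
      and \<psi>: "\<psi> j t = U t (\<psi>init j) - \<i> *\<^sub>C D"
      using Duhamel j t by blast
    have "U (- t) (U (t - s) v) = U (- s) v" for s v
      by (simp add: unitary_groupD(5)[OF U, symmetric])
    then have "(G j has_integral U (- t) D) {0..t}"
      using has_integral_linear[OF D unitary_group_linear(4)[OF U, of "- t"]]
      by (simp add: o_def G_def \<phi>_def lohe_term_unitary[OF U])
    then have "U (- t) D = integral {0..t} (G j)" by (simp add: integral_unique)
    then show ?thesis
      unfolding \<phi>_def \<psi> by (simp add: unitary_group_linear(2,5)[OF U] unitary_groupD(2)[OF U])
  qed
  show init: "\<phi> j 0 = \<psi>init j" if "j \<in> {1..N}" for j
    using formula[OF that, of 0] by simp
  show "lohe_flow N K \<Omega> \<phi>"
  proof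
    fix j t assume j: "j \<in> {1..N}" and t: "(0::real) \<le> t"
    have "((\<lambda>u. integral {0..u} (G j)) has_vector_derivative G j t) (at t within {0..t + 1})"
      by (rule integral_has_vector_derivative[OF continuous_on_subset[OF contG[OF j]]]) (use t in auto)
    from has_vector_derivative_diff[OF has_vector_derivative_const[of "\<psi>init j"]
        bounded_linear.has_vector_derivative[OF bounded_linear_scaleC[of \<i>] this]]
    have "((\<lambda>u. \<psi>init j - \<i> *\<^sub>C integral {0..u} (G j)) has_vector_derivative (- \<i>) *\<^sub>C G j t) (at t within {0..t + 1})"
      by (simp add: scaleC_minus_left)
    then have "(\<phi> j has_vector_derivative (- \<i>) *\<^sub>C G j t) (at t within {0..t + 1})"
      by (rule has_vector_derivative_transform[rotated 2]) (use formula[OF j] t in auto)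
    moreover have "at t within {0..t + 1} = at t within {0..}"
      by (rule at_within_nhd[of t "{..<t + 1}"]) auto
    ultimately show "(\<phi> j has_vector_derivative (- \<i>) *\<^sub>C lohe_term N K \<Omega> (\<lambda>l. \<phi> l t) j) (at t within {0..})"
      by (simp add: G_def)
  qed (use K N unit init in auto)
qed

section \<open>Uniform Sobolev control on the span of the initial data\<close>

lemma weak_deriv_sum:
  assumes b: "b \<in> Basis" and F: "finite F" "\<And>i. i \<in> F \<Longrightarrow> f i \<in> H1"
  shows "weak_deriv (\<Sum>i\<in>F. f i) b = (\<Sum>i\<in>F. weak_deriv (f i) b)"
  using F
proof (induction F rule: finite_induct)
  case empty
  show ?case using weak_deriv_eqI[OF b has_weak_deriv_0[OF b]] by simp
next
  case (insert i F)
  have "(\<Sum>i\<in>F. f i) \<in> H1" using insert by (intro subspace_sum[OF subspace_H1]) auto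
  then show ?case using insert b by (simp add: weak_deriv_add)
qed

text \<open>Pointwise bounds on orbits become a bound that is linear in the norm: in coordinates with respect to
  an orthogonal spanning family, only finitely many orbits have to be controlled.\<close>

lemma span_H1_bound:
  fixes B :: "'a::euclidean_space L2 set"
  assumes U: "unitary_group U" and B: "finite B"
    and bound: "\<And>x. x \<in> span B \<Longrightarrow> (\<forall>t. U t x \<in> H1) \<and> (\<exists>M. \<forall>t. \<forall>b\<in>Basis. norm (weak_deriv (U t x) b) \<le> M)"
  shows "\<exists>M\<ge>0. \<forall>x\<in>span B. \<forall>t. \<forall>b\<in>Basis. norm (weak_deriv (U t x) b) \<le> M * norm x"
proof -
  obtain C where C: "finite C" "span C = span B" "pairwise orthogonal C"
    using basis_orthogonal[OF B] by blast
  \<comment> \<open>The family may contain the zero vector; with division by zero equal to zero it contributes nothing to the constant below.\<close>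
  have "\<forall>c\<in>C. \<exists>M\<ge>0. \<forall>t. \<forall>b\<in>Basis. norm (weak_deriv (U t c) b) \<le> M"
  proof
    fix c assume "c \<in> C"
    then have "c \<in> span B" using C(2) span_base by blast
    then obtain M where "\<forall>t. \<forall>b\<in>Basis. norm (weak_deriv (U t c) b) \<le> M" using bound by blast
    then show "\<exists>M\<ge>0. \<forall>t. \<forall>b\<in>Basis. norm (weak_deriv (U t c) b) \<le> M"
      by (intro exI[of _ "max M 0"]) (auto simp: le_max_iff_disj)
  qed
  then obtain M where M0: "\<And>c. c \<in> C \<Longrightarrow> M c \<ge> 0"
    and M: "\<And>c t b. c \<in> C \<Longrightarrow> b \<in> Basis \<Longrightarrow> norm (weak_deriv (U t c) b) \<le> M c"
    by metis
  have "norm (weak_deriv (U t x) b) \<le> (\<Sum>c\<in>C. M c / norm c) * norm x"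
    if x: "x \<in> span B" and b: "b \<in> Basis" for x t b
  proof -
    obtain u where u: "x = (\<Sum>c\<in>C. u c *\<^sub>R c)"
      using x unfolding C(2)[symmetric] span_finite[OF C(1)] by blast
    have CH: "U t c \<in> H1" if "c \<in> C" for c
    proof -
      have "c \<in> span B" using span_base[OF that] C(2) by simp
      then show ?thesis using bound by blast
    qed
    have coeff: "\<bar>u c\<bar> * norm c \<le> norm x" if c: "c \<in> C" "c \<noteq> 0" for c
    proof -
      have "inner c x = (\<Sum>d\<in>C. if d = c then u c * inner c c else 0)"
        unfolding u inner_sum_right
      proof (rule sum.cong[OF refl])
        fix d assume d: "d \<in> C"
        have "inner c d = 0" if "d \<noteq> c"
          using pairwiseD[OF C(3) c(1) d that[symmetric]] by (simp add: orthogonal_def)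
        then show "inner c (u d *\<^sub>R d) = (if d = c then u c * inner c c else 0)"
          by (cases "d = c") simp_all
      qed
      then have "inner c x = u c * (norm c)\<^sup>2" using C(1) c(1) by (simp add: power2_norm_eq_inner)
      then have "norm c * (\<bar>u c\<bar> * norm c) = \<bar>inner c x\<bar>"
        by (simp add: abs_mult power2_eq_square)
      also have "\<dots> \<le> norm c * norm x" by (rule Cauchy_Schwarz_ineq2)
      finally show ?thesis using c(2) by simp
    qed
    have "U t x = (\<Sum>c\<in>C. u c *\<^sub>R U t c)"
      unfolding u by (simp add: unitary_group_linear(1,7)[OF U])
    then have "weak_deriv (U t x) b = (\<Sum>c\<in>C. u c *\<^sub>R weak_deriv (U t c) b)"
      using CH b C(1) by (simp add: weak_deriv_sum H1_scaleR weak_deriv_scaleR)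
    also have "norm \<dots> \<le> (\<Sum>c\<in>C. M c / norm c * norm x)"
    proof (rule sum_norm_le)
      fix c assume c: "c \<in> C"
      show "norm (u c *\<^sub>R weak_deriv (U t c) b) \<le> M c / norm c * norm x"
      proof (cases "c = 0")
        case True
        have "U t c = 0" using unitary_group_linear(3)[OF U, of t c] True by simp
        then show ?thesis using True weak_deriv_eqI[OF b has_weak_deriv_0[OF b]] by simp
      next
        case False
        have "\<bar>u c\<bar> \<le> norm x / norm c" using coeff[OF c False] False by (simp add: field_simps)
        then have "\<bar>u c\<bar> * norm (weak_deriv (U t c) b) \<le> norm x / norm c * M c"
          using M[OF c b] by (intro mult_mono) auto
        then show ?thesis by (simp add: mult.commute)
      qed
    qed
    finally show ?thesis by (simp add: sum_distrib_right)
  qed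
  moreover have "(\<Sum>c\<in>C. M c / norm c) \<ge> 0" using M0 by (intro sum_nonneg) auto
  ultimately show ?thesis by blast
qed

text \<open>The component of a state orthogonal to the complex span of the initial states vanishes by
  \<open>orthogonal_to_flow\<close>. Complex spans are represented as real spans that contain the multiples by
  \<open>\<i>\<close> of the generators.\<close>

lemma (in lohe_flow) flow_in_span:
  assumes S: "S = span (\<Union>l\<in>{1..N}. {\<phi> l 0, \<i> *\<^sub>C \<phi> l 0})" and j: "j \<in> {1..N}" and t: "t \<ge> 0"
  shows "\<phi> j t \<in> S"
proof -
  let ?B = "\<Union>l\<in>{1..N}. {\<phi> l 0, \<i> *\<^sub>C \<phi> l 0}"
  obtain C where C: "finite C" "span C = S" "pairwise orthogonal C"
    using basis_orthogonal[of ?B] unfolding S by auto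
  define s where "s = (\<Sum>c\<in>C. (inner c (\<phi> j t) / inner c c) *\<^sub>R c)"
  have sS: "s \<in> S" unfolding s_def C(2)[symmetric] by (intro span_sum span_scale span_base)
  define w where "w = \<phi> j t - s"
  have "orthogonal w c" if c: "c \<in> C" for c
  proof -
    have "inner s c = (\<Sum>d\<in>C. if d = c then inner c (\<phi> j t) else 0)"
      unfolding s_def inner_sum_left
    proof (rule sum.cong[OF refl])
      fix d assume d: "d \<in> C"
      have "inner d c = 0" if "d \<noteq> c" using C(3) c d that unfolding pairwise_def orthogonal_def by blast
      then show "inner ((inner d (\<phi> j t) / inner d d) *\<^sub>R d) c = (if d = c then inner c (\<phi> j t) else 0)"
        by (cases "c = 0") auto
    qed
    then have "inner s c = inner c (\<phi> j t)" using c C(1) by simp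
    then show ?thesis unfolding orthogonal_def w_def inner_diff_left by (simp add: inner_commute)
  qed
  then have orth: "orthogonal w x" if "x \<in> S" for x
    using that unfolding C(2)[symmetric] by (rule orthogonal_to_span[rotated])
  have "\<langle>w, \<phi> l 0\<rangle> = 0" if l: "l \<in> {1..N}" for l
  proof -
    have "\<phi> l 0 \<in> S" "\<i> *\<^sub>C \<phi> l 0 \<in> S" unfolding S using l by (auto intro!: span_base)
    then have "inner w (\<phi> l 0) = 0" "inner w (\<i> *\<^sub>C \<phi> l 0) = 0"
      using orth by (auto simp: orthogonal_def)
    then show ?thesis by (simp add: inner_L2_def cinner_scaleC_right complex_eq_iff)
  qed
  then have "\<langle>w, \<phi> j t\<rangle> = 0" by (rule orthogonal_to_flow[OF _ j t])
  then have "inner w (\<phi> j t) = 0" by (simp add: inner_L2_def)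
  moreover have "inner w s = 0" using orth[OF sS] by (simp add: orthogonal_def)
  ultimately have "inner w w = 0" unfolding w_def inner_diff_right[of "\<phi> j t - s" "\<phi> j t" s] by simp
  then have "\<phi> j t = s" by (simp add: w_def)
  then show ?thesis using sS by simp
qed

lemma span_closed_under_scaleC:
  fixes X :: "'a::euclidean_space L2 set"
  assumes "x \<in> span (\<Union>v\<in>X. {v, \<i> *\<^sub>C v})"
  shows "c *\<^sub>C x \<in> span (\<Union>v\<in>X. {v, \<i> *\<^sub>C v})"
proof -
  let ?S = "span (\<Union>v\<in>X. {v, \<i> *\<^sub>C v})"
  have "\<i> *\<^sub>C x \<in> ?S"
    using assms
  proof (induction rule: span_induct_alt)
    case base
    then show ?case by (simp add: span_zero)
  next
    case (step r y z)
    from step(1) obtain v where v: "v \<in> X" "y = v \<or> y = \<i> *\<^sub>C v" by auto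
    then have "v \<in> ?S" "\<i> *\<^sub>C v \<in> ?S" by (auto intro!: span_base)
    then have "\<i> *\<^sub>C y \<in> ?S"
      using v(2) by (auto simp: scaleC_scaleC scaleC_minus_one span_neg)
    then show ?case using step by (simp add: scaleC_add_right scaleC_scaleR span_add span_scale)
  qed
  moreover have "c *\<^sub>C x = Re c *\<^sub>R x + Im c *\<^sub>R (\<i> *\<^sub>C x)"
    unfolding scaleC_of_real[symmetric] scaleC_scaleC scaleC_add_left[symmetric]
    by (metis complex_eq mult.commute)
  ultimately show ?thesis using assms by (simp add: span_add span_scale)
qed

section \<open>Densities and currents\<close>

lemma nn_integral_norm_mult_le:
  "(\<integral>\<^sup>+ x. ennreal (norm (rep_L2 u x) * norm (rep_L2 v x)) \<partial>lborel) \<le> ennreal (norm u * norm v)"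
proof -
  let ?I = "\<integral>\<^sup>+ x. ennreal (norm (rep_L2 u x)) * ennreal (norm (rep_L2 v x)) \<partial>lborel"
  have "?I\<^sup>2 \<le> (\<integral>\<^sup>+ x. (ennreal (norm (rep_L2 u x)))\<^sup>2 \<partial>lborel) * (\<integral>\<^sup>+ x. (ennreal (norm (rep_L2 v x)))\<^sup>2 \<partial>lborel)"
    by (rule Cauchy_Schwarz_nn_integral) measurable
  also have "\<dots> = ennreal ((norm u)\<^sup>2) * ennreal ((norm v)\<^sup>2)"
    by (simp add: norm_sq_L2_nn ennreal_power)
  also have "\<dots> = ennreal ((norm u * norm v)\<^sup>2)" by (simp add: ennreal_mult power_mult_distrib)
  finally have sq: "?I\<^sup>2 \<le> ennreal ((norm u * norm v)\<^sup>2)" .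
  have "?I \<le> ennreal (norm u * norm v)"
  proof (cases ?I)
    case (real r)
    then have "ennreal (r\<^sup>2) \<le> ennreal ((norm u * norm v)\<^sup>2)"
      using sq by (simp add: ennreal_power)
    then have "r\<^sup>2 \<le> (norm u * norm v)\<^sup>2" by (subst (asm) ennreal_le_iff) auto
    then have "r \<le> norm u * norm v" by (rule power2_le_imp_le) simp
    then show ?thesis using real by (simp add: ennreal_leI)
  next
    case top
    then show ?thesis using sq by (simp add: power2_eq_square top_unique ennreal_mult_top)
  qed
  then show ?thesis by (simp add: ennreal_mult)
qed

text \<open>The densities are invariant under a constant phase, so they are compared after removing a
  factor \<open>c\<close> of modulus at most one.\<close>

lemma L1_norm_mass_density_diff_le:
  fixes u v :: "'a::euclidean_space L2"
  assumes c: "cmod c \<le> 1" and uv: "norm u = 1" "norm v = 1"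
  shows "L1_norm (\<lambda>x. mass_density u x - mass_density v x)
    \<le> ennreal (2 * norm (u - c *\<^sub>C v) + (1 - (cmod c)\<^sup>2))"
proof -
  let ?d = "u - c *\<^sub>C v" and ?r = "1 - (cmod c)\<^sup>2"
  have r: "?r \<ge> 0" using c by (simp add: power_le_one)
  have pw: "\<bar>(cmod a)\<^sup>2 - (cmod b)\<^sup>2\<bar> \<le> cmod d * cmod a + cmod d * cmod b + ?r * (cmod b * cmod b)"
    if "d = a - c * b" for a b d
  proof -
    have "\<bar>cmod a - cmod (c * b)\<bar> \<le> cmod d" unfolding that by (rule norm_triangle_ineq3)
    then have "\<bar>cmod a - cmod (c * b)\<bar> * (cmod a + cmod (c * b)) \<le> cmod d * (cmod a + cmod b)"
      using mult_right_mono[OF c, of "cmod b"] by (intro mult_mono) (auto simp: norm_mult)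
    moreover have "(cmod a)\<^sup>2 - (cmod b)\<^sup>2 = (cmod a - cmod (c * b)) * (cmod a + cmod (c * b)) - ?r * (cmod b * cmod b)"
      by (simp add: norm_mult power2_eq_square algebra_simps)
    moreover have "\<bar>(cmod a - cmod (c * b)) * (cmod a + cmod (c * b)) - ?r * (cmod b * cmod b)\<bar>
        \<le> \<bar>cmod a - cmod (c * b)\<bar> * (cmod a + cmod (c * b)) + ?r * (cmod b * cmod b)"
      using r abs_triangle_ineq4[of "(cmod a - cmod (c * b)) * (cmod a + cmod (c * b))" "?r * (cmod b * cmod b)"]
      by (simp add: abs_mult)
    ultimately show ?thesis by (simp add: distrib_left)
  qed
  have "L1_norm (\<lambda>x. mass_density u x - mass_density v x)
      \<le> (\<integral>\<^sup>+ x. ennreal (norm (rep_L2 ?d x) * norm (rep_L2 u x)) + ennreal (norm (rep_L2 ?d x) * norm (rep_L2 v x))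
            + ennreal ?r * ennreal (norm (rep_L2 v x) * norm (rep_L2 v x)) \<partial>lborel)"
    unfolding L1_norm_def
  proof (rule nn_integral_mono_AE)
    show "AE x in lborel. ennreal (norm (mass_density u x - mass_density v x))
       \<le> ennreal (norm (rep_L2 ?d x) * norm (rep_L2 u x)) + ennreal (norm (rep_L2 ?d x) * norm (rep_L2 v x))
            + ennreal ?r * ennreal (norm (rep_L2 v x) * norm (rep_L2 v x))"
      using rep_minus_L2[of u "c *\<^sub>C v"] rep_scaleC[of c v]
    proof eventually_elim
      case (elim x)
      have "norm (mass_density u x - mass_density v x) \<le> norm (rep_L2 ?d x) * norm (rep_L2 u x)
          + norm (rep_L2 ?d x) * norm (rep_L2 v x) + ?r * (norm (rep_L2 v x) * norm (rep_L2 v x))"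
        using pw[of "rep_L2 ?d x" "rep_L2 u x" "rep_L2 v x"] elim by (simp add: mass_density_def)
      from ennreal_leI[OF this] show ?case
        using r by (simp add: ennreal_plus ennreal_mult)
    qed
  qed
  also have "\<dots> = (\<integral>\<^sup>+ x. ennreal (norm (rep_L2 ?d x) * norm (rep_L2 u x)) \<partial>lborel)
      + (\<integral>\<^sup>+ x. ennreal (norm (rep_L2 ?d x) * norm (rep_L2 v x)) \<partial>lborel)
      + ennreal ?r * (\<integral>\<^sup>+ x. ennreal (norm (rep_L2 v x) * norm (rep_L2 v x)) \<partial>lborel)"
    by (simp add: nn_integral_add nn_integral_cmult)
  also have "\<dots> \<le> ennreal (norm ?d * norm u) + ennreal (norm ?d * norm v) + ennreal ?r * ennreal (norm v * norm v)"
    by (intro add_mono mult_left_mono nn_integral_norm_mult_le) auto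
  also have "\<dots> = ennreal (2 * norm ?d + ?r)"
    using r by (simp add: uv ennreal_plus[symmetric] del: ennreal_plus)
  finally show ?thesis .
qed

text \<open>The current is quadratic in the state and its gradient, so besides the norm of \<open>u - c v\<close> the
  estimate needs the size of its gradient.\<close>

lemma L1_norm_current_density_diff_le:
  fixes u v :: "'a::euclidean_space L2"
  assumes c: "cmod c \<le> 1" and uv: "norm u = 1" "norm v = 1" and H1: "u \<in> H1" "v \<in> H1"
    and M: "\<And>b. b \<in> Basis \<Longrightarrow> norm (weak_deriv u b) \<le> M" "\<And>b. b \<in> Basis \<Longrightarrow> norm (weak_deriv v b) \<le> M"
    and \<epsilon>: "\<And>b. b \<in> Basis \<Longrightarrow> norm (weak_deriv (u - c *\<^sub>C v) b) \<le> \<epsilon>"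
  shows "L1_norm (\<lambda>x. current_density u x - current_density v x)
    \<le> ennreal (real DIM('a) * (M * norm (u - c *\<^sub>C v) + \<epsilon> + M * (1 - (cmod c)\<^sup>2)))"
proof -
  let ?d = "u - c *\<^sub>C v" and ?r = "1 - (cmod c)\<^sup>2"
  have r: "?r \<ge> 0" using c by (simp add: power_le_one)
  obtain b0 :: 'a where "b0 \<in> Basis" using nonempty_Basis by blast
  then have M0: "M \<ge> 0" and \<epsilon>0: "\<epsilon> \<ge> 0"
    using M(1) \<epsilon> norm_ge_zero order_trans by blast+
  \<comment> \<open>Expand around \<open>a = c b + d\<close>: the term without \<open>d\<close> differs from the one for \<open>b\<close> by the factor \<open>|c|\<^sup>2\<close>, which is close to one.\<close>
  have pw: "\<bar>Im (cnj a * a') - Im (cnj b * b')\<bar> \<le> cmod d * cmod a' + cmod b * cmod d' + ?r * (cmod b * cmod b')"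
    if d: "d = a - c * b" "d' = a' - c * b'" for a b d a' b' d'
  proof -
    have cc: "c * cnj c = complex_of_real ((cmod c)\<^sup>2)" by (simp only: complex_norm_square)
    have "cnj d * a' + cnj c * cnj b * d' = cnj a * a' - (c * cnj c) * (cnj b * b')"
      unfolding d by (simp add: algebra_simps)
    then have "cnj a * a' - cnj b * b' = cnj d * a' + cnj c * cnj b * d' - complex_of_real ?r * (cnj b * b')"
      unfolding cc by (simp add: algebra_simps)
    then have "\<bar>Im (cnj a * a') - Im (cnj b * b')\<bar>
        = \<bar>Im (cnj d * a' + cnj c * cnj b * d' - complex_of_real ?r * (cnj b * b'))\<bar>"
      by (metis minus_complex.sel(2))
    also have "\<dots> \<le> cmod (cnj d * a' + cnj c * cnj b * d' - complex_of_real ?r * (cnj b * b'))"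
      by (rule abs_Im_le_cmod)
    also have "\<dots> \<le> cmod (cnj d * a') + cmod (cnj c * cnj b * d') + cmod (complex_of_real ?r * (cnj b * b'))"
      by (rule order_trans[OF norm_triangle_ineq4 add_right_mono[OF norm_triangle_ineq]])
    also have "cmod (complex_of_real ?r * (cnj b * b')) = ?r * (cmod b * cmod b')"
      unfolding norm_mult norm_of_real complex_mod_cnj using r by simp
    also have "cmod (cnj c * cnj b * d') \<le> cmod b * cmod d'"
      using mult_right_mono[OF c, of "cmod b * cmod d'"] by (simp add: norm_mult mult_ac)
    finally show ?thesis by (simp add: norm_mult)
  qed
  let ?F = "\<lambda>b x. ennreal (norm (rep_L2 ?d x) * norm (rep_L2 (weak_deriv u b) x))
      + ennreal (norm (rep_L2 v x) * norm (rep_L2 (weak_deriv ?d b) x))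
      + ennreal ?r * ennreal (norm (rep_L2 v x) * norm (rep_L2 (weak_deriv v b) x))"
  have dH: "c *\<^sub>C v \<in> H1" using H1 by (intro H1_scaleC)
  have "L1_norm (\<lambda>x. current_density u x - current_density v x) \<le> (\<integral>\<^sup>+ x. (\<Sum>b\<in>Basis. ?F b x) \<partial>lborel)"
    unfolding L1_norm_def
  proof (rule nn_integral_mono_AE)
    have "AE x in lborel. \<forall>b\<in>(Basis :: 'a set). rep_L2 (weak_deriv ?d b) x = rep_L2 (weak_deriv u b) x - c * rep_L2 (weak_deriv v b) x"
    proof (rule AE_finite_allI[OF finite_Basis])
      fix b :: 'a assume b: "b \<in> Basis"
      have eq: "weak_deriv ?d b = weak_deriv u b - c *\<^sub>C weak_deriv v b"
        using weak_deriv_diff[OF b H1(1) dH] weak_deriv_scaleC[OF b H1(2)] by simp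
      show "AE x in lborel. rep_L2 (weak_deriv ?d b) x = rep_L2 (weak_deriv u b) x - c * rep_L2 (weak_deriv v b) x"
        unfolding eq using rep_minus_L2[of "weak_deriv u b" "c *\<^sub>C weak_deriv v b"] rep_scaleC[of c "weak_deriv v b"]
        by eventually_elim simp
    qed
    then show "AE x in lborel. ennreal (norm (current_density u x - current_density v x)) \<le> (\<Sum>b\<in>Basis. ?F b x)"
      using rep_minus_L2[of u "c *\<^sub>C v"] rep_scaleC[of c v]
    proof eventually_elim
      case (elim x)
      let ?f = "\<lambda>b. norm (rep_L2 ?d x) * norm (rep_L2 (weak_deriv u b) x) + norm (rep_L2 v x) * norm (rep_L2 (weak_deriv ?d b) x)
          + ?r * (norm (rep_L2 v x) * norm (rep_L2 (weak_deriv v b) x))"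
      have "current_density u x - current_density v x = (\<Sum>b\<in>Basis.
          (Im (cnj (rep_L2 u x) * rep_L2 (weak_deriv u b) x) - Im (cnj (rep_L2 v x) * rep_L2 (weak_deriv v b) x)) *\<^sub>R b)"
        by (simp add: current_density_def sum_subtractf scaleR_diff_left)
      also have "norm \<dots> \<le> (\<Sum>b\<in>Basis. ?f b)"
      proof (rule sum_norm_le)
        fix b :: 'a assume b: "b \<in> Basis"
        show "norm ((Im (cnj (rep_L2 u x) * rep_L2 (weak_deriv u b) x) - Im (cnj (rep_L2 v x) * rep_L2 (weak_deriv v b) x)) *\<^sub>R b) \<le> ?f b"
          using pw[of "rep_L2 ?d x" "rep_L2 u x" "rep_L2 v x" "rep_L2 (weak_deriv ?d b) x" "rep_L2 (weak_deriv u b) x" "rep_L2 (weak_deriv v b) x"]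
            elim b by simp
      qed
      finally have "ennreal (norm (current_density u x - current_density v x)) \<le> ennreal (\<Sum>b\<in>Basis. ?f b)"
        by (rule ennreal_leI)
      also have "ennreal (\<Sum>b\<in>Basis. ?f b) = (\<Sum>b\<in>Basis. ennreal (?f b))"
        using r by (intro sum_ennreal[symmetric]) auto
      also have "\<dots> = (\<Sum>b\<in>Basis. ?F b x)"
        using r by (intro sum.cong refl) (simp add: ennreal_plus ennreal_mult)
      finally show ?case .
    qed
  qed
  also have "\<dots> = (\<Sum>b\<in>Basis. (\<integral>\<^sup>+ x. ?F b x \<partial>lborel))"
    by (rule nn_integral_sum) measurable
  also have "\<dots> \<le> (\<Sum>b\<in>(Basis :: 'a set). ennreal (M * norm ?d + \<epsilon> + M * ?r))"
  proof (rule sum_mono)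
    fix b :: 'a assume b: "b \<in> Basis"
    have "(\<integral>\<^sup>+ x. ?F b x \<partial>lborel) = (\<integral>\<^sup>+ x. ennreal (norm (rep_L2 ?d x) * norm (rep_L2 (weak_deriv u b) x)) \<partial>lborel)
      + (\<integral>\<^sup>+ x. ennreal (norm (rep_L2 v x) * norm (rep_L2 (weak_deriv ?d b) x)) \<partial>lborel)
      + ennreal ?r * (\<integral>\<^sup>+ x. ennreal (norm (rep_L2 v x) * norm (rep_L2 (weak_deriv v b) x)) \<partial>lborel)"
      by (simp add: nn_integral_add nn_integral_cmult)
    also have "\<dots> \<le> ennreal (norm ?d * norm (weak_deriv u b)) + ennreal (norm v * norm (weak_deriv ?d b))
        + ennreal ?r * ennreal (norm v * norm (weak_deriv v b))"
      by (intro add_mono mult_left_mono nn_integral_norm_mult_le) auto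
    also have "\<dots> \<le> ennreal (norm ?d * M) + ennreal \<epsilon> + ennreal ?r * ennreal M"
      using M[OF b] \<epsilon>[OF b] by (intro add_mono mult_left_mono ennreal_leI) (auto simp: uv mult_left_mono)
    also have "\<dots> = ennreal (norm ?d * M + \<epsilon> + ?r * M)"
      using r M0 \<epsilon>0 by (simp add: ennreal_plus ennreal_mult)
    finally show "(\<integral>\<^sup>+ x. ?F b x \<partial>lborel) \<le> ennreal (M * norm ?d + \<epsilon> + M * ?r)"
      by (simp only: mult.commute)
  qed
  also have "\<dots> = ennreal (real DIM('a) * (M * norm ?d + \<epsilon> + M * ?r))"
    using r M0 \<epsilon>0 by (simp add: ennreal_mult ennreal_of_nat_eq_real_of_nat)
  finally show ?thesis .
qed

text \<open>Since \<open>|u - \<langle>v, u\<rangle> v|^2 = 1 - |\<langle>v, u\<rangle>|^2\<close> for unit vectors, asymptotic collinearity is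
  convergence of the overlap modulus to one.\<close>

lemma norm_diff_projection_sq:
  fixes u v :: "'a::euclidean_space L2"
  assumes "norm u = 1" "norm v = 1"
  shows "(norm (u - \<langle>v, u\<rangle> *\<^sub>C v))\<^sup>2 = 1 - (cmod \<langle>v, u\<rangle>)\<^sup>2"
proof -
  let ?c = "\<langle>v, u\<rangle>"
  have "complex_of_real ((norm (u - ?c *\<^sub>C v))\<^sup>2) = \<langle>u - ?c *\<^sub>C v, u - ?c *\<^sub>C v\<rangle>" by (rule cinner_self[symmetric])
  also have "\<dots> = \<langle>u, u\<rangle> - ?c * cnj ?c - cnj ?c * ?c + cnj ?c * ?c * \<langle>v, v\<rangle>"
    by (simp add: cinner_diff_left cinner_diff_right cinner_scaleC_left cinner_scaleC_right
        cinner_commute[of u v] algebra_simps)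
  also have "\<dots> = 1 - ?c * cnj ?c" using assms by (simp add: cinner_self)
  also have "\<dots> = complex_of_real (1 - (cmod ?c)\<^sup>2)" by (simp only: complex_norm_square of_real_diff of_real_1)
  finally show ?thesis by (simp only: of_real_eq_iff)
qed

text \<open>The gradient hypothesis concerns all complex combinations of the two states at the same time, so it
  controls the gradient of \<open>u t - \<langle>v t, u t\<rangle> v t\<close> by the norm of this vector, which tends to
  zero.\<close>

lemma densities_synchronize:
  fixes u v :: "real \<Rightarrow> 'a::euclidean_space L2"
  assumes unit: "\<And>t. t \<ge> 0 \<Longrightarrow> norm (u t) = 1" "\<And>t. t \<ge> 0 \<Longrightarrow> norm (v t) = 1"
    and H1: "\<And>t. t \<ge> 0 \<Longrightarrow> u t \<in> H1" "\<And>t. t \<ge> 0 \<Longrightarrow> v t \<in> H1"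
    and M: "\<And>t a c b. t \<ge> 0 \<Longrightarrow> b \<in> Basis \<Longrightarrow>
      norm (weak_deriv (a *\<^sub>C u t + c *\<^sub>C v t) b) \<le> M * norm (a *\<^sub>C u t + c *\<^sub>C v t)"
    and overlap: "((\<lambda>t. cmod \<langle>v t, u t\<rangle>) \<longlongrightarrow> 1) at_top"
  shows "((\<lambda>t. L1_norm (\<lambda>x. mass_density (u t) x - mass_density (v t) x)) \<longlongrightarrow> 0) at_top"
    and "((\<lambda>t. L1_norm (\<lambda>x. current_density (u t) x - current_density (v t) x)) \<longlongrightarrow> 0) at_top"
proof -
  define c where "c = (\<lambda>t. \<langle>v t, u t\<rangle>)"
  define d where "d = (\<lambda>t. norm (u t - c t *\<^sub>C v t))"
  define r where "r = (\<lambda>t. 1 - (cmod (c t))\<^sup>2)"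
  have c1: "cmod (c t) \<le> 1" if "t \<ge> 0" for t
    using cinner_Cauchy_Schwarz[of "v t" "u t"] unit[OF that] by (simp add: c_def)
  have "((\<lambda>t. 1 - (cmod (c t))\<^sup>2) \<longlongrightarrow> 1 - 1\<^sup>2) at_top"
    unfolding c_def by (intro tendsto_diff tendsto_const tendsto_power overlap)
  then have r0: "(r \<longlongrightarrow> 0) at_top" by (simp add: r_def)
  have d_eq: "d t = sqrt (r t)" if "t \<ge> 0" for t
    using norm_diff_projection_sq[OF unit(1)[OF that] unit(2)[OF that]]
    by (simp add: d_def r_def c_def real_sqrt_unique)
  have "((\<lambda>t. sqrt (r t)) \<longlongrightarrow> sqrt 0) at_top" by (rule tendsto_real_sqrt[OF r0])
  moreover have "\<forall>\<^sub>F t in at_top. sqrt (r t) = d t"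
    unfolding eventually_at_top_linorder using d_eq by (intro exI[of _ 0]) auto
  ultimately have d0: "(d \<longlongrightarrow> 0) at_top" using Lim_transform_eventually by fastforce
  have Mu: "norm (weak_deriv (u t) b) \<le> M" "norm (weak_deriv (v t) b) \<le> M" if "t \<ge> 0" "b \<in> Basis" for t b
    using M[OF that, of 1 0] M[OF that, of 0 1] unit[OF that(1)] by simp_all
  have Md: "norm (weak_deriv (u t - c t *\<^sub>C v t) b) \<le> M * d t" if "t \<ge> 0" "b \<in> Basis" for t b
    using M[OF that, of 1 "- c t"] by (simp add: scaleC_minus_left d_def)
  have squeeze: "(F \<longlongrightarrow> 0) at_top"
    if "\<And>t. t \<ge> 0 \<Longrightarrow> F t \<le> ennreal (g t)" and "(g \<longlongrightarrow> 0) at_top" for F :: "real \<Rightarrow> ennreal" and g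
  proof (rule tendsto_sandwich[OF _ _ tendsto_const])
    show "\<forall>\<^sub>F t in at_top. F t \<le> ennreal (g t)"
      unfolding eventually_at_top_linorder using that(1) by (intro exI[of _ 0]) auto
    have "((\<lambda>t. ennreal (g t)) \<longlongrightarrow> ennreal 0) at_top" by (rule tendsto_ennrealI[OF that(2)])
    then show "((\<lambda>t. ennreal (g t)) \<longlongrightarrow> 0) at_top" by simp
  qed simp
  show "((\<lambda>t. L1_norm (\<lambda>x. mass_density (u t) x - mass_density (v t) x)) \<longlongrightarrow> 0) at_top"
  proof (rule squeeze)
    show "L1_norm (\<lambda>x. mass_density (u t) x - mass_density (v t) x) \<le> ennreal (2 * d t + r t)" if "t \<ge> 0" for t
      unfolding d_def r_def by (rule L1_norm_mass_density_diff_le[OF c1[OF that] unit(1)[OF that] unit(2)[OF that]])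
    have "((\<lambda>t. 2 * d t + r t) \<longlongrightarrow> 2 * 0 + 0) at_top"
      by (intro tendsto_add tendsto_mult tendsto_const d0 r0)
    then show "((\<lambda>t. 2 * d t + r t) \<longlongrightarrow> 0) at_top" by simp
  qed
  show "((\<lambda>t. L1_norm (\<lambda>x. current_density (u t) x - current_density (v t) x)) \<longlongrightarrow> 0) at_top"
  proof (rule squeeze)
    show "L1_norm (\<lambda>x. current_density (u t) x - current_density (v t) x)
        \<le> ennreal (real DIM('a) * (M * d t + M * d t + M * r t))" if t: "t \<ge> 0" for t
      unfolding r_def
      using L1_norm_current_density_diff_le[OF c1[OF t] unit(1)[OF t] unit(2)[OF t] H1(1)[OF t] H1(2)[OF t]
          Mu(1)[OF t] Mu(2)[OF t] Md[OF t]]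
      by (simp only: d_def)
    have "((\<lambda>t. real DIM('a) * (M * d t + M * d t + M * r t)) \<longlongrightarrow> real DIM('a) * (M * 0 + M * 0 + M * 0)) at_top"
      by (intro tendsto_add tendsto_mult tendsto_const d0 r0)
    then show "((\<lambda>t. real DIM('a) * (M * d t + M * d t + M * r t)) \<longlongrightarrow> 0) at_top" by simp
  qed
qed

theorem mainTheorem5:
  fixes V :: "'a::euclidean_space \<Rightarrow> real"
    and p K :: real
    and N :: nat
    and \<Omega> :: "nat \<Rightarrow> real"
    and \<psi>init :: "nat \<Rightarrow> 'a L2"
    and \<psi> :: "nat \<Rightarrow> real \<Rightarrow> 'a L2"
  assumes "p > max 1 (real DIM('a) / 2)"
    and "Lp_plus_Linfty p V"
    and "K > 0"
    and "\<And>j. j \<in> {1..N} \<Longrightarrow> \<psi>init j \<in> H1"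
    and "\<And>j. j \<in> {1..N} \<Longrightarrow> norm (\<psi>init j) = 1"
    and "schroedinger_lohe_solution V N K \<Omega> \<psi>init \<psi>"
    and "\<And>j. j \<in> {1..N} \<Longrightarrow> continuous_on_H1 {0..} (\<psi> j)"
    and "(N = 2 \<and> (\<exists>\<omega> \<Lambda>. \<omega> \<ge> 0 \<and> \<Omega> 1 = \<omega> \<and> \<Omega> 2 = - \<omega> \<and> \<Lambda> = 2 * \<omega> / K \<and>
            (0 \<le> \<Lambda> \<and> \<Lambda> < 1 \<and>
               \<langle>\<psi>init 1, \<psi>init 2\<rangle> \<noteq> - complex_of_real (sqrt (1 - \<Lambda>\<^sup>2)) + \<i> * complex_of_real \<Lambda>
             \<or> \<Lambda> = 1 \<and> \<langle>\<psi>init 1, \<psi>init 2\<rangle> \<noteq> \<i>)))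
       \<or> (N \<ge> 2 \<and> (\<forall>j\<in>{1..N}. \<Omega> j = 0) \<and>
          (\<forall>j\<in>{1..N}. Re \<langle>(1 / real N) *\<^sub>R (\<Sum>l=1..N. \<psi> l 0), \<psi>init j\<rangle> > 0))"
  shows "\<forall>j\<in>{1..N}. \<forall>k\<in>{1..N}.
           ((\<lambda>t. L1_norm (\<lambda>x. mass_density (\<psi> j t) x - mass_density (\<psi> k t) x)) \<longlongrightarrow> 0) at_top \<and>
           ((\<lambda>t. L1_norm (\<lambda>x. current_density (\<psi> j t) x - current_density (\<psi> k t) x)) \<longlongrightarrow> 0) at_top"
proof -
  obtain U where grp: "schroedinger_group V U"
    and Duhamel: "\<forall>j\<in>{1..N}. \<forall>t\<ge>0. \<exists>D.
          ((\<lambda>s. U (t - s) (lohe_term N K \<Omega> (\<lambda>l. \<psi> l s) j)) has_integral D) {0..t} \<and>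
          \<psi> j t = U t (\<psi>init j) - \<i> *\<^sub>C D"
    using assms(6) unfolding schroedinger_lohe_solution_def by blast
  have U: "unitary_group U" using grp by (simp add: schroedinger_group_def)
  have N: "N \<ge> 1" using assms(8) by auto
  define \<phi> where "\<phi> = (\<lambda>j t. U (- t) (\<psi> j t))"
  have cont: "continuous_on {0..} (\<psi> j)" if "j \<in> {1..N}" for j
    by (rule continuous_on_H1_imp_continuous_on[OF assms(7)[OF that]])
  have flow: "lohe_flow N K \<Omega> \<phi>" and \<phi>0: "\<And>j. j \<in> {1..N} \<Longrightarrow> \<phi> j 0 = \<psi>init j"
    unfolding \<phi>_def using interaction_picture[OF U assms(3) N assms(5) cont Duhamel] by blast+
  interpret lohe_flow N K \<Omega> \<phi> by (rule flow)
  have \<psi>: "\<psi> j t = U t (\<phi> j t)" for j t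
    by (simp add: \<phi>_def unitary_group_linear(6)[OF U])

  have overlap: "((\<lambda>t. cmod \<langle>\<phi> j t, \<phi> k t\<rangle>) \<longlongrightarrow> 1) at_top" if j: "j \<in> {1..N}" and k: "k \<in> {1..N}" for j k
  proof -
    have detuned: ?thesis if N2: "N = 2" and \<omega>: "\<Omega> 1 = \<omega>" "\<Omega> 2 = - \<omega>" and \<Lambda>: "\<Lambda> = 2 * \<omega> / K"
      and cases: "0 \<le> \<Lambda> \<and> \<Lambda> < 1 \<and>
               \<langle>\<psi>init 1, \<psi>init 2\<rangle> \<noteq> - complex_of_real (sqrt (1 - \<Lambda>\<^sup>2)) + \<i> * complex_of_real \<Lambda>
             \<or> \<Lambda> = 1 \<and> \<langle>\<psi>init 1, \<psi>init 2\<rangle> \<noteq> \<i>" for \<omega> \<Lambda>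
    proof -
      have init: "\<langle>\<phi> 1 0, \<phi> 2 0\<rangle> = \<langle>\<psi>init 1, \<psi>init 2\<rangle>" using \<phi>0[of 1] \<phi>0[of 2] N2 by simp
      have lim12: "((\<lambda>t. cmod \<langle>\<phi> 1 t, \<phi> 2 t\<rangle>) \<longlongrightarrow> 1) at_top"
        using cases
      proof
        assume "0 \<le> \<Lambda> \<and> \<Lambda> < 1 \<and> \<langle>\<psi>init 1, \<psi>init 2\<rangle> \<noteq> - complex_of_real (sqrt (1 - \<Lambda>\<^sup>2)) + \<i> * complex_of_real \<Lambda>"
        then show ?thesis using overlap_limit_subcritical[OF N2 \<omega> \<Lambda>] init by simp
      next
        assume "\<Lambda> = 1 \<and> \<langle>\<psi>init 1, \<psi>init 2\<rangle> \<noteq> \<i>"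
        then show ?thesis using overlap_limit_critical[OF N2 \<omega>] \<Lambda> init by simp
      qed
      show ?thesis
      proof (cases "j = k")
        case True
        have "\<forall>\<^sub>F t in at_top. cmod \<langle>\<phi> j t, \<phi> k t\<rangle> = 1"
          unfolding eventually_at_top_linorder using norm_\<phi>[OF j] True
          by (intro exI[of _ 0]) (simp add: cinner_self)
        then show ?thesis by (rule tendsto_eventually)
      next
        case False
        then have "(j = 1 \<and> k = 2) \<or> (j = 2 \<and> k = 1)" using j k N2 by auto
        moreover have "cmod \<langle>\<phi> 2 t, \<phi> 1 t\<rangle> = cmod \<langle>\<phi> 1 t, \<phi> 2 t\<rangle>" for t
          using cinner_commute[of "\<phi> 2 t" "\<phi> 1 t"] by simp
        ultimately show ?thesis using lim12 by auto
      qed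
    qed
    have identical: ?thesis if \<Omega>0: "\<forall>j\<in>{1..N}. \<Omega> j = 0"
      and pos: "\<forall>j\<in>{1..N}. Re \<langle>(1 / real N) *\<^sub>R (\<Sum>l=1..N. \<psi> l 0), \<psi>init j\<rangle> > 0"
    proof -
      have c: "centroid 0 = (1 / real N) *\<^sub>R (\<Sum>l=1..N. \<psi> l 0)"
        by (simp add: centroid_def \<psi> unitary_groupD(4)[OF U])
      have "Re \<langle>centroid 0, \<psi>init j\<rangle> > 0" unfolding c using pos j by blast
      \<comment> \<open>Positivity of the overlaps makes the initial centroid a non-zero vector.\<close>
      then have "centroid 0 \<noteq> 0" by auto
      then show ?thesis by (rule overlap_limit_identical[OF \<Omega>0 _ j k])
    qed
    show ?thesis using assms(8) detuned identical by blast
  qed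

  define X where "X = \<psi>init ` {1..N}"
  define S where "S = span (\<Union>v\<in>X. {v, \<i> *\<^sub>C v})"
  have fin: "finite (\<Union>v\<in>X. {v, \<i> *\<^sub>C v})" by (simp add: X_def)
  have "X \<subseteq> H1" unfolding X_def using assms(4) by blast
  then have "(\<Union>v\<in>X. {v, \<i> *\<^sub>C v}) \<subseteq> H1" by (auto intro!: H1_scaleC)
  then have "S \<subseteq> H1" unfolding S_def by (rule span_minimal[OF _ subspace_H1])
  then have "\<exists>M\<ge>0. \<forall>x\<in>S. \<forall>t. \<forall>b\<in>Basis. norm (weak_deriv (U t x) b) \<le> M * norm x"
    unfolding S_def
    by (intro span_H1_bound[OF U fin] conjI allI schroedinger_group_H1_bounded[OF assms(1,2) grp]) auto
  then obtain M where M: "\<And>x t b. x \<in> S \<Longrightarrow> b \<in> Basis \<Longrightarrow> norm (weak_deriv (U t x) b) \<le> M * norm x"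
    by blast
  have inS: "\<phi> j t \<in> S" if "j \<in> {1..N}" "t \<ge> 0" for j t
  proof (rule flow_in_span[OF _ that])
    show "S = span (\<Union>l\<in>{1..N}. {\<phi> l 0, \<i> *\<^sub>C \<phi> l 0})"
      unfolding S_def X_def using \<phi>0 by (intro arg_cong[of _ _ span]) auto
  qed
  show ?thesis
  proof (intro ballI)
    fix j k assume j: "j \<in> {1..N}" and k: "k \<in> {1..N}"
    have unit: "norm (\<psi> i t) = 1" if "i \<in> {1..N}" "t \<ge> 0" for i t
      unfolding \<psi> unitary_group_linear(3)[OF U] by (rule norm_\<phi>[OF that])
    have H1: "\<psi> i t \<in> H1" if "i \<in> {1..N}" "t \<ge> 0" for i t
      using assms(7)[OF that(1)] that(2) by (simp add: continuous_on_H1_def)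
    have bound: "norm (weak_deriv (a *\<^sub>C \<psi> j t + c *\<^sub>C \<psi> k t) b) \<le> M * norm (a *\<^sub>C \<psi> j t + c *\<^sub>C \<psi> k t)"
      if t: "t \<ge> 0" and b: "b \<in> Basis" for t a c b
    proof -
      have "a *\<^sub>C \<phi> j t + c *\<^sub>C \<phi> k t \<in> S"
        using inS[OF j t] inS[OF k t] span_closed_under_scaleC unfolding S_def by (intro span_add) blast+
      from M[OF this b, of t] show ?thesis
        by (simp add: \<psi> unitary_groupD(1,2)[OF U, symmetric] unitary_group_linear(3)[OF U])
    qed
    have "((\<lambda>t. cmod \<langle>\<psi> k t, \<psi> j t\<rangle>) \<longlongrightarrow> 1) at_top"
      unfolding \<psi> unitary_groupD(3)[OF U] by (rule overlap[OF k j])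
    from densities_synchronize[OF unit[OF j] unit[OF k] H1[OF j] H1[OF k] bound this]
    show "((\<lambda>t. L1_norm (\<lambda>x. mass_density (\<psi> j t) x - mass_density (\<psi> k t) x)) \<longlongrightarrow> 0) at_top \<and>
           ((\<lambda>t. L1_norm (\<lambda>x. current_density (\<psi> j t) x - current_density (\<psi> k t) x)) \<longlongrightarrow> 0) at_top"
      by blast
  qed
qed

end
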